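(* Let $(M^n,g_t)$ be a smooth closed Ricci flow, let $x\in M$, let $s<t$ be times of the flow, put $\tau=t-s$, and let $d\nu(y)=K(x,t;y,s)\,dg_s(y)$. Let $v\in T_xM$ be a unit vector with respect to $g_t$, and define $$S_v(y)=\left\langle\nabla_x\log K(x,t;y,s),v\right\rangle_{g_t},\qquad y\in M .$$ Let $Z_\tau\sim N(0,1/(2\tau))$. Then for every convex function $\psi:\mathbb R\to\mathbb R$ for which both sides are well-defined, $$\int_M\psi(S_v)\,d\nu\ \le\ \mathbb E\,\psi(Z_\tau).$$
   Context: Ricci flow: $M^n$ is a closed smooth manifold and $g_t$ is a smooth family of Riemannian metrics, parametrized by an interval of times, with $\partial_t g_t=-2\operatorname{Ric}_{g_t}$. Heat kernel: $K(x,t;y,s)$, $s<t$, denotes the heat kernel of the flow, i.e. for fixed $(y,s)$ it is the fundamental solution of $(\partial_t-\Delta_{g_t})u=0$ centered at $(y,s)$; for fixed $(x,t)$ it solves the conjugate heat equation in $(y,s)$ with limit $\delta_x$ as $s\uparrow t$. The measure $\nu$ is a probability measure; $dg_s$ is the Riemannian volume of $g_s$. $\nabla_x$ is the gradient in the basepoint variable $x$ with respect to $g_t$. $N(0,\sigma^2)$ is the centered Gaussian law on $\mathbb R$ with variance $\sigma^2$. *)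

theory Defs
  imports "HOL-Probability.Probability"
begin

section \<open>Smooth functions on subsets of Euclidean space\<close>

text \<open>
  Derivatives are taken within the set, so that one-sided derivatives are used at those end points
  of a time interval that belong to it. On open sets this is the usual notion of a \<open>C\<^sup>k\<close> map; all
  sets used below have the form (open set) times (convex set with nonempty interior), where
  derivatives within the set are unique.
\<close>

primrec Ck_on :: "nat \<Rightarrow> ('a::euclidean_space \<Rightarrow> 'b::real_normed_vector) \<Rightarrow> 'a set \<Rightarrow> bool" where
  "Ck_on 0 f S \<longleftrightarrow> continuous_on S f"
| "Ck_on (Suc k) f S \<longleftrightarrow> f differentiable_on S \<and>
     (\<forall>b\<in>Basis. Ck_on k (\<lambda>x. frechet_derivative f (at x within S) b) S)"

definition smooth_on :: "'a set \<Rightarrow> ('a::euclidean_space \<Rightarrow> 'b::real_normed_vector) \<Rightarrow> bool" where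
  "smooth_on S f \<longleftrightarrow> (\<forall>k. Ck_on k f S)"

definition pderiv_at :: "'n::finite \<Rightarrow> (real^'n \<Rightarrow> real) \<Rightarrow> real^'n \<Rightarrow> real" where
  "pderiv_at i f z = frechet_derivative f (at z) (axis i 1)"


section \<open>Smooth manifolds, tangent vectors, Riemannian metrics\<close>

text \<open>
  The manifold is a topological space given as a type \<open>'m\<close>, with a smooth atlas (not
  required to be maximal). A chart is a pair of a domain and a coordinate map; the values of the
  coordinate map outside the domain are irrelevant. Tensors are described by their components in
  each chart, subject to the transformation law under change of chart.
\<close>

type_synonym ('m, 'n) chart = "'m set \<times> ('m \<Rightarrow> real^'n)"

abbreviation cdom :: "('m, 'n::finite) chart \<Rightarrow> 'm set" where "cdom \<equiv> fst"
abbreviation coord :: "('m, 'n::finite) chart \<Rightarrow> 'm \<Rightarrow> real^'n" where "coord \<equiv> snd"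

definition cimg :: "('m, 'n::finite) chart \<Rightarrow> (real^'n) set" where
  "cimg c = coord c ` cdom c"

definition cinv :: "('m, 'n::finite) chart \<Rightarrow> real^'n \<Rightarrow> 'm" where
  "cinv c = inv_into (cdom c) (coord c)"

definition smooth_atlas ::
    "('m::{t2_space,second_countable_topology}, 'n::finite) chart set \<Rightarrow> bool" where
  "smooth_atlas A \<longleftrightarrow>
     (\<forall>c\<in>A. open (cdom c) \<and> open (cimg c) \<and> homeomorphism (cdom c) (cimg c) (coord c) (cinv c)) \<and>
     (\<Union>c\<in>A. cdom c) = UNIV \<and>
     (\<forall>c\<in>A. \<forall>c'\<in>A. smooth_on (coord c ` (cdom c \<inter> cdom c')) (coord c' \<circ> cinv c))"

definition jacobian ::
    "('m, 'n::finite) chart \<Rightarrow> ('m, 'n) chart \<Rightarrow> 'm \<Rightarrow> real^'n^'n" where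
  "jacobian c c' p = matrix (frechet_derivative (coord c' \<circ> cinv c) (at (coord c p)))"

definition tangent_space ::
    "('m, 'n::finite) chart set \<Rightarrow> 'm \<Rightarrow> (('m, 'n) chart \<Rightarrow> real^'n) set" where
  "tangent_space A p = {v. \<forall>c\<in>A. \<forall>c'\<in>A. p \<in> cdom c \<longrightarrow> p \<in> cdom c' \<longrightarrow>
     v c' = jacobian c c' p *v v c}"

text \<open>\<open>h c p $ i $ j\<close> is the component \<open>h\<^sub>i\<^sub>j\<close> at the point \<open>p\<close> in the chart \<open>c\<close>.\<close>

type_synonym ('m, 'n) metric_field = "('m, 'n) chart \<Rightarrow> 'm \<Rightarrow> real^'n^'n"

definition in_chart :: "('m, 'n::finite) metric_field \<Rightarrow> ('m, 'n) chart \<Rightarrow> real^'n \<Rightarrow> real^'n^'n" where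
  "in_chart h c z = h c (cinv c z)"

definition riemannian_metric ::
    "('m, 'n::finite) chart set \<Rightarrow> ('m, 'n) metric_field \<Rightarrow> bool" where
  "riemannian_metric A h \<longleftrightarrow>
     (\<forall>c\<in>A. smooth_on (cimg c) (in_chart h c)) \<and>
     (\<forall>c\<in>A. \<forall>p\<in>cdom c. transpose (h c p) = h c p \<and> (\<forall>a. a \<noteq> 0 \<longrightarrow> a \<bullet> (h c p *v a) > 0)) \<and>
     (\<forall>c\<in>A. \<forall>c'\<in>A. \<forall>p\<in>cdom c \<inter> cdom c'.
        h c p = transpose (jacobian c c' p) ** h c' p ** jacobian c c' p)"

text \<open>For tangent vectors at \<open>p\<close> the inner product does not depend on the chart chosen here.\<close>

definition metric_inner ::
    "('m, 'n::finite) chart set \<Rightarrow> ('m, 'n) metric_field \<Rightarrow> 'm \<Rightarrow>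
     (('m, 'n) chart \<Rightarrow> real^'n) \<Rightarrow> (('m, 'n) chart \<Rightarrow> real^'n) \<Rightarrow> real" where
  "metric_inner A h p u v =
     (let c = (SOME c. c \<in> A \<and> p \<in> cdom c) in u c \<bullet> (h c p *v v c))"

definition gradient ::
    "('m, 'n::finite) metric_field \<Rightarrow> ('m \<Rightarrow> real) \<Rightarrow> 'm \<Rightarrow> ('m, 'n) chart \<Rightarrow> real^'n" where
  "gradient h f p = (\<lambda>c. matrix_inv (h c p) *v (\<chi> i. pderiv_at i (f \<circ> cinv c) (coord c p)))"

text \<open>
  The Riemannian volume: it has density \<open>\<surd>(det h)\<close> in every chart. On a closed manifold these
  local conditions determine a unique Borel measure.
\<close>

definition riemannian_volume ::
    "('m::topological_space, 'n::finite) chart set \<Rightarrow> ('m, 'n) metric_field \<Rightarrow> 'm measure \<Rightarrow> bool" where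
  "riemannian_volume A h \<mu> \<longleftrightarrow> sets \<mu> = sets borel \<and>
     (\<forall>c\<in>A. \<forall>B\<in>sets borel. B \<subseteq> cdom c \<longrightarrow>
        emeasure \<mu> B = (\<integral>\<^sup>+ z \<in> coord c ` B. ennreal (sqrt (det (in_chart h c z))) \<partial>lborel))"


section \<open>Curvature and Laplacian in local coordinates\<close>

text \<open>Here \<open>h\<close> is the matrix of a metric as a function of the coordinates.\<close>

definition christoffel :: "(real^'n \<Rightarrow> real^'n^'n) \<Rightarrow> 'n::finite \<Rightarrow> 'n \<Rightarrow> 'n \<Rightarrow> real^'n \<Rightarrow> real" where
  "christoffel h k i j z = 1/2 * (\<Sum>l\<in>UNIV. matrix_inv (h z) $ k $ l *
     (pderiv_at i (\<lambda>w. h w $ j $ l) z + pderiv_at j (\<lambda>w. h w $ i $ l) z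
      - pderiv_at l (\<lambda>w. h w $ i $ j) z))"

text \<open>\<open>riemann h l i j k\<close> is the \<open>l\<close>-th component of \<open>R(\<partial>\<^sub>i, \<partial>\<^sub>j) \<partial>\<^sub>k\<close>, where
  \<open>R(X, Y) Z = \<nabla>\<^sub>X \<nabla>\<^sub>Y Z - \<nabla>\<^sub>Y \<nabla>\<^sub>X Z - \<nabla>\<^bsub>[X, Y]\<^esub> Z\<close>.\<close>

definition riemann ::
    "(real^'n \<Rightarrow> real^'n^'n) \<Rightarrow> 'n::finite \<Rightarrow> 'n \<Rightarrow> 'n \<Rightarrow> 'n \<Rightarrow> real^'n \<Rightarrow> real" where
  "riemann h l i j k z =
     pderiv_at i (christoffel h l j k) z - pderiv_at j (christoffel h l i k) z
     + (\<Sum>m\<in>UNIV. christoffel h l i m z * christoffel h m j k z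
                 - christoffel h l j m z * christoffel h m i k z)"

text \<open>\<open>Ric(Y, Z)\<close> is the trace of \<open>X \<mapsto> R(X, Y) Z\<close>; it is positive on round spheres.\<close>

definition ricci :: "(real^'n \<Rightarrow> real^'n^'n) \<Rightarrow> 'n::finite \<Rightarrow> 'n \<Rightarrow> real^'n \<Rightarrow> real" where
  "ricci h j k z = (\<Sum>i\<in>UNIV. riemann h i i j k z)"

definition scalar_curvature :: "(real^'n \<Rightarrow> real^'n^'n) \<Rightarrow> real^'n::finite \<Rightarrow> real" where
  "scalar_curvature h z = (\<Sum>i\<in>UNIV. \<Sum>j\<in>UNIV. matrix_inv (h z) $ i $ j * ricci h i j z)"

definition laplacian :: "(real^'n \<Rightarrow> real^'n^'n) \<Rightarrow> (real^'n \<Rightarrow> real) \<Rightarrow> real^'n::finite \<Rightarrow> real" where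
  "laplacian h f z = (\<Sum>i\<in>UNIV. \<Sum>j\<in>UNIV. matrix_inv (h z) $ i $ j *
     (pderiv_at i (pderiv_at j f) z - (\<Sum>k\<in>UNIV. christoffel h k i j z * pderiv_at k f z)))"


section \<open>Ricci flow and its heat kernel\<close>

definition closed_Ricci_flow ::
    "('m::{t2_space,second_countable_topology}, 'n::finite) chart set \<Rightarrow> real set \<Rightarrow>
     (real \<Rightarrow> ('m, 'n) metric_field) \<Rightarrow> bool" where
  "closed_Ricci_flow A I g \<longleftrightarrow>
     compact (UNIV :: 'm set) \<and> smooth_atlas A \<and> is_interval I \<and>
     (\<forall>t\<in>I. riemannian_metric A (g t)) \<and>
     (\<forall>c\<in>A. smooth_on (cimg c \<times> I) (\<lambda>(z, t). in_chart (g t) c z)) \<and>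
     (\<forall>c\<in>A. \<forall>p\<in>cdom c. \<forall>t\<in>I. \<forall>i j.
        ((\<lambda>t. g t c p $ i $ j) has_real_derivative
           - 2 * ricci (in_chart (g t) c) i j (coord c p)) (at t within I))"

text \<open>
  \<open>K x t y s\<close> is the heat kernel \<open>K(x,t;y,s)\<close> for \<open>s < t\<close> (other values are
  irrelevant), and \<open>vol s\<close> is the Riemannian volume of \<open>g s\<close>. The conditions are, in this order:
  smoothness; \<open>K\<close> is the density of probability measures in \<open>y\<close>; the heat equation in \<open>(x,t)\<close>;
  convergence to the Dirac measure at \<open>y\<close> as \<open>t \<down> s\<close>; the conjugate heat equation
  \<open>\<partial>\<^sub>s K = - \<Delta> K + R K\<close> in \<open>(y,s)\<close>; convergence to the Dirac measure at \<open>x\<close> as \<open>s \<up> t\<close>.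
  Strict positivity of \<open>K\<close> is not required since it fails if the manifold is not connected.
\<close>

definition heat_kernel ::
    "('m::{t2_space,second_countable_topology}, 'n::finite) chart set \<Rightarrow> real set \<Rightarrow>
     (real \<Rightarrow> ('m, 'n) metric_field) \<Rightarrow> (real \<Rightarrow> 'm measure) \<Rightarrow>
     ('m \<Rightarrow> real \<Rightarrow> 'm \<Rightarrow> real \<Rightarrow> real) \<Rightarrow> bool" where
  "heat_kernel A I g vol K \<longleftrightarrow>
     (\<forall>c\<in>A. \<forall>c'\<in>A. smooth_on {(z, t, w, s). z \<in> cimg c \<and> w \<in> cimg c' \<and> s \<in> I \<and> t \<in> I \<and> s < t}
        (\<lambda>(z, t, w, s). K (cinv c z) t (cinv c' w) s)) \<and>
     (\<forall>s\<in>I. \<forall>t\<in>I. s < t \<longrightarrow> (\<forall>x.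
        (\<forall>y. 0 \<le> K x t y s) \<and> prob_space (density (vol s) (\<lambda>y. ennreal (K x t y s))))) \<and>
     (\<forall>s\<in>I. \<forall>t\<in>I. s < t \<longrightarrow> (\<forall>y. \<forall>c\<in>A. \<forall>x\<in>cdom c.
        ((\<lambda>t. K x t y s) has_real_derivative
           laplacian (in_chart (g t) c) (\<lambda>z. K (cinv c z) t y s) (coord c x)) (at t within I))) \<and>
     (\<forall>s\<in>I. \<forall>y. \<forall>f. continuous_on UNIV f \<longrightarrow>
        ((\<lambda>t. \<integral>x. K x t y s * f x \<partial>vol t) \<longlongrightarrow> f y) (at s within (I \<inter> {s<..}))) \<and>
     (\<forall>s\<in>I. \<forall>t\<in>I. s < t \<longrightarrow> (\<forall>x. \<forall>c\<in>A. \<forall>y\<in>cdom c.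
        ((\<lambda>s. K x t y s) has_real_derivative
           - laplacian (in_chart (g s) c) (\<lambda>w. K x t (cinv c w) s) (coord c y)
           + scalar_curvature (in_chart (g s) c) (coord c y) * K x t y s) (at s within I))) \<and>
     (\<forall>t\<in>I. \<forall>x. \<forall>f. continuous_on UNIV f \<longrightarrow>
        ((\<lambda>s. \<integral>y. K x t y s * f y \<partial>vol s) \<longlongrightarrow> f x) (at t within (I \<inter> {..<t})))"


section \<open>Integrals with values in the extended reals\<close>

definition integral_well_defined :: "'a measure \<Rightarrow> ('a \<Rightarrow> real) \<Rightarrow> bool" where
  "integral_well_defined M f \<longleftrightarrow> f \<in> borel_measurable M \<and>
     ((\<integral>\<^sup>+ x. ennreal (f x) \<partial>M) < \<infinity> \<or> (\<integral>\<^sup>+ x. ennreal (- f x) \<partial>M) < \<infinity>)"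

text \<open>Note that \<open>ennreal\<close> maps negative numbers to 0, so these are the integrals of the positive
  and of the negative part.\<close>

definition ext_integral :: "'a measure \<Rightarrow> ('a \<Rightarrow> real) \<Rightarrow> ereal" where
  "ext_integral M f =
     enn2ereal (\<integral>\<^sup>+ x. ennreal (f x) \<partial>M) - enn2ereal (\<integral>\<^sup>+ x. ennreal (- f x) \<partial>M)"

lemma ext_integral_eq_integral:
  assumes "integrable M f"
  shows "ext_integral M f = ereal (integral\<^sup>L M f)"
proof -
  have "(\<integral>\<^sup>+ x. ennreal (f x) \<partial>M) \<noteq> \<infinity>" "(\<integral>\<^sup>+ x. ennreal (- f x) \<partial>M) \<noteq> \<infinity>"
    using assms by (auto simp: real_integrable_def)
  then show ?thesis
    unfolding ext_integral_def real_lebesgue_integral_def[OF assms]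
    by (cases "\<integral>\<^sup>+ x. ennreal (f x) \<partial>M"; cases "\<integral>\<^sup>+ x. ennreal (- f x) \<partial>M")
       (auto simp: enn2ereal_ennreal)
qed

end

theory Submission
  imports Defs
begin

text \<open>For a bounded function \<open>f\<close> on \<open>M\<close> put \<open>u(x, r) = \<integral> K(x, r; y, s) f(y) dg\<^sub>s(y)\<close>. This is a solution of the
  heat equation, and \<open>\<integral> f d\<nu> = u(x, t)\<close>, \<open>\<integral> S\<^sub>v f d\<nu> = \<partial>\<^sub>v u(x, t)\<close>: statements about the law of \<open>S\<^sub>v\<close>
  are gradient estimates for solutions of the heat equation.

  Let \<open>f\<close> take values in a compact subset of \<open>(0, 1)\<close>; so does \<open>u\<close>, since \<open>K\<close> is a probability density. Write
  \<open>u = \<Phi>(h)\<close> with the standard normal distribution function \<open>\<Phi>\<close> and its density \<open>\<phi>\<close>. Since \<open>\<phi>' = - h \<phi>\<close>, the heat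
  equation becomes \<open>\<partial>\<^sub>r h = \<Delta>h - h N\<close> with \<open>N = |\<nabla>h|\<^sup>2\<close>. By Bochner's formula (\<open>bochner\<close>), whose Ricci term
  is cancelled by the derivative of the metric under the Ricci flow,
  \<open>(\<partial>\<^sub>r - \<Delta>) N = - 2 |\<nabla>\<^sup>2h|\<^sup>2 - 2 N\<^sup>2 - 2 h \<langle>\<nabla>N, \<nabla>h\<rangle>\<close>. Hence \<open>\<partial>\<^sub>r N \<le> - 2 N\<^sup>2\<close> at a spatial maximum of \<open>N\<close>
  (\<open>N_derivative_at_max\<close>), and the differential inequality \<open>m' \<le> - 2 m\<^sup>2\<close> for \<open>m = max N\<close> forces
  \<open>N \<le> 1 / (2 (r - s))\<close> whatever the value of \<open>m\<close> at the beginning (\<open>gradient_bound\<close>). With \<open>\<sigma>\<^sup>2 = 1 / (2\<tau>)\<close> this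
  says \<open>\<integral> S\<^sub>v f d\<nu> = \<phi>(h) \<partial>\<^sub>v h \<le> \<sigma> \<phi>(h)\<close> where
  \<open>\<Phi>(h) = \<integral> f d\<nu>\<close> (\<open>dK_bound\<close>).

  Letting \<open>f\<close> tend to the indicator of \<open>{S\<^sub>v > b}\<close> gives
  \<open>\<integral> (S\<^sub>v - b)\<^sup>+ d\<nu> \<le> sup\<^sub>h (\<sigma> \<phi>(h) - b \<Phi>(h)) \<le> \<bbbE> (Z - b)\<^sup>+\<close>, because \<open>\<sigma> \<phi>(h) - b \<Phi>(h)\<close> is the expectation of \<open>Z - b\<close>
  over the event \<open>{Z > - \<sigma> h}\<close> (\<open>score_stop_loss\<close>). Moreover \<open>\<integral> S\<^sub>v d\<nu> = \<partial>\<^sub>v 1 = 0 = \<bbbE> Z\<close>. A convex function is an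
  affine function plus a limit of positive combinations of ramps \<open>(x - b)\<^sup>+\<close> and \<open>(- x - b)\<^sup>+\<close>, so these
  inequalities give the comparison for all convex functions (\<open>ext_integral_convex_le\<close>).

  Everything is done in charts. The quantity \<open>|\<nabla>h|\<^sup>2\<close> is shown to be independent of the chart, so that the
  maximum principle can be run on the compact space \<open>M \<times> [s', r]\<close>, with the computation at the maximum
  made in one chart.\<close>

section \<open>Calculus of \<open>C\<^sup>k\<close> functions on open sets\<close>

abbreviation pd :: "'a \<Rightarrow> ('a::euclidean_space \<Rightarrow> 'b::real_normed_vector) \<Rightarrow> 'a \<Rightarrow> 'b" where
  "pd b f p \<equiv> frechet_derivative f (at p) b"

lemma Ck_on_cong:
  "(\<And>x. x \<in> S \<Longrightarrow> f x = g x) \<Longrightarrow> Ck_on k f S \<longleftrightarrow> Ck_on k g S"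
proof (induction k arbitrary: f g)
  case 0
  then show ?case by (simp cong: continuous_on_cong)
next
  case (Suc k)
  have hd: "(f has_derivative d) (at x within S) \<longleftrightarrow> (g has_derivative d) (at x within S)"
    if "x \<in> S" for x d
  proof
    show "(g has_derivative d) (at x within S)" if "(f has_derivative d) (at x within S)"
      by (rule has_derivative_transform[OF \<open>x \<in> S\<close> _ that]) (simp add: Suc.prems)
    show "(f has_derivative d) (at x within S)" if "(g has_derivative d) (at x within S)"
      by (rule has_derivative_transform[OF \<open>x \<in> S\<close> _ that]) (simp add: Suc.prems)
  qed
  have "f differentiable_on S \<longleftrightarrow> g differentiable_on S"
    unfolding differentiable_on_def differentiable_def using hd by blast
  moreover have "Ck_on k (\<lambda>x. frechet_derivative f (at x within S) b) S \<longleftrightarrow>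
     Ck_on k (\<lambda>x. frechet_derivative g (at x within S) b) S" for b
    by (rule Suc.IH) (simp add: frechet_derivative_def hd)
  ultimately show ?case by simp
qed

lemma Ck_on_Suc_open:
  assumes "open S"
  shows "Ck_on (Suc k) f S \<longleftrightarrow> f differentiable_on S \<and> (\<forall>b\<in>Basis. Ck_on k (pd b f) S)"
proof -
  have "Ck_on k (\<lambda>x. frechet_derivative f (at x within S) b) S \<longleftrightarrow> Ck_on k (pd b f) S" for b
    by (rule Ck_on_cong) (simp add: at_within_open[OF _ assms])
  then show ?thesis by simp
qed

lemma Ck_on_has_derivative:
  assumes "open S" "Ck_on (Suc k) f S" "p \<in> S"
  shows "(f has_derivative frechet_derivative f (at p)) (at p)"
  using assms unfolding Ck_on_Suc_open[OF assms(1)] differentiable_on_def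
  by (metis at_within_open frechet_derivative_works)

lemma Ck_on_SucI:
  assumes S: "open S" and d: "\<And>p. p \<in> S \<Longrightarrow> (f has_derivative f' p) (at p)"
    and k: "\<And>b. b \<in> Basis \<Longrightarrow> Ck_on k (\<lambda>p. f' p b) S"
  shows "Ck_on (Suc k) f S"
  unfolding Ck_on_Suc_open[OF S]
proof (intro conjI ballI)
  show "f differentiable_on S"
    using d by (auto simp: differentiable_on_def differentiable_def intro: has_derivative_at_withinI)
  fix b :: 'a assume b: "b \<in> Basis"
  show "Ck_on k (pd b f) S"
    using k[OF b] by (rule Ck_on_cong[THEN iffD1, rotated]) (simp add: frechet_derivative_at[OF d, symmetric])
qed

lemma Ck_on_pd: "open S \<Longrightarrow> Ck_on (Suc k) f S \<Longrightarrow> b \<in> Basis \<Longrightarrow> Ck_on k (pd b f) S"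
  by (simp only: Ck_on_Suc_open)

lemma Ck_on_SucD: "Ck_on (Suc k) f S \<Longrightarrow> Ck_on k f S"
proof (induction k arbitrary: f)
  case 0
  then show ?case by (simp add: differentiable_imp_continuous_on)
next
  case (Suc k)
  show ?case unfolding Ck_on.simps(2)[of k]
  proof (intro conjI ballI)
    show "f differentiable_on S" using Suc.prems by simp
    fix b :: 'a assume "b \<in> Basis"
    then show "Ck_on k (\<lambda>x. frechet_derivative f (at x within S) b) S"
      using Suc.prems by (intro Suc.IH) simp
  qed
qed

lemma Ck_on_mono: "Ck_on k f S \<Longrightarrow> j \<le> k \<Longrightarrow> Ck_on j f S"
  by (induction k) (auto simp del: Ck_on.simps(2) simp: le_Suc_eq dest: Ck_on_SucD)

lemma Ck_on_continuous: "Ck_on k f S \<Longrightarrow> continuous_on S f"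
  using Ck_on_mono[of k f S 0] by simp

lemma Ck_on_const: "open S \<Longrightarrow> Ck_on k (\<lambda>x. c) S"
proof (induction k arbitrary: c)
  case (Suc k)
  then show ?case by (intro Ck_on_SucI[of _ _ "\<lambda>_ _. 0"]) (auto)
qed simp

lemma Ck_on_add:
  assumes "open S" shows "Ck_on k f S \<Longrightarrow> Ck_on k g S \<Longrightarrow> Ck_on k (\<lambda>x. f x + g x) S"
proof (induction k arbitrary: f g)
  case 0 then show ?case by (simp add: continuous_on_add)
next
  case (Suc k)
  show ?case
    by (rule Ck_on_SucI[OF assms has_derivative_add[OF Ck_on_has_derivative[OF assms Suc.prems(1)]
        Ck_on_has_derivative[OF assms Suc.prems(2)]]])
      (auto intro!: Suc.IH Ck_on_pd[OF assms] Suc.prems simp del: Ck_on.simps)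
qed

lemma Ck_on_mult:
  fixes f g :: "'a::euclidean_space \<Rightarrow> real"
  assumes "open S" shows "Ck_on k f S \<Longrightarrow> Ck_on k g S \<Longrightarrow> Ck_on k (\<lambda>x. f x * g x) S"
proof (induction k arbitrary: f g)
  case 0 then show ?case by (simp add: continuous_on_mult)
next
  case (Suc k)
  show ?case
    by (rule Ck_on_SucI[OF assms has_derivative_mult[OF Ck_on_has_derivative[OF assms Suc.prems(1)]
        Ck_on_has_derivative[OF assms Suc.prems(2)]]])
      (auto intro!: Suc.IH Ck_on_add Ck_on_pd[OF assms] Suc.prems Suc.prems[THEN Ck_on_SucD] assms simp del: Ck_on.simps)
qed

lemma Ck_on_minus:
  fixes f :: "'a::euclidean_space \<Rightarrow> real"
  assumes "open S" "Ck_on k f S" shows "Ck_on k (\<lambda>x. - f x) S"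
  using Ck_on_mult[OF assms(1) Ck_on_const[OF assms(1), of k "-1"] assms(2)] by simp

lemma Ck_on_diff:
  fixes f g :: "'a::euclidean_space \<Rightarrow> real"
  assumes "open S" "Ck_on k f S" "Ck_on k g S" shows "Ck_on k (\<lambda>x. f x - g x) S"
  using Ck_on_add[OF assms(1,2) Ck_on_minus[OF assms(1,3)]] by simp

lemma Ck_on_sum:
  fixes f :: "'i \<Rightarrow> 'a::euclidean_space \<Rightarrow> real"
  assumes "open S" "\<And>i. i \<in> J \<Longrightarrow> Ck_on k (f i) S" shows "Ck_on k (\<lambda>x. \<Sum>i\<in>J. f i x) S"
  using assms(2) by (induction J rule: infinite_finite_induct) (auto intro: Ck_on_add Ck_on_const assms(1))

lemma Ck_on_prod:
  fixes f :: "'i \<Rightarrow> 'a::euclidean_space \<Rightarrow> real"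
  assumes "open S" "\<And>i. i \<in> J \<Longrightarrow> Ck_on k (f i) S" shows "Ck_on k (\<lambda>x. \<Prod>i\<in>J. f i x) S"
  using assms(2) by (induction J rule: infinite_finite_induct) (auto intro: Ck_on_mult Ck_on_const assms(1))

lemma Ck_on_exp:
  fixes f :: "'a::euclidean_space \<Rightarrow> real"
  assumes "open S" shows "Ck_on k f S \<Longrightarrow> Ck_on k (\<lambda>x. exp (f x)) S"
proof (induction k)
  case 0 then show ?case by (simp add: continuous_on_exp)
next
  case (Suc k)
  have "((\<lambda>x. exp (f x)) has_derivative (\<lambda>b. exp (f p) * pd b f p)) (at p)" if "p \<in> S" for p
    by (rule has_derivative_eq_rhs, rule has_derivative_exp[OF Ck_on_has_derivative[OF assms Suc.prems that]])
      (auto simp: mult.commute)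
  then show ?case
    by (rule Ck_on_SucI[OF assms])
      (auto intro!: Suc.IH Ck_on_mult Ck_on_pd[OF assms] Suc.prems Suc.prems[THEN Ck_on_SucD] assms simp del: Ck_on.simps)
qed

lemma Ck_on_inverse:
  fixes f :: "'a::euclidean_space \<Rightarrow> real"
  assumes "open S" and nz: "\<And>x. x \<in> S \<Longrightarrow> f x \<noteq> 0"
  shows "Ck_on k f S \<Longrightarrow> Ck_on k (\<lambda>x. inverse (f x)) S"
proof (induction k)
  case 0 then show ?case using nz by (auto intro!: continuous_on_inverse)
next
  case (Suc k)
  have "((\<lambda>x. inverse (f x)) has_derivative (\<lambda>b. - (inverse (f p) * pd b f p * inverse (f p)))) (at p)" if "p \<in> S" for p
    by (rule Deriv.has_derivative_inverse[OF nz[OF that] Ck_on_has_derivative[OF assms(1) Suc.prems that]])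
  then show ?case
    by (rule Ck_on_SucI[OF assms(1)])
      (auto intro!: Suc.IH Ck_on_minus Ck_on_mult Ck_on_pd[OF assms(1)] Suc.prems Suc.prems[THEN Ck_on_SucD] assms(1) simp del: Ck_on.simps)
qed

lemma Ck_on_bounded_linear:
  assumes "open S" "bounded_linear L" shows "Ck_on k f S \<Longrightarrow> Ck_on k (\<lambda>x. L (f x)) S"
proof (induction k arbitrary: f)
  case 0 then show ?case using bounded_linear.continuous_on[OF assms(2)] by simp
next
  case (Suc k)
  show ?case
    by (rule Ck_on_SucI[OF assms(1) bounded_linear.has_derivative[OF assms(2) Ck_on_has_derivative[OF assms(1) Suc.prems]]])
      (auto intro!: Suc.IH Ck_on_pd[OF assms(1)] Suc.prems simp del: Ck_on.simps)
qed

text \<open>Restriction to a coordinate slice. A derivative within \<open>S\<close> restricts to an ordinary derivative along the open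
  slice \<open>T\<close>. In this way smoothness of the kernel up to an end point of the
  time interval yields smoothness in the remaining variables.\<close>

lemma Ck_on_affine:
  assumes T: "open T" and L: "bounded_linear L" "\<And>b. b \<in> Basis \<Longrightarrow> L b \<in> Basis"
    and img: "\<And>p. p \<in> T \<Longrightarrow> L p + c \<in> S"
  shows "Ck_on k f S \<Longrightarrow> Ck_on k (\<lambda>p. f (L p + c)) T"
proof (induction k arbitrary: f)
  case 0
  have "continuous_on T (\<lambda>p. L p + c)"
    by (intro continuous_intros bounded_linear.continuous_on[OF L(1)])
  then show ?case
    using continuous_on_compose2[of S f T "\<lambda>p. L p + c"] 0 img by (simp add: image_subset_iff)
next
  case (Suc k)
  have "((\<lambda>p. f (L p + c)) has_derivative (\<lambda>b. frechet_derivative f (at (L p + c) within S) (L b))) (at p)"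
    if p: "p \<in> T" for p
  proof -
    have "(f has_derivative frechet_derivative f (at (L p + c) within S)) (at (L p + c) within S)"
      using Suc.prems img[OF p] by (auto simp: differentiable_on_def frechet_derivative_works)
    then have "(f has_derivative frechet_derivative f (at (L p + c) within S)) (at (L p + c) within (\<lambda>p. L p + c) ` T)"
      by (rule has_derivative_subset) (use img in auto)
    moreover have "((\<lambda>p. L p + c) has_derivative L) (at p within T)"
      using has_derivative_add[OF bounded_linear_imp_has_derivative[OF L(1)] has_derivative_const] by simp
    ultimately have "((\<lambda>p. f (L p + c)) has_derivative (\<lambda>b. frechet_derivative f (at (L p + c) within S) (L b))) (at p within T)"
      using diff_chain_within[of "\<lambda>p. L p + c" L p T f] by (simp add: o_def)
    then show ?thesis by (simp add: at_within_open[OF p T])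
  qed
  moreover have "Ck_on k (\<lambda>p. frechet_derivative f (at (L p + c) within S) (L b)) T" if "b \<in> Basis" for b
    using Suc.IH[of "\<lambda>q. frechet_derivative f (at q within S) (L b)"] Suc.prems L(2)[OF that] by simp
  ultimately show ?case by (rule Ck_on_SucI[OF T])
qed

lemma has_real_derivative_line:
  assumes "(f has_derivative f') (at (a + s *\<^sub>R b))"
  shows "((\<lambda>s. f (a + s *\<^sub>R b)) has_real_derivative f' b) (at s)"
proof -
  have "((\<lambda>s. a + s *\<^sub>R b) has_derivative (\<lambda>h. h *\<^sub>R b)) (at s)"
    by (auto intro!: derivative_eq_intros)
  from has_derivative_compose[OF this assms] have "((\<lambda>s. f (a + s *\<^sub>R b)) has_derivative (\<lambda>h. f' (h *\<^sub>R b))) (at s)" .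
  moreover have "(\<lambda>h. f' (h *\<^sub>R b)) = (*) (f' b)"
    using assms by (auto simp: linear_cmul[OF has_derivative_linear])
  ultimately show ?thesis by (simp add: has_field_derivative_def)
qed

text \<open>Two applications of the mean value theorem turn the mixed second difference into a value of the mixed
  derivative near \<open>p\<close>. The difference is symmetric in \<open>b\<close> and \<open>c\<close>, which gives Schwarz's theorem below.\<close>

lemma second_difference_quotient:
  fixes f :: "'a::euclidean_space \<Rightarrow> real"
  assumes S: "open S" and f: "Ck_on 2 f S" and p: "p \<in> S" and bc: "b \<in> Basis" "c \<in> Basis" and e: "e > 0"
  obtains d where "d > 0" "\<And>h. 0 < h \<Longrightarrow> h < d \<Longrightarrow>
     \<bar>(f (p + h *\<^sub>R b + h *\<^sub>R c) - f (p + h *\<^sub>R b) - f (p + h *\<^sub>R c) + f p) / h\<^sup>2 - pd c (pd b f) p\<bar> < e"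
proof -
  have f': "Ck_on (Suc (Suc 0)) f S" using f by (simp add: numeral_2_eq_2)
  have f1: "Ck_on (Suc 0) (pd b f) S" by (rule Ck_on_pd[OF S f' bc(1)])
  have "continuous_on S (pd c (pd b f))" using Ck_on_pd[OF S f1 bc(2)] by simp
  then have "isCont (pd c (pd b f)) p" using S p continuous_on_eq_continuous_at by blast
  then obtain r where r: "r > 0" "\<And>x. dist x p < r \<Longrightarrow> \<bar>pd c (pd b f) x - pd c (pd b f) p\<bar> < e"
    using e unfolding continuous_at_eps_delta dist_real_def by blast
  obtain r' where r': "r' > 0" "ball p r' \<subseteq> S" using S p open_contains_ball by blast
  define d where "d = min r r' / 2"
  have dpos: "d > 0" using r r' by (simp add: d_def)
  have near: "dist (p + x *\<^sub>R b + y *\<^sub>R c) p < min r r'" if "0 \<le> x" "0 \<le> y" "x < d" "y < d" for x y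
  proof -
    have "norm (x *\<^sub>R b + y *\<^sub>R c) \<le> x + y"
      using norm_triangle_ineq[of "x *\<^sub>R b" "y *\<^sub>R c"] that bc by simp
    also have "\<dots> < min r r'" using that by (simp add: d_def)
    finally show ?thesis by (simp add: dist_norm add.assoc)
  qed
  have inS: "p + x *\<^sub>R b + y *\<^sub>R c \<in> S" if "0 \<le> x" "0 \<le> y" "x < d" "y < d" for x y
    using near[OF that] r'(2) by (auto simp: dist_commute subset_eq)
  show ?thesis
  proof (rule that[OF dpos])
    fix h :: real assume h: "0 < h" "h < d"
    define g where "g = (\<lambda>x. f (p + h *\<^sub>R c + x *\<^sub>R b) - f (p + x *\<^sub>R b))"
    define g' where "g' = (\<lambda>x. pd b f (p + h *\<^sub>R c + x *\<^sub>R b) - pd b f (p + x *\<^sub>R b))"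
    have "(g has_real_derivative g' x) (at x)" if "0 \<le> x" "x \<le> h" for x
      unfolding g_def g'_def
      by (intro derivative_intros has_real_derivative_line Ck_on_has_derivative[OF S f'])
        (use inS[of x h] inS[of x 0] that h in \<open>simp_all add: algebra_simps\<close>)
    then have "\<exists>x. 0 < x \<and> x < h \<and> g h - g 0 = (h - 0) * g' x"
      using h by (intro MVT2) auto
    then obtain x where x: "0 < x" "x < h" "g h - g 0 = h * g' x" by auto
    have "((\<lambda>y. pd b f (p + x *\<^sub>R b + y *\<^sub>R c)) has_real_derivative pd c (pd b f) (p + x *\<^sub>R b + y *\<^sub>R c)) (at y)"
      if "0 \<le> y" "y \<le> h" for y
      by (intro has_real_derivative_line Ck_on_has_derivative[OF S f1]) (use inS[of x y] x h that in auto)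
    then have "\<exists>y. 0 < y \<and> y < h \<and> pd b f (p + x *\<^sub>R b + h *\<^sub>R c) - pd b f (p + x *\<^sub>R b + 0 *\<^sub>R c)
       = (h - 0) * pd c (pd b f) (p + x *\<^sub>R b + y *\<^sub>R c)"
      using h by (intro MVT2) auto
    then obtain y where y: "0 < y" "y < h" "pd b f (p + x *\<^sub>R b + h *\<^sub>R c) - pd b f (p + x *\<^sub>R b)
       = h * pd c (pd b f) (p + x *\<^sub>R b + y *\<^sub>R c)" by auto
    have "g' x = h * pd c (pd b f) (p + x *\<^sub>R b + y *\<^sub>R c)"
      using y(3) unfolding g'_def by (simp add: algebra_simps)
    moreover have "g h - g 0 = f (p + h *\<^sub>R b + h *\<^sub>R c) - f (p + h *\<^sub>R b) - f (p + h *\<^sub>R c) + f p"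
      by (simp add: g_def algebra_simps)
    ultimately have "(f (p + h *\<^sub>R b + h *\<^sub>R c) - f (p + h *\<^sub>R b) - f (p + h *\<^sub>R c) + f p) / h\<^sup>2
        = pd c (pd b f) (p + x *\<^sub>R b + y *\<^sub>R c)"
      using x(3) h by (simp add: power2_eq_square field_simps)
    then show "\<bar>(f (p + h *\<^sub>R b + h *\<^sub>R c) - f (p + h *\<^sub>R b) - f (p + h *\<^sub>R c) + f p) / h\<^sup>2 - pd c (pd b f) p\<bar> < e"
      using r(2)[of "p + x *\<^sub>R b + y *\<^sub>R c"] near[of x y] x y h by simp
  qed
qed

lemma pd_commute:
  fixes f :: "'a::euclidean_space \<Rightarrow> real"
  assumes "open S" "Ck_on 2 f S" "p \<in> S" "b \<in> Basis" "c \<in> Basis"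
  shows "pd b (pd c f) p = pd c (pd b f) p"
proof (rule ccontr)
  assume ne: "pd b (pd c f) p \<noteq> pd c (pd b f) p"
  define e where "e = \<bar>pd b (pd c f) p - pd c (pd b f) p\<bar> / 2"
  have e: "e > 0" using ne by (simp add: e_def)
  obtain d1 where d1: "d1 > 0" "\<And>h. 0 < h \<Longrightarrow> h < d1 \<Longrightarrow>
     \<bar>(f (p + h *\<^sub>R b + h *\<^sub>R c) - f (p + h *\<^sub>R b) - f (p + h *\<^sub>R c) + f p) / h\<^sup>2 - pd c (pd b f) p\<bar> < e"
    by (rule second_difference_quotient[OF assms e]) blast
  obtain d2 where d2: "d2 > 0" "\<And>h. 0 < h \<Longrightarrow> h < d2 \<Longrightarrow>
     \<bar>(f (p + h *\<^sub>R c + h *\<^sub>R b) - f (p + h *\<^sub>R c) - f (p + h *\<^sub>R b) + f p) / h\<^sup>2 - pd b (pd c f) p\<bar> < e"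
    by (rule second_difference_quotient[OF assms(1,2,3,5,4) e]) blast
  define h where "h = min d1 d2 / 2"
  have h: "0 < h" "h < d1" "h < d2" using d1(1) d2(1) by (auto simp: h_def)
  define q where "q = (f (p + h *\<^sub>R b + h *\<^sub>R c) - f (p + h *\<^sub>R b) - f (p + h *\<^sub>R c) + f p) / h\<^sup>2"
  have "\<bar>q - pd c (pd b f) p\<bar> < e" using d1(2)[of h] h by (simp add: q_def)
  moreover have "\<bar>q - pd b (pd c f) p\<bar> < e" using d2(2)[of h] h by (simp add: q_def algebra_simps)
  ultimately show False using abs_triangle_ineq[of "q - pd c (pd b f) p" "pd b (pd c f) p - q"] unfolding e_def by argo
qed

section \<open>Partial derivatives in coordinates\<close>

lemma Ck_on_pderiv: "open U \<Longrightarrow> Ck_on (Suc k) f U \<Longrightarrow> Ck_on k (pderiv_at i f) U"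
proof -
  assume "open U" "Ck_on (Suc k) f U"
  moreover have "pderiv_at i f = pd (axis i 1) f" by (simp add: pderiv_at_def fun_eq_iff)
  ultimately show ?thesis using Ck_on_pd[of U k f "axis i 1"] by (simp add: axis_in_Basis_iff)
qed

lemma pderiv_unique: "(f has_derivative f') (at z) \<Longrightarrow> pderiv_at i f z = f' (axis i 1)"
  by (simp add: pderiv_at_def frechet_derivative_at[symmetric])

lemma pderiv_cong:
  assumes "open U" "\<And>w. w \<in> U \<Longrightarrow> f w = h w" "z \<in> U"
  shows "pderiv_at i f z = pderiv_at i h z"
proof -
  have "(f has_derivative d) (at z) \<longleftrightarrow> (h has_derivative d) (at z)" for d
    using has_derivative_transform_within_open[of f d z UNIV U h] has_derivative_transform_within_open[of h d z UNIV U f] assms by auto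
  then show ?thesis by (simp add: pderiv_at_def frechet_derivative_def)
qed

context
  fixes U :: "(real^'n::finite) set" and z
  assumes U: "open U" and z: "z \<in> U"
begin

lemma pderiv_add:
  assumes "Ck_on (Suc 0) f U" "Ck_on (Suc 0) h U"
  shows "pderiv_at i (\<lambda>w. f w + h w) z = pderiv_at i f z + pderiv_at i h z"
  using pderiv_unique[OF has_derivative_add[OF assms[THEN Ck_on_has_derivative[OF U _ z]]]] by (simp add: pderiv_at_def)

lemma pderiv_diff:
  assumes "Ck_on (Suc 0) f U" "Ck_on (Suc 0) h U"
  shows "pderiv_at i (\<lambda>w. f w - h w) z = pderiv_at i f z - pderiv_at i h z"
  using pderiv_unique[OF has_derivative_diff[OF assms[THEN Ck_on_has_derivative[OF U _ z]]]] by (simp add: pderiv_at_def)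

lemma pderiv_mult:
  assumes "Ck_on (Suc 0) f U" "Ck_on (Suc 0) h U"
  shows "pderiv_at i (\<lambda>w. f w * h w) z = pderiv_at i f z * h z + f z * pderiv_at i h z"
  using pderiv_unique[OF has_derivative_mult[OF assms[THEN Ck_on_has_derivative[OF U _ z]]]] by (simp add: pderiv_at_def)

lemma pderiv_const: "pderiv_at i (\<lambda>w. c) z = 0"
  by (simp add: pderiv_at_def)

lemma pderiv_cmult:
  assumes "Ck_on (Suc 0) h U"
  shows "pderiv_at i (\<lambda>w. c * h w) z = c * pderiv_at i h z"
  using pderiv_mult[OF Ck_on_const[OF U] assms] by (simp add: pderiv_const)

lemma pderiv_sum:
  assumes "\<And>j. j \<in> J \<Longrightarrow> Ck_on (Suc 0) (f j) U"
  shows "pderiv_at i (\<lambda>w. \<Sum>j\<in>J. f j w) z = (\<Sum>j\<in>J. pderiv_at i (f j) z)"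
  using pderiv_unique[OF has_derivative_sum[OF assms[THEN Ck_on_has_derivative[OF U _ z]]]] by (simp add: pderiv_at_def)

lemma pderiv_commute:
  assumes "Ck_on 2 f U"
  shows "pderiv_at i (pderiv_at j f) z = pderiv_at j (pderiv_at i f) z"
proof -
  have "pderiv_at k f = pd (axis k 1) f" for k by (simp add: pderiv_at_def fun_eq_iff)
  then show ?thesis using pd_commute[OF U assms z, of "axis i 1" "axis j 1"]
    by (simp add: pderiv_at_def axis_in_Basis_iff)
qed

end

lemma derivative_eq_sum_partials:
  fixes f :: "real^'n::finite \<Rightarrow> real"
  assumes "(f has_derivative f') F"
  shows "f' a = (\<Sum>i\<in>UNIV. a $ i * f' (axis i 1))"
proof -
  have "f' a = f' (\<Sum>i\<in>UNIV. a $ i *\<^sub>R axis i 1)"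
    using basis_expansion[of a] by (simp add: scalar_mult_eq_scaleR)
  also have "\<dots> = (\<Sum>i\<in>UNIV. a $ i * f' (axis i 1))"
    using has_derivative_linear[OF assms] by (simp add: linear_sum linear_cmul)
  finally show ?thesis .
qed

section \<open>Positive semidefinite matrices and matrix inverses\<close>

text \<open>Cholesky decomposition \<open>A = W W\<^sup>T\<close>. It replaces an orthonormal frame: contractions with the inverse metric
  become sums of squares. The induction is over the set of indices of nonzero rows; each step subtracts the
  rank one matrix that clears one row and column.\<close>

lemma psd_matrix_square_root:
  fixes A :: "real^'n::finite^'n"
  assumes "\<And>i j. A $ i $ j = A $ j $ i" "\<And>a. a \<bullet> (A *v a) \<ge> 0"
  obtains W :: "real^'n^'n" where "\<And>i j. A $ i $ j = (\<Sum>k\<in>UNIV. W $ i $ k * W $ j $ k)"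
proof -
  have quad: "a \<bullet> (B *v a) = (\<Sum>i\<in>UNIV. \<Sum>j\<in>UNIV. a $ i * a $ j * B $ i $ j)" for a and B :: "real^'n^'n"
    by (simp add: inner_vec_def matrix_vector_mult_def sum_distrib_left mult_ac)
  have "\<exists>W::real^'n^'n. (\<forall>i j. A $ i $ j = (\<Sum>k\<in>UNIV. W $ i $ k * W $ j $ k)) \<and> (\<forall>i k. k \<notin> T \<longrightarrow> W $ i $ k = 0)"
    if "finite T" "\<And>i j. A $ i $ j = A $ j $ i" "\<And>a. a \<bullet> (A *v a) \<ge> 0" "\<And>i j. i \<notin> T \<Longrightarrow> A $ i $ j = 0" for T :: "'n set" and A
    using that
  proof (induction T arbitrary: A rule: finite_induct)
    case empty
    then show ?case by (intro exI[of _ 0]) auto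
  next
    case (insert p T)
    have diag: "A $ p $ p \<ge> 0"
      using insert.prems(2)[of "axis p 1"] by (simp add: matrix_vector_mult_basis column_def inner_axis')
    have cs: "2 * x * A $ i $ p + A $ i $ i + x\<^sup>2 * A $ p $ p \<ge> 0" if "i \<noteq> p" for x i
    proof -
      have "A *v (x *\<^sub>R axis p 1 + axis i 1) = x *\<^sub>R column p A + column i A"
        by (simp add: matrix_vector_right_distrib matrix_vector_mult_basis matrix_vector_mult_scaleR)
      then have "(x *\<^sub>R axis p 1 + axis i 1) \<bullet> (A *v (x *\<^sub>R axis p 1 + axis i 1)) = 2 * x * A $ i $ p + A $ i $ i + x\<^sup>2 * A $ p $ p"
        by (simp add: inner_add_left inner_axis' column_def power2_eq_square algebra_simps insert.prems(1)[of p i])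
      then show ?thesis using insert.prems(2)[of "x *\<^sub>R axis p 1 + axis i 1"] by simp
    qed
    show ?case
    proof (cases "A $ p $ p = 0")
      case True
      have zero: "A $ i $ p = 0" for i
      proof (cases "i = p")
        case False
        show ?thesis
        proof (rule ccontr)
          assume nz: "A $ i $ p \<noteq> 0"
          \<comment> \<open>With a vanishing diagonal entry the form is affine in \<open>x\<close>; this \<open>x\<close> makes it equal to \<open>-1\<close>.\<close>
          have "2 * (- (A $ i $ i + 1) / (2 * A $ i $ p)) * A $ i $ p + A $ i $ i \<ge> 0"
            using cs[OF False, of "- (A $ i $ i + 1) / (2 * A $ i $ p)"] True by simp
          moreover have "2 * (- (A $ i $ i + 1) / (2 * A $ i $ p)) * A $ i $ p = - (A $ i $ i + 1)"
            using nz by (simp add: field_simps)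
          ultimately show False by simp
        qed
      qed (use True in simp)
      have "\<And>i j. i \<notin> T \<Longrightarrow> A $ i $ j = 0"
        using insert.prems(1,3) zero by (metis insert_iff)
      from insert.IH[OF insert.prems(1,2) this] show ?thesis by blast
    next
      case False
      then have pp: "A $ p $ p > 0" using diag by simp
      \<comment> \<open>Pivot at \<open>p\<close>: the Schur complement is again positive semidefinite, and its row \<open>p\<close> vanishes.\<close>
      define B :: "real^'n^'n" where "B = (\<chi> i j. A $ i $ j - A $ i $ p * A $ j $ p / A $ p $ p)"
      have B0: "B $ i $ p = 0" for i using pp by (simp add: B_def)
      have Bsym: "B $ i $ j = B $ j $ i" for i j by (simp add: B_def insert.prems(1)[of i j] mult.commute)
      have Bpsd: "a \<bullet> (B *v a) \<ge> 0" for a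
      proof -
        define y where "y = (\<Sum>i\<in>UNIV. a $ i * A $ i $ p)"
        \<comment> \<open>Completing the square: \<open>b\<close> minimizes the form over the line through \<open>a\<close> in direction \<open>p\<close>.\<close>
        define b where "b = a - (y / A $ p $ p) *\<^sub>R axis p 1"
        have aAa: "a \<bullet> (A *v a) = (\<Sum>i\<in>UNIV. \<Sum>j\<in>UNIV. a $ i * a $ j * A $ i $ j)" by (rule quad)
        have "a \<bullet> column p A = y" by (simp add: y_def inner_vec_def column_def)
        moreover have "(A *v a) $ p = y"
          by (simp add: y_def matrix_vector_mult_def insert.prems(1)[of p] mult.commute)
        ultimately have "b \<bullet> (A *v b) = a \<bullet> (A *v a) - y\<^sup>2 / A $ p $ p"
          unfolding b_def using pp
          by (simp add: matrix_vector_mult_diff_distrib matrix_vector_mult_scaleR matrix_vector_mult_basis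
              inner_diff_left inner_diff_right inner_axis' column_def power2_eq_square field_simps)
        moreover have "a \<bullet> (B *v a) = a \<bullet> (A *v a) - y\<^sup>2 / A $ p $ p"
        proof -
          have "y\<^sup>2 / A $ p $ p = (\<Sum>i\<in>UNIV. \<Sum>j\<in>UNIV. a $ i * a $ j * (A $ i $ p * A $ j $ p / A $ p $ p))"
            by (simp add: y_def power2_eq_square sum_product sum_divide_distrib mult_ac)
          then show ?thesis unfolding quad[of a B] aAa
            by (simp add: B_def right_diff_distrib sum_subtractf)
        qed
        ultimately show ?thesis using insert.prems(2)[of b] by simp
      qed
      have "\<And>i j. i \<notin> T \<Longrightarrow> B $ i $ j = 0"
        using insert.prems(1,3) B0 Bsym by (metis (no_types, lifting) B_def insert_iff diff_zero div_0 mult_zero_left vec_lambda_beta)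
      from insert.IH[OF Bsym Bpsd this] obtain W :: "real^'n^'n"
        where W: "\<And>i j. B $ i $ j = (\<Sum>k\<in>UNIV. W $ i $ k * W $ j $ k)" "\<And>i k. k \<notin> T \<Longrightarrow> W $ i $ k = 0"
        by blast
      define W' :: "real^'n^'n" where "W' = (\<chi> i k. if k = p then A $ i $ p / sqrt (A $ p $ p) else W $ i $ k)"
      have "A $ i $ j = (\<Sum>k\<in>UNIV. W' $ i $ k * W' $ j $ k)" for i j
      proof -
        have "(\<Sum>k\<in>UNIV. W' $ i $ k * W' $ j $ k) = W' $ i $ p * W' $ j $ p + (\<Sum>k\<in>UNIV - {p}. W' $ i $ k * W' $ j $ k)"
          by (subst sum.remove[of _ p]) auto
        also have "(\<Sum>k\<in>UNIV - {p}. W' $ i $ k * W' $ j $ k) = (\<Sum>k\<in>UNIV - {p}. W $ i $ k * W $ j $ k)"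
          by (intro sum.cong) (auto simp: W'_def)
        also have "\<dots> = (\<Sum>k\<in>UNIV. W $ i $ k * W $ j $ k)"
          using W(2)[of p] insert.hyps by (subst sum.remove[of UNIV p]) auto
        finally show ?thesis using pp by (simp add: W(1)[symmetric] W'_def B_def)
      qed
      moreover have "\<forall>i k. k \<notin> insert p T \<longrightarrow> W' $ i $ k = 0" using W(2) by (auto simp: W'_def)
      ultimately show ?thesis by blast
    qed
  qed
  from this[of UNIV A] assms that show thesis by auto
qed

text \<open>For \<open>A = W W\<^sup>T\<close> the trace of \<open>A b\<close> is the sum of the values of the form \<open>b\<close> on the columns of \<open>W\<close>.\<close>

lemma sum_psd_form_nonpos:
  fixes A :: "real^'n::finite^'n" and b :: "'n \<Rightarrow> 'n \<Rightarrow> real"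
  assumes A: "\<And>i j. A $ i $ j = A $ j $ i" "\<And>a. a \<bullet> (A *v a) \<ge> 0"
    and b: "\<And>a. (\<Sum>i\<in>UNIV. \<Sum>j\<in>UNIV. a i * a j * b i j) \<le> (0::real)"
  shows "(\<Sum>i\<in>UNIV. \<Sum>j\<in>UNIV. A $ i $ j * b i j) \<le> 0"
proof -
  obtain W :: "real^'n^'n" where W: "\<And>i j. A $ i $ j = (\<Sum>k\<in>UNIV. W $ i $ k * W $ j $ k)"
    using psd_matrix_square_root[OF A] by blast
  have "(\<Sum>i\<in>UNIV. \<Sum>j\<in>UNIV. A $ i $ j * b i j) = (\<Sum>i\<in>UNIV. \<Sum>j\<in>UNIV. \<Sum>k\<in>UNIV. W $ i $ k * W $ j $ k * b i j)"
    by (simp add: W sum_distrib_right)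
  also have "\<dots> = (\<Sum>i\<in>UNIV. \<Sum>k\<in>UNIV. \<Sum>j\<in>UNIV. W $ i $ k * W $ j $ k * b i j)"
    by (intro sum.cong refl sum.swap)
  also have "\<dots> = (\<Sum>k\<in>UNIV. \<Sum>i\<in>UNIV. \<Sum>j\<in>UNIV. W $ i $ k * W $ j $ k * b i j)"
    by (rule sum.swap)
  also have "\<dots> \<le> 0" by (intro sum_nonpos b)
  finally show ?thesis .
qed

text \<open>This expresses \<open>|H|\<^sup>2 \<ge> 0\<close> for the norm that \<open>A\<close> induces on bilinear forms \<open>H\<close>.\<close>

lemma sum_psd_square_nonneg:
  fixes A :: "real^'n::finite^'n" and H :: "'n \<Rightarrow> 'n \<Rightarrow> real"
  assumes A: "\<And>i j. A $ i $ j = A $ j $ i" "\<And>a. a \<bullet> (A *v a) \<ge> 0"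
  shows "(\<Sum>l\<in>UNIV. \<Sum>k\<in>UNIV. A $ l $ k * (\<Sum>i\<in>UNIV. H k i * (\<Sum>j\<in>UNIV. A $ i $ j * H l j))) \<ge> 0"
proof -
  have pos: "(\<Sum>i\<in>UNIV. \<Sum>j\<in>UNIV. c i * c j * A $ i $ j) \<ge> 0" for c
    using A(2)[of "\<chi> i. c i"]
    by (simp add: inner_vec_def matrix_vector_mult_def sum_distrib_left mult_ac)
  have "(\<Sum>l\<in>UNIV. \<Sum>k\<in>UNIV. A $ l $ k * - (\<Sum>i\<in>UNIV. \<Sum>j\<in>UNIV. H k i * H l j * A $ i $ j)) \<le> 0"
  proof (rule sum_psd_form_nonpos[OF A])
    fix a :: "'n \<Rightarrow> real"
    have "(\<Sum>l\<in>UNIV. \<Sum>k\<in>UNIV. a l * a k * - (\<Sum>i\<in>UNIV. \<Sum>j\<in>UNIV. H k i * H l j * A $ i $ j))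
      = - (\<Sum>l\<in>UNIV. \<Sum>k\<in>UNIV. \<Sum>i\<in>UNIV. \<Sum>j\<in>UNIV. (a k * H k i) * (a l * H l j) * A $ i $ j)"
      by (simp add: sum_distrib_left sum_negf mult_ac)
    also have "(\<Sum>l\<in>UNIV. \<Sum>k\<in>UNIV. \<Sum>i\<in>UNIV. \<Sum>j\<in>UNIV. (a k * H k i) * (a l * H l j) * A $ i $ j)
      = (\<Sum>k\<in>UNIV. \<Sum>l\<in>UNIV. \<Sum>i\<in>UNIV. \<Sum>j\<in>UNIV. (a k * H k i) * (a l * H l j) * A $ i $ j)"
      by (rule sum.swap)
    also have "\<dots> = (\<Sum>k\<in>UNIV. \<Sum>i\<in>UNIV. \<Sum>l\<in>UNIV. \<Sum>j\<in>UNIV. (a k * H k i) * (a l * H l j) * A $ i $ j)"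
      by (intro sum.cong refl sum.swap)
    also have "\<dots> = (\<Sum>i\<in>UNIV. \<Sum>k\<in>UNIV. \<Sum>l\<in>UNIV. \<Sum>j\<in>UNIV. (a k * H k i) * (a l * H l j) * A $ i $ j)"
      by (rule sum.swap)
    also have "\<dots> = (\<Sum>i\<in>UNIV. \<Sum>k\<in>UNIV. \<Sum>j\<in>UNIV. \<Sum>l\<in>UNIV. (a k * H k i) * (a l * H l j) * A $ i $ j)"
      by (intro sum.cong refl sum.swap)
    also have "\<dots> = (\<Sum>i\<in>UNIV. \<Sum>j\<in>UNIV. \<Sum>k\<in>UNIV. \<Sum>l\<in>UNIV. (a k * H k i) * (a l * H l j) * A $ i $ j)"
      by (intro sum.cong refl sum.swap)
    also have "\<dots> = (\<Sum>i\<in>UNIV. \<Sum>j\<in>UNIV. (\<Sum>k\<in>UNIV. a k * H k i) * (\<Sum>l\<in>UNIV. a l * H l j) * A $ i $ j)"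
      unfolding sum_product by (simp add: sum_distrib_right)
    finally show "(\<Sum>l\<in>UNIV. \<Sum>k\<in>UNIV. a l * a k * - (\<Sum>i\<in>UNIV. \<Sum>j\<in>UNIV. H k i * H l j * A $ i $ j)) \<le> 0"
      using pos[of "\<lambda>i. \<Sum>k\<in>UNIV. a k * H k i"] by simp
  qed
  then show ?thesis by (simp add: sum_negf sum_distrib_left mult_ac)
qed

lemma psd_cauchy_schwarz:
  fixes A :: "real^'n::finite^'n"
  assumes "\<And>i j. A $ i $ j = A $ j $ i" "\<And>a. a \<bullet> (A *v a) \<ge> 0"
  shows "(v \<bullet> (A *v y))\<^sup>2 \<le> (v \<bullet> (A *v v)) * (y \<bullet> (A *v y))"
proof -
  obtain W :: "real^'n^'n" where W: "\<And>i j. A $ i $ j = (\<Sum>k\<in>UNIV. W $ i $ k * W $ j $ k)"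
    using psd_matrix_square_root[OF assms] by blast
  have A: "A = W ** transpose W" by (simp add: vec_eq_iff W matrix_matrix_mult_def transpose_def)
  have *: "a \<bullet> (A *v b) = (a v* W) \<bullet> (b v* W)" for a b
    unfolding A matrix_vector_mul_assoc[symmetric] transpose_matrix_vector dot_lmul_matrix ..
  show ?thesis unfolding * by (rule Cauchy_Schwarz_ineq)
qed

lemma pos_def_invertible:
  fixes A :: "real^'n::finite^'n"
  assumes "\<And>a. a \<noteq> 0 \<Longrightarrow> a \<bullet> (A *v a) > 0"
  shows "invertible A"
proof -
  have "\<forall>x. A *v x = 0 \<longrightarrow> x = 0" using assms by (metis inner_zero_right less_irrefl)
  then show ?thesis by (simp add: invertible_left_inverse matrix_left_invertible_ker)
qed

lemma matrix_inv_right: "invertible (A::real^'n::finite^'n) \<Longrightarrow> A ** matrix_inv A = mat 1"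
  and matrix_inv_left: "invertible (A::real^'n::finite^'n) \<Longrightarrow> matrix_inv A ** A = mat 1"
  unfolding matrix_inv_def invertible_def by (metis (mono_tags, lifting) someI_ex)+

lemma matrix_inv_entry:
  fixes A :: "real^'n::finite^'n"
  assumes "invertible A"
  shows "matrix_inv A $ i $ j = det (\<chi> r c. if c = i then axis j 1 $ r else A $ r $ c) / det A"
proof -
  have d: "det A \<noteq> 0" using assms by (simp add: invertible_det_nz)
  have "A *v column j (matrix_inv A) = axis j 1"
    using matrix_inv_right[OF assms] by (simp add: matrix_vector_mult_basis[symmetric] matrix_vector_mul_assoc)
  then have "column j (matrix_inv A) = (\<chi> k. det (\<chi> r c. if c = k then axis j 1 $ r else A $ r $ c) / det A)"
    using cramer[OF d] by blast
  then show ?thesis by (simp add: column_def vec_eq_iff)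
qed

text \<open>The hypothesis is the derivative of \<open>B A = 1\<close>. It is used for derivatives in space and in time.\<close>

lemma derivative_of_inverse_matrix:
  fixes A B A' B' :: "real^'n::finite^'n"
  assumes "B' ** A + B ** A' = 0" "A ** B = mat 1"
  shows "B' = - (B ** A' ** B)"
proof -
  have "(B' ** A + B ** A') ** B = 0"
    unfolding assms(1) by (simp add: vec_eq_iff matrix_matrix_mult_def)
  moreover have distrib: "(X + Y) ** Z = X ** Z + Y ** Z" for X Y Z :: "real^'n^'n"
    by (simp add: vec_eq_iff matrix_matrix_mult_def distrib_right sum.distrib)
  ultimately have "B' + B ** A' ** B = 0"
    unfolding distrib by (simp add: matrix_mul_assoc[symmetric] assms(2))
  then show ?thesis by (simp add: eq_neg_iff_add_eq_0)
qed

lemma Ck_on_det: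
  assumes "open S" "\<And>i j. Ck_on k (\<lambda>z. A z $ i $ j) S"
  shows "Ck_on k (\<lambda>z. det (A z :: real^'n::finite^'n)) S"
  unfolding det_def using assms by (intro Ck_on_sum Ck_on_mult Ck_on_prod Ck_on_const) auto

lemma Ck_on_matrix_inv:
  fixes A :: "'a::euclidean_space \<Rightarrow> real^'n::finite^'n"
  assumes S: "open S" and A: "\<And>i j. Ck_on k (\<lambda>z. A z $ i $ j) S" and inv: "\<And>z. z \<in> S \<Longrightarrow> invertible (A z)"
  shows "Ck_on k (\<lambda>z. matrix_inv (A z) $ i $ j) S"
proof -
  have *: "Ck_on k (\<lambda>z. det (\<chi> r c. if c = i then axis j 1 $ r else A z $ r $ c) * inverse (det (A z))) S"
  proof (intro Ck_on_mult Ck_on_inverse Ck_on_det S A)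
    fix r c show "Ck_on k (\<lambda>z. (\<chi> r c. if c = i then axis j 1 $ r else A z $ r $ c) $ r $ c) S"
      by (cases "c = i") (simp_all add: A Ck_on_const S)
  qed (use inv in \<open>auto simp: invertible_det_nz\<close>)
  show ?thesis
    by (rule Ck_on_cong[THEN iffD1, OF _ *]) (simp add: matrix_inv_entry[OF inv] divide_inverse)
qed

section \<open>Bochner's formula in coordinates\<close>

text \<open>The metric in one chart. All index computations below follow the usual tensor calculus, with \<open>gi\<close> for the
  inverse metric.\<close>

locale coordinate_metric =
  fixes U :: "(real^'n::finite) set" and g :: "real^'n \<Rightarrow> real^'n^'n"
  assumes open_U: "open U"
    and smooth_metric: "\<And>k i j. Ck_on k (\<lambda>z. g z $ i $ j) U"
    and metric_sym: "\<And>z i j. z \<in> U \<Longrightarrow> g z $ i $ j = g z $ j $ i"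
    and metric_pos: "\<And>z a. z \<in> U \<Longrightarrow> a \<noteq> 0 \<Longrightarrow> a \<bullet> (g z *v a) > 0"
begin

abbreviation gi :: "'n \<Rightarrow> 'n \<Rightarrow> real^'n \<Rightarrow> real" where "gi i j z \<equiv> matrix_inv (g z) $ i $ j"
abbreviation D :: "'n \<Rightarrow> (real^'n \<Rightarrow> real) \<Rightarrow> real^'n \<Rightarrow> real" where "D \<equiv> pderiv_at"
abbreviation \<Gamma> :: "'n \<Rightarrow> 'n \<Rightarrow> 'n \<Rightarrow> real^'n \<Rightarrow> real" where "\<Gamma> \<equiv> christoffel g"

text \<open>The Christoffel symbols of the first kind, the lower index first.\<close>

definition \<Gamma>low :: "'n \<Rightarrow> 'n \<Rightarrow> 'n \<Rightarrow> real^'n \<Rightarrow> real" where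
  "\<Gamma>low m i j z = 1/2 * (D i (\<lambda>w. g w $ j $ m) z + D j (\<lambda>w. g w $ i $ m) z - D m (\<lambda>w. g w $ i $ j) z)"

lemma inv_g: "z \<in> U \<Longrightarrow> invertible (g z)"
  by (rule pos_def_invertible) (rule metric_pos)

lemma sum_g_gi: "z \<in> U \<Longrightarrow> (\<Sum>k\<in>UNIV. g z $ i $ k * gi k j z) = (if i = j then 1 else 0)"
  using matrix_inv_right[OF inv_g] by (simp add: vec_eq_iff matrix_matrix_mult_def mat_def)

lemma sum_gi_g: "z \<in> U \<Longrightarrow> (\<Sum>k\<in>UNIV. gi i k z * g z $ k $ j) = (if i = j then 1 else 0)"
  using matrix_inv_left[OF inv_g] by (simp add: vec_eq_iff matrix_matrix_mult_def mat_def)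

lemma lower_raise: "z \<in> U \<Longrightarrow> (\<Sum>k\<in>UNIV. g z $ i $ k * (\<Sum>l\<in>UNIV. gi k l z * X l)) = X i"
proof -
  assume z: "z \<in> U"
  have "(\<Sum>k\<in>UNIV. g z $ i $ k * (\<Sum>l\<in>UNIV. gi k l z * X l)) = (\<Sum>l\<in>UNIV. (\<Sum>k\<in>UNIV. g z $ i $ k * gi k l z) * X l)"
    by (simp add: sum_distrib_left sum_distrib_right mult.assoc) (rule sum.swap)
  then show ?thesis by (simp add: sum_g_gi[OF z] if_distrib[of "\<lambda>x. x * _"] cong: if_cong)
qed

lemma raise_lower: "z \<in> U \<Longrightarrow> (\<Sum>k\<in>UNIV. gi i k z * (\<Sum>l\<in>UNIV. g z $ k $ l * X l)) = X i"
proof -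
  assume z: "z \<in> U"
  have "(\<Sum>k\<in>UNIV. gi i k z * (\<Sum>l\<in>UNIV. g z $ k $ l * X l)) = (\<Sum>l\<in>UNIV. (\<Sum>k\<in>UNIV. gi i k z * g z $ k $ l) * X l)"
    by (simp add: sum_distrib_left sum_distrib_right mult.assoc) (rule sum.swap)
  then show ?thesis by (simp add: sum_gi_g[OF z] if_distrib[of "\<lambda>x. x * _"] cong: if_cong)
qed

lemma gi_sym: assumes z: "z \<in> U" shows "gi i j z = gi j i z"
proof -
  have "(\<Sum>l\<in>UNIV. g z $ k $ l * gi j l z) = (if j = k then 1 else 0)" for k
    using sum_gi_g[OF z, of j k] by (simp add: metric_sym[OF z, of k] mult.commute)
  with raise_lower[OF z, of i "\<lambda>l. gi j l z"] show ?thesis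
    by (simp add: if_distrib[of "\<lambda>x. _ * x"] cong: if_cong)
qed

lemma gi_pos:
  assumes z: "z \<in> U"
  shows "a \<bullet> (matrix_inv (g z) *v a) \<ge> 0"
proof -
  define b where "b = matrix_inv (g z) *v a"
  have "g z *v b = a" by (simp add: b_def matrix_vector_mul_assoc matrix_inv_right[OF inv_g[OF z]])
  then have "a \<bullet> b = b \<bullet> (g z *v b)" by (simp add: inner_commute)
  also have "\<dots> \<ge> 0" using metric_pos[OF z, of b] by (cases "b = 0") auto
  finally show ?thesis by (simp add: b_def)
qed

lemma Ck_gi: "Ck_on k (gi i j) U"
  by (rule Ck_on_matrix_inv[OF open_U smooth_metric inv_g])

lemma Ck_D: "Ck_on (Suc k) f U \<Longrightarrow> Ck_on k (D i f) U"
  by (rule Ck_on_pderiv[OF open_U])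

lemma Ck_\<Gamma>: "Ck_on k (\<Gamma> l i j) U"
  unfolding christoffel_def
  by (intro Ck_on_mult Ck_on_sum Ck_on_const Ck_on_add Ck_on_diff open_U Ck_gi Ck_D smooth_metric)

lemma Ck_\<Gamma>low: "Ck_on k (\<Gamma>low l i j) U"
  unfolding \<Gamma>low_def[abs_def]
  by (intro Ck_on_mult Ck_on_sum Ck_on_const Ck_on_add Ck_on_diff open_U Ck_gi Ck_D smooth_metric)

lemma D_metric_sym: "z \<in> U \<Longrightarrow> D l (\<lambda>w. g w $ i $ j) z = D l (\<lambda>w. g w $ j $ i) z"
  by (rule pderiv_cong[OF open_U]) (auto simp: metric_sym)

lemma \<Gamma>_sym: "z \<in> U \<Longrightarrow> \<Gamma> k i j z = \<Gamma> k j i z"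
  unfolding christoffel_def by (simp add: D_metric_sym[of z _ i j] add.commute)

lemma \<Gamma>_raise: "\<Gamma> k i j z = (\<Sum>l\<in>UNIV. gi k l z * \<Gamma>low l i j z)"
  by (simp add: christoffel_def \<Gamma>low_def sum_distrib_left mult_ac)

lemma \<Gamma>_lower: "z \<in> U \<Longrightarrow> (\<Sum>k\<in>UNIV. g z $ m $ k * \<Gamma> k i j z) = \<Gamma>low m i j z"
  by (simp add: \<Gamma>_raise lower_raise)

text \<open>The metric is parallel: \<open>\<partial>\<^sub>l g\<^sub>i\<^sub>j\<close> consists of Christoffel terms only.\<close>

lemma D_metric: "z \<in> U \<Longrightarrow> D l (\<lambda>w. g w $ i $ j) z = \<Gamma>low j l i z + \<Gamma>low i l j z"
  unfolding \<Gamma>low_def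
  using D_metric_sym[of z i l j] D_metric_sym[of z j l i] D_metric_sym[of z l i j]
  by (simp add: field_simps)

lemma D_inverse_metric:
  assumes z: "z \<in> U"
  shows "D l (gi i m) z = - (\<Sum>k\<in>UNIV. \<Gamma> i l k z * gi k m z) - (\<Sum>k\<in>UNIV. gi i k z * \<Gamma> m l k z)"
proof -
  define B' where "B' = (\<chi> i j. D l (gi i j) z)"
  define A' where "A' = (\<chi> i j. D l (\<lambda>w. g w $ i $ j) z)"
  have "(B' ** g z + matrix_inv (g z) ** A') $ i $ j = 0" for i j
  proof -
    have "D l (\<lambda>w. \<Sum>k\<in>UNIV. gi i k w * g w $ k $ j) z = D l (\<lambda>w. if i = j then 1 else 0) z"
      by (rule pderiv_cong[OF open_U _ z]) (rule sum_gi_g)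
    then have "D l (\<lambda>w. \<Sum>k\<in>UNIV. gi i k w * g w $ k $ j) z = 0" by (cases "i = j") (simp_all add: pderiv_const[OF open_U z])
    then have "(\<Sum>k\<in>UNIV. D l (gi i k) z * g z $ k $ j + gi i k z * D l (\<lambda>w. g w $ k $ j) z) = 0"
      by (simp add: pderiv_sum[OF open_U z] pderiv_mult[OF open_U z] Ck_on_mult[OF open_U] Ck_gi smooth_metric del: Ck_on.simps)
    then show ?thesis by (simp add: matrix_matrix_mult_def B'_def A'_def sum.distrib)
  qed
  then have "B' ** g z + matrix_inv (g z) ** A' = 0" by (simp add: vec_eq_iff)
  from derivative_of_inverse_matrix[OF this matrix_inv_right[OF inv_g[OF z]]]
  have "D l (gi i m) z = - (matrix_inv (g z) ** A' ** matrix_inv (g z)) $ i $ m"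
    by (auto simp: B'_def vec_eq_iff)
  also have "\<dots> = - (\<Sum>k\<in>UNIV. \<Sum>j\<in>UNIV. gi i j z * (\<Gamma>low k l j z + \<Gamma>low j l k z) * gi k m z)"
    by (simp add: matrix_matrix_mult_def A'_def D_metric[OF z] sum_distrib_right)
  also have "\<dots> = - (\<Sum>k\<in>UNIV. \<Sum>j\<in>UNIV. gi i j z * \<Gamma>low k l j z * gi k m z) - (\<Sum>k\<in>UNIV. \<Sum>j\<in>UNIV. gi i j z * \<Gamma>low j l k z * gi k m z)"
    by (simp add: algebra_simps sum.distrib)
  also have "(\<Sum>k\<in>UNIV. \<Sum>j\<in>UNIV. gi i j z * \<Gamma>low k l j z * gi k m z) = (\<Sum>j\<in>UNIV. \<Sum>k\<in>UNIV. gi i j z * \<Gamma>low k l j z * gi k m z)"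
    by (rule sum.swap)
  also have "\<dots> = (\<Sum>j\<in>UNIV. gi i j z * \<Gamma> m l j z)"
    by (simp add: \<Gamma>_raise sum_distrib_left gi_sym[OF z, of m] mult_ac)
  also have "(\<Sum>k\<in>UNIV. \<Sum>j\<in>UNIV. gi i j z * \<Gamma>low j l k z * gi k m z) = (\<Sum>k\<in>UNIV. \<Gamma> i l k z * gi k m z)"
    by (simp add: \<Gamma>_raise sum_distrib_right)
  finally show ?thesis by simp
qed

text \<open>Lowering the upper index of the curvature tensor. The derivatives of the metric produced by moving \<open>g\<close>
  inside the derivatives cancel half of the quadratic terms.\<close>

lemma sum_g_riemann:
  assumes z: "z \<in> U"
  shows "(\<Sum>m\<in>UNIV. g z $ p $ m * riemann g m l i k z) =
     D l (\<Gamma>low p i k) z - D i (\<Gamma>low p l k) z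
     - (\<Sum>m\<in>UNIV. \<Gamma>low m l p z * \<Gamma> m i k z) + (\<Sum>m\<in>UNIV. \<Gamma>low m i p z * \<Gamma> m l k z)"
proof -
  have Dlow: "(\<Sum>m\<in>UNIV. g z $ p $ m * D l (\<Gamma> m i k) z)
      = D l (\<Gamma>low p i k) z - (\<Sum>m\<in>UNIV. (\<Gamma>low m l p z + \<Gamma>low p l m z) * \<Gamma> m i k z)" for l i
  proof -
    have "D l (\<Gamma>low p i k) z = D l (\<lambda>w. \<Sum>m\<in>UNIV. g w $ p $ m * \<Gamma> m i k w) z"
      by (rule pderiv_cong[OF open_U _ z]) (simp add: \<Gamma>_lower)
    also have "\<dots> = (\<Sum>m\<in>UNIV. D l (\<lambda>w. g w $ p $ m) z * \<Gamma> m i k z + g z $ p $ m * D l (\<Gamma> m i k) z)"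
      by (simp add: pderiv_sum[OF open_U z] pderiv_mult[OF open_U z] Ck_on_mult[OF open_U] Ck_\<Gamma> smooth_metric del: Ck_on.simps)
    finally show ?thesis by (simp add: D_metric[OF z] sum.distrib algebra_simps)
  qed
  have quad: "(\<Sum>m\<in>UNIV. g z $ p $ m * (\<Sum>q\<in>UNIV. \<Gamma> m l q z * \<Gamma> q i k z)) = (\<Sum>q\<in>UNIV. \<Gamma>low p l q z * \<Gamma> q i k z)" for l i
  proof -
    have "(\<Sum>m\<in>UNIV. g z $ p $ m * (\<Sum>q\<in>UNIV. \<Gamma> m l q z * \<Gamma> q i k z)) = (\<Sum>m\<in>UNIV. \<Sum>q\<in>UNIV. g z $ p $ m * \<Gamma> m l q z * \<Gamma> q i k z)"
      by (simp add: sum_distrib_left mult_ac)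
    also have "\<dots> = (\<Sum>q\<in>UNIV. \<Sum>m\<in>UNIV. g z $ p $ m * \<Gamma> m l q z * \<Gamma> q i k z)" by (rule sum.swap)
    also have "\<dots> = (\<Sum>q\<in>UNIV. \<Gamma>low p l q z * \<Gamma> q i k z)"
      by (simp add: \<Gamma>_lower[OF z, symmetric] sum_distrib_right)
    finally show ?thesis .
  qed
  have "(\<Sum>m\<in>UNIV. g z $ p $ m * riemann g m l i k z) =
     (\<Sum>m\<in>UNIV. g z $ p $ m * D l (\<Gamma> m i k) z) - (\<Sum>m\<in>UNIV. g z $ p $ m * D i (\<Gamma> m l k) z)
     + (\<Sum>m\<in>UNIV. g z $ p $ m * (\<Sum>q\<in>UNIV. \<Gamma> m l q z * \<Gamma> q i k z))
     - (\<Sum>m\<in>UNIV. g z $ p $ m * (\<Sum>q\<in>UNIV. \<Gamma> m i q z * \<Gamma> q l k z))"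
    by (simp add: riemann_def algebra_simps sum.distrib sum_subtractf)
  then show ?thesis
    unfolding Dlow quad by (simp add: algebra_simps sum.distrib)
qed

lemma sum_\<Gamma>low_\<Gamma>_swap:
  assumes z: "z \<in> U"
  shows "(\<Sum>m\<in>UNIV. \<Gamma>low m a b z * \<Gamma> m c d z) = (\<Sum>m\<in>UNIV. \<Gamma>low m c d z * \<Gamma> m a b z)"
proof -
  have "(\<Sum>m\<in>UNIV. \<Gamma>low m a b z * \<Gamma> m c d z) = (\<Sum>m\<in>UNIV. \<Sum>q\<in>UNIV. \<Gamma>low m a b z * gi m q z * \<Gamma>low q c d z)"
    by (simp add: \<Gamma>_raise sum_distrib_left mult_ac)
  also have "\<dots> = (\<Sum>q\<in>UNIV. \<Sum>m\<in>UNIV. \<Gamma>low m a b z * gi m q z * \<Gamma>low q c d z)" by (rule sum.swap)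
  also have "\<dots> = (\<Sum>q\<in>UNIV. \<Gamma>low q c d z * \<Gamma> q a b z)"
    by (simp add: \<Gamma>_raise sum_distrib_left gi_sym[OF z, of _ _] mult_ac)
  finally show ?thesis .
qed

text \<open>In the sum over both orders of the last two indices, the first order terms become second derivatives of the
  metric, which commute, and the quadratic terms cancel by symmetry of \<open>gi\<close>.\<close>

lemma riemann_antisym:
  assumes z: "z \<in> U"
  shows "(\<Sum>m\<in>UNIV. g z $ p $ m * riemann g m l i k z) = - (\<Sum>m\<in>UNIV. g z $ k $ m * riemann g m l i p z)"
proof -
  have D2: "D l (\<Gamma>low p i k) z + D l (\<Gamma>low k i p) z = D l (D i (\<lambda>w. g w $ p $ k)) z" for l i
  proof -
    have "D l (\<lambda>w. \<Gamma>low p i k w + \<Gamma>low k i p w) z = D l (D i (\<lambda>w. g w $ p $ k)) z"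
      by (rule pderiv_cong[OF open_U _ z]) (simp add: D_metric)
    then show ?thesis by (simp add: pderiv_add[OF open_U z] Ck_\<Gamma>low del: Ck_on.simps)
  qed
  have "D l (D i (\<lambda>w. g w $ p $ k)) z = D i (D l (\<lambda>w. g w $ p $ k)) z"
    by (rule pderiv_commute[OF open_U z smooth_metric])
  then show ?thesis
    unfolding sum_g_riemann[OF z]
    using D2[of l i] D2[of i l] sum_\<Gamma>low_\<Gamma>_swap[OF z, of l p i k] sum_\<Gamma>low_\<Gamma>_swap[OF z, of i p l k] by linarith
qed

text \<open>This identifies the curvature term in Bochner's formula: antisymmetry moves the contraction to the pair of
  indices that defines the Ricci tensor.\<close>

lemma contracted_riemann:
  assumes z: "z \<in> U"
  shows "(\<Sum>l\<in>UNIV. \<Sum>k\<in>UNIV. gi l k z * (\<Sum>m\<in>UNIV. riemann g m l i k z * u m)) =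
     - (\<Sum>m\<in>UNIV. ricci g i m z * (\<Sum>j\<in>UNIV. gi m j z * u j))"
proof -
  define V where "V p = (\<Sum>j\<in>UNIV. gi p j z * u j)" for p
  have low: "(\<Sum>m\<in>UNIV. riemann g m l i k z * u m) = - (\<Sum>p\<in>UNIV. V p * (\<Sum>m\<in>UNIV. g z $ k $ m * riemann g m l i p z))" for l k
  proof -
    have "(\<Sum>m\<in>UNIV. riemann g m l i k z * u m) = (\<Sum>m\<in>UNIV. \<Sum>p\<in>UNIV. riemann g m l i k z * g z $ m $ p * V p)"
      using lower_raise[OF z, of _ u, folded V_def] by (simp add: mult.assoc sum_distrib_left[symmetric])
    also have "\<dots> = (\<Sum>p\<in>UNIV. \<Sum>m\<in>UNIV. riemann g m l i k z * g z $ m $ p * V p)" by (rule sum.swap)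
    also have "\<dots> = (\<Sum>p\<in>UNIV. V p * (\<Sum>m\<in>UNIV. g z $ p $ m * riemann g m l i k z))"
      by (simp add: sum_distrib_left metric_sym[OF z] mult_ac)
    finally show ?thesis unfolding riemann_antisym[OF z, of _ l i k] by (simp add: sum_negf)
  qed
  have "(\<Sum>k\<in>UNIV. gi l k z * (\<Sum>m\<in>UNIV. riemann g m l i k z * u m)) = - (\<Sum>p\<in>UNIV. V p * riemann g l l i p z)" for l
  proof -
    have "(\<Sum>k\<in>UNIV. gi l k z * (\<Sum>m\<in>UNIV. riemann g m l i k z * u m)) =
      - (\<Sum>k\<in>UNIV. \<Sum>p\<in>UNIV. V p * (gi l k z * (\<Sum>m\<in>UNIV. g z $ k $ m * riemann g m l i p z)))"
      unfolding low by (simp add: sum_distrib_left sum_negf mult_ac)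
    also have "(\<Sum>k\<in>UNIV. \<Sum>p\<in>UNIV. V p * (gi l k z * (\<Sum>m\<in>UNIV. g z $ k $ m * riemann g m l i p z))) =
      (\<Sum>p\<in>UNIV. \<Sum>k\<in>UNIV. V p * (gi l k z * (\<Sum>m\<in>UNIV. g z $ k $ m * riemann g m l i p z)))" by (rule sum.swap)
    also have "\<dots> = (\<Sum>p\<in>UNIV. V p * riemann g l l i p z)"
      by (simp add: sum_distrib_left[symmetric] raise_lower[OF z])
    finally show ?thesis .
  qed
  then have "(\<Sum>l\<in>UNIV. \<Sum>k\<in>UNIV. gi l k z * (\<Sum>m\<in>UNIV. riemann g m l i k z * u m)) =
    - (\<Sum>l\<in>UNIV. \<Sum>p\<in>UNIV. V p * riemann g l l i p z)" by (simp add: sum_negf)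
  also have "(\<Sum>l\<in>UNIV. \<Sum>p\<in>UNIV. V p * riemann g l l i p z) = (\<Sum>p\<in>UNIV. \<Sum>l\<in>UNIV. V p * riemann g l l i p z)"
    by (rule sum.swap)
  also have "\<dots> = (\<Sum>p\<in>UNIV. ricci g i p z * V p)"
    by (simp add: ricci_def sum_distrib_left mult.commute)
  finally show ?thesis unfolding V_def .
qed

end

locale coordinate_function = coordinate_metric U g for U :: "(real^'n::finite) set" and g +
  fixes f :: "real^'n \<Rightarrow> real"
  assumes f3: "Ck_on 3 f U"
begin

text \<open>\<open>H\<close>, \<open>V\<close>, \<open>N\<close> and \<open>hess_sq\<close> are \<open>\<nabla>\<^sup>2f\<close>, \<open>\<nabla>f\<close>, \<open>|\<nabla>f|\<^sup>2\<close> and \<open>|\<nabla>\<^sup>2f|\<^sup>2\<close> in coordinates.\<close>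

definition H :: "'n \<Rightarrow> 'n \<Rightarrow> real^'n \<Rightarrow> real" where
  "H i j z = D i (D j f) z - (\<Sum>k\<in>UNIV. \<Gamma> k i j z * D k f z)"

definition V :: "'n \<Rightarrow> real^'n \<Rightarrow> real" where
  "V i z = (\<Sum>j\<in>UNIV. gi i j z * D j f z)"

definition N :: "real^'n \<Rightarrow> real" where
  "N z = (\<Sum>i\<in>UNIV. V i z * D i f z)"

definition hess_sq :: "real^'n \<Rightarrow> real" where
  "hess_sq z = (\<Sum>l\<in>UNIV. \<Sum>k\<in>UNIV. gi l k z * (\<Sum>i\<in>UNIV. H k i z * (\<Sum>j\<in>UNIV. gi i j z * H l j z)))"

lemma Ck_Df: "Ck_on 2 (D i f) U"
proof -
  have "Ck_on (Suc 2) f U" using f3 by (simp add: eval_nat_numeral del: Ck_on.simps)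
  then show ?thesis by (rule Ck_D)
qed

lemma Ck_DDf: "Ck_on 1 (D i (D j f)) U"
proof -
  have "Ck_on (Suc 1) (D j f) U" using Ck_Df by (simp add: eval_nat_numeral del: Ck_on.simps)
  then show ?thesis by (rule Ck_D)
qed

lemma Ck_Df1: "Ck_on (Suc 0) (D i f) U" by (rule Ck_on_mono[OF Ck_Df]) simp

lemmas Ck_DDf1 = Ck_DDf[unfolded One_nat_def]

lemma laplacian_eq: "laplacian g f z = (\<Sum>l\<in>UNIV. \<Sum>k\<in>UNIV. gi l k z * H l k z)"
  by (simp add: laplacian_def H_def)

lemma D2f_commute: "z \<in> U \<Longrightarrow> D i (D j f) z = D j (D i f) z"
  by (rule pderiv_commute[OF open_U]) (auto intro: Ck_on_mono[OF f3])

lemma H_sym: "z \<in> U \<Longrightarrow> H i j z = H j i z"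
  unfolding H_def by (simp add: D2f_commute \<Gamma>_sym[of z _ i j])

lemma Ck_H: "Ck_on (Suc 0) (H i j) U"
  unfolding H_def[abs_def]
  by (intro Ck_on_diff Ck_on_sum Ck_on_mult open_U Ck_\<Gamma> Ck_DDf1 Ck_Df1)

lemma Ck_V: "Ck_on 2 (V i) U"
  unfolding V_def[abs_def] by (intro Ck_on_sum Ck_on_mult open_U Ck_gi Ck_Df)

lemma Ck_V1: "Ck_on (Suc 0) (V i) U" by (rule Ck_on_mono[OF Ck_V]) simp

lemma Ck_N: "Ck_on 2 N U"
  unfolding N_def[abs_def] by (intro Ck_on_sum Ck_on_mult open_U Ck_V Ck_Df)

text \<open>That is, \<open>\<nabla>\<^sub>l V\<^sup>i = g\<^sup>i\<^sup>j H\<^sub>l\<^sub>j\<close>, since the inverse metric is parallel.\<close>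

lemma D_V:
  assumes z: "z \<in> U"
  shows "D l (V i) z = (\<Sum>j\<in>UNIV. gi i j z * H l j z) - (\<Sum>m\<in>UNIV. \<Gamma> i l m z * V m z)"
proof -
  have "D l (V i) z = (\<Sum>j\<in>UNIV. D l (gi i j) z * D j f z + gi i j z * D l (D j f) z)"
    unfolding V_def[abs_def]
    by (simp add: pderiv_sum[OF open_U z] pderiv_mult[OF open_U z] Ck_on_mult[OF open_U] Ck_gi Ck_Df1 del: Ck_on.simps)
  also have "\<dots> = (\<Sum>j\<in>UNIV. D l (gi i j) z * D j f z) + (\<Sum>j\<in>UNIV. gi i j z * (H l j z + (\<Sum>k\<in>UNIV. \<Gamma> k l j z * D k f z)))"
    by (simp add: sum.distrib H_def)
  also have "(\<Sum>j\<in>UNIV. D l (gi i j) z * D j f z) =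
     - (\<Sum>j\<in>UNIV. \<Sum>k\<in>UNIV. \<Gamma> i l k z * (gi k j z * D j f z)) - (\<Sum>j\<in>UNIV. \<Sum>k\<in>UNIV. gi i k z * (\<Gamma> j l k z * D j f z))"
    by (simp add: D_inverse_metric[OF z] algebra_simps sum_negf sum_distrib_right sum_distrib_left sum.distrib sum_subtractf)
  also have "(\<Sum>j\<in>UNIV. \<Sum>k\<in>UNIV. \<Gamma> i l k z * (gi k j z * D j f z)) = (\<Sum>k\<in>UNIV. \<Sum>j\<in>UNIV. \<Gamma> i l k z * (gi k j z * D j f z))"
    by (rule sum.swap)
  also have "\<dots> = (\<Sum>k\<in>UNIV. \<Gamma> i l k z * V k z)" by (simp add: V_def sum_distrib_left)
  also have "(\<Sum>j\<in>UNIV. \<Sum>k\<in>UNIV. gi i k z * (\<Gamma> j l k z * D j f z)) = (\<Sum>k\<in>UNIV. \<Sum>j\<in>UNIV. gi i k z * (\<Gamma> j l k z * D j f z))"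
    by (rule sum.swap)
  finally show ?thesis by (simp add: sum_distrib_left sum.distrib distrib_left)
qed

lemma D_N:
  assumes z: "z \<in> U"
  shows "D k N z = 2 * (\<Sum>i\<in>UNIV. H k i z * V i z)"
proof -
  have "D k N z = (\<Sum>i\<in>UNIV. D k (V i) z * D i f z + V i z * D k (D i f) z)"
    unfolding N_def[abs_def]
    by (simp add: pderiv_sum[OF open_U z] pderiv_mult[OF open_U z] Ck_on_mult[OF open_U] Ck_V1 Ck_Df1 del: Ck_on.simps)
  also have "\<dots> = (\<Sum>i\<in>UNIV. D k (V i) z * D i f z) + (\<Sum>i\<in>UNIV. V i z * (H k i z + (\<Sum>m\<in>UNIV. \<Gamma> m k i z * D m f z)))"
    by (simp add: sum.distrib H_def)
  also have "(\<Sum>i\<in>UNIV. D k (V i) z * D i f z) =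
      (\<Sum>i\<in>UNIV. \<Sum>j\<in>UNIV. gi i j z * H k j z * D i f z) - (\<Sum>i\<in>UNIV. \<Sum>m\<in>UNIV. \<Gamma> i k m z * V m z * D i f z)"
    by (simp add: D_V[OF z] left_diff_distrib sum_subtractf sum_distrib_right)
  also have "(\<Sum>i\<in>UNIV. \<Sum>j\<in>UNIV. gi i j z * H k j z * D i f z) = (\<Sum>j\<in>UNIV. \<Sum>i\<in>UNIV. gi i j z * H k j z * D i f z)"
    by (rule sum.swap)
  also have "\<dots> = (\<Sum>j\<in>UNIV. H k j z * V j z)"
    unfolding V_def sum_distrib_left by (intro sum.cong refl) (simp add: gi_sym[OF z] mult_ac)
  also have "(\<Sum>i\<in>UNIV. \<Sum>m\<in>UNIV. \<Gamma> i k m z * V m z * D i f z) = (\<Sum>m\<in>UNIV. \<Sum>i\<in>UNIV. \<Gamma> i k m z * V m z * D i f z)"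
    by (rule sum.swap)
  finally show ?thesis by (simp add: sum.distrib distrib_left sum_distrib_left mult_ac)
qed

lemma D_D_N:
  assumes z: "z \<in> U"
  shows "D l (D k N) z = 2 * (\<Sum>i\<in>UNIV. D l (H k i) z * V i z)
     + 2 * (\<Sum>i\<in>UNIV. H k i z * (\<Sum>j\<in>UNIV. gi i j z * H l j z))
     - 2 * (\<Sum>i\<in>UNIV. H k i z * (\<Sum>m\<in>UNIV. \<Gamma> i l m z * V m z))"
proof -
  have "D l (D k N) z = D l (\<lambda>w. 2 * (\<Sum>i\<in>UNIV. H k i w * V i w)) z"
    by (rule pderiv_cong[OF open_U _ z]) (rule D_N)
  also have "\<dots> = 2 * (\<Sum>i\<in>UNIV. D l (H k i) z * V i z + H k i z * D l (V i) z)"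
    by (simp add: pderiv_cmult[OF open_U z] pderiv_sum[OF open_U z] pderiv_mult[OF open_U z] Ck_on_mult[OF open_U] Ck_on_sum[OF open_U] Ck_V1 Ck_H del: Ck_on.simps)
  finally show ?thesis by (simp add: D_V[OF z] sum.distrib right_diff_distrib sum_subtractf algebra_simps)
qed

text \<open>The Ricci identity: the third derivatives of \<open>f\<close> are symmetric, so exchanging the order of two covariant
  derivatives of \<open>df\<close> leaves only a curvature term.\<close>

lemma D_H_commute:
  assumes z: "z \<in> U"
  shows "D l (H i k) z = D i (H l k) z - (\<Sum>m\<in>UNIV. \<Gamma> m i k z * H l m z) + (\<Sum>m\<in>UNIV. \<Gamma> m l k z * H i m z)
     - (\<Sum>m\<in>UNIV. riemann g m l i k z * D m f z)"
proof -
  have DH: "D l (H i k) z = D l (D i (D k f)) z - (\<Sum>m\<in>UNIV. D l (\<Gamma> m i k) z * D m f z + \<Gamma> m i k z * D l (D m f) z)" for l i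
    unfolding H_def[abs_def]
    by (simp add: pderiv_diff[OF open_U z] pderiv_sum[OF open_U z] pderiv_mult[OF open_U z] Ck_on_mult[OF open_U] Ck_on_sum[OF open_U] Ck_\<Gamma> Ck_Df1 Ck_DDf1 del: Ck_on.simps)
  have com: "D l (D i (D k f)) z = D i (D l (D k f)) z"
    by (rule pderiv_commute[OF open_U z Ck_Df])
  have H: "(\<Sum>m\<in>UNIV. \<Gamma> m i k z * H l m z) = (\<Sum>m\<in>UNIV. \<Gamma> m i k z * D l (D m f) z) - (\<Sum>m\<in>UNIV. \<Sum>q\<in>UNIV. \<Gamma> q l m z * \<Gamma> m i k z * D q f z)" for l i
    by (simp add: H_def right_diff_distrib sum_subtractf sum_distrib_left mult_ac)
  have swap: "(\<Sum>m\<in>UNIV. \<Sum>q\<in>UNIV. \<Gamma> q l m z * \<Gamma> m i k z * D q f z) = (\<Sum>q\<in>UNIV. \<Sum>m\<in>UNIV. \<Gamma> q l m z * \<Gamma> m i k z * D q f z)" for l i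
    by (rule sum.swap)
  have R: "(\<Sum>m\<in>UNIV. riemann g m l i k z * D m f z) =
     (\<Sum>m\<in>UNIV. D l (\<Gamma> m i k) z * D m f z) - (\<Sum>m\<in>UNIV. D i (\<Gamma> m l k) z * D m f z)
     + (\<Sum>q\<in>UNIV. \<Sum>m\<in>UNIV. \<Gamma> q l m z * \<Gamma> m i k z * D q f z) - (\<Sum>q\<in>UNIV. \<Sum>m\<in>UNIV. \<Gamma> q i m z * \<Gamma> m l k z * D q f z)"
    by (simp add: riemann_def algebra_simps sum.distrib sum_subtractf sum_distrib_left sum_distrib_right)
  show ?thesis unfolding DH H swap R com by (simp add: sum.distrib)
qed

text \<open>The derivative of \<open>g\<^sup>l\<^sup>k\<close> contributes two Christoffel terms, equal by symmetry of \<open>g\<close> and \<open>H\<close>; together with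
  \<open>\<partial>\<^sub>i H\<^sub>l\<^sub>k\<close> they form the trace of the covariant derivative \<open>\<nabla>\<^sub>i H\<close>.\<close>

lemma D_laplacian:
  assumes z: "z \<in> U"
  shows "D i (laplacian g f) z = (\<Sum>l\<in>UNIV. \<Sum>k\<in>UNIV. gi l k z * D i (H l k) z)
     - 2 * (\<Sum>l\<in>UNIV. \<Sum>k\<in>UNIV. gi l k z * (\<Sum>m\<in>UNIV. \<Gamma> m i k z * H l m z))"
proof -
  have "D i (laplacian g f) z = D i (\<lambda>z. \<Sum>l\<in>UNIV. \<Sum>k\<in>UNIV. gi l k z * H l k z) z"
    by (simp add: laplacian_eq[abs_def])
  also have "\<dots> = (\<Sum>l\<in>UNIV. \<Sum>k\<in>UNIV. D i (gi l k) z * H l k z + gi l k z * D i (H l k) z)"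
    by (simp add: pderiv_sum[OF open_U z] pderiv_mult[OF open_U z] Ck_on_mult[OF open_U] Ck_on_sum[OF open_U] Ck_gi Ck_H del: Ck_on.simps)
  also have "\<dots> = (\<Sum>l\<in>UNIV. \<Sum>k\<in>UNIV. D i (gi l k) z * H l k z) + (\<Sum>l\<in>UNIV. \<Sum>k\<in>UNIV. gi l k z * D i (H l k) z)"
    by (simp add: sum.distrib)
  also have "(\<Sum>l\<in>UNIV. \<Sum>k\<in>UNIV. D i (gi l k) z * H l k z) =
     - (\<Sum>l\<in>UNIV. \<Sum>k\<in>UNIV. \<Sum>m\<in>UNIV. \<Gamma> l i m z * gi m k z * H l k z)
     - (\<Sum>l\<in>UNIV. \<Sum>k\<in>UNIV. \<Sum>m\<in>UNIV. gi l m z * \<Gamma> k i m z * H l k z)"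
    by (simp add: D_inverse_metric[OF z] algebra_simps sum_negf sum_distrib_right sum_distrib_left sum.distrib sum_subtractf)
  also have "(\<Sum>l\<in>UNIV. \<Sum>k\<in>UNIV. \<Sum>m\<in>UNIV. gi l m z * \<Gamma> k i m z * H l k z)
     = (\<Sum>l\<in>UNIV. \<Sum>m\<in>UNIV. \<Sum>k\<in>UNIV. gi l m z * \<Gamma> k i m z * H l k z)"
    by (intro sum.cong refl sum.swap)
  also have "(\<Sum>l\<in>UNIV. \<Sum>k\<in>UNIV. \<Sum>m\<in>UNIV. \<Gamma> l i m z * gi m k z * H l k z)
     = (\<Sum>k\<in>UNIV. \<Sum>l\<in>UNIV. \<Sum>m\<in>UNIV. \<Gamma> l i m z * gi m k z * H l k z)"
    by (rule sum.swap)
  also have "\<dots> = (\<Sum>k\<in>UNIV. \<Sum>m\<in>UNIV. \<Sum>l\<in>UNIV. \<Gamma> l i m z * gi m k z * H l k z)"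
    by (intro sum.cong refl sum.swap)
  also have "\<dots> = (\<Sum>l\<in>UNIV. \<Sum>m\<in>UNIV. \<Sum>k\<in>UNIV. gi l m z * \<Gamma> k i m z * H l k z)"
  proof (intro sum.cong refl)
    fix k m l show "\<Gamma> l i m z * gi m k z * H l k z = gi k m z * \<Gamma> l i m z * H k l z"
      using gi_sym[OF z, of m k] H_sym[OF z, of l k] by simp
  qed
  finally show ?thesis by (simp add: sum_distrib_left sum_negf mult.assoc)
qed

text \<open>Bochner's formula. Both derivatives of \<open>N = V\<^sup>i \<partial>\<^sub>if\<close> are expressed by \<open>H\<close>; the term with \<open>\<nabla>H\<close> is rewritten by
  the Ricci identity so that its trace becomes \<open>\<nabla>\<Delta>f\<close> plus the contracted curvature.\<close>

lemma bochner:
  assumes z: "z \<in> U"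
  shows "laplacian g N z = 2 * (\<Sum>i\<in>UNIV. V i z * D i (laplacian g f) z)
     + 2 * hess_sq z + 2 * (\<Sum>i\<in>UNIV. \<Sum>m\<in>UNIV. ricci g i m z * V i z * V m z)"
proof -
  define B where "B i l k = D l (H k i) z - (\<Sum>m\<in>UNIV. \<Gamma> m l i z * H k m z) - (\<Sum>m\<in>UNIV. \<Gamma> m l k z * H m i z)" for i l k
  have contr: "(\<Sum>l\<in>UNIV. \<Sum>k\<in>UNIV. gi l k z * B i l k) = D i (laplacian g f) z + (\<Sum>m\<in>UNIV. ricci g i m z * V m z)" for i
  proof -
    have B: "B i l k = D i (H l k) z - (\<Sum>m\<in>UNIV. \<Gamma> m i k z * H l m z) - (\<Sum>m\<in>UNIV. \<Gamma> m i l z * H k m z)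
        - (\<Sum>m\<in>UNIV. riemann g m l i k z * D m f z)" for l k
    proof -
      have "D l (H k i) z = D l (H i k) z" by (rule pderiv_cong[OF open_U _ z]) (rule H_sym)
      then show ?thesis
        unfolding B_def by (simp add: D_H_commute[OF z, of l i k] H_sym[OF z, of _ i] \<Gamma>_sym[OF z, of _ l i])
    qed
    have "(\<Sum>l\<in>UNIV. \<Sum>k\<in>UNIV. gi l k z * (\<Sum>m\<in>UNIV. \<Gamma> m i l z * H k m z))
      = (\<Sum>k\<in>UNIV. \<Sum>l\<in>UNIV. gi l k z * (\<Sum>m\<in>UNIV. \<Gamma> m i l z * H k m z))" by (rule sum.swap)
    also have "\<dots> = (\<Sum>l\<in>UNIV. \<Sum>k\<in>UNIV. gi l k z * (\<Sum>m\<in>UNIV. \<Gamma> m i k z * H l m z))"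
      by (intro sum.cong refl) (simp add: gi_sym[OF z])
    finally show ?thesis
      unfolding B using contracted_riemann[OF z, of i "\<lambda>m. D m f z", folded V_def]
      by (simp add: right_diff_distrib sum_subtractf D_laplacian[OF z])
  qed
  have lap: "D l (D k N) z - (\<Sum>m\<in>UNIV. \<Gamma> m l k z * D m N z) =
      2 * (\<Sum>i\<in>UNIV. V i z * B i l k) + 2 * (\<Sum>i\<in>UNIV. H k i z * (\<Sum>j\<in>UNIV. gi i j z * H l j z))" for l k
  proof -
    have "(\<Sum>i\<in>UNIV. H k i z * (\<Sum>m\<in>UNIV. \<Gamma> i l m z * V m z)) = (\<Sum>i\<in>UNIV. \<Sum>m\<in>UNIV. V m z * (\<Gamma> i l m z * H k i z))"
      by (simp add: sum_distrib_left mult_ac)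
    also have "\<dots> = (\<Sum>m\<in>UNIV. \<Sum>i\<in>UNIV. V m z * (\<Gamma> i l m z * H k i z))" by (rule sum.swap)
    finally have 1: "(\<Sum>i\<in>UNIV. H k i z * (\<Sum>m\<in>UNIV. \<Gamma> i l m z * V m z)) = (\<Sum>i\<in>UNIV. V i z * (\<Sum>m\<in>UNIV. \<Gamma> m l i z * H k m z))"
      by (simp add: sum_distrib_left)
    have "(\<Sum>m\<in>UNIV. \<Gamma> m l k z * D m N z) = 2 * (\<Sum>m\<in>UNIV. \<Sum>i\<in>UNIV. V i z * (\<Gamma> m l k z * H m i z))"
      by (simp add: D_N[OF z] sum_distrib_left mult_ac)
    also have "(\<Sum>m\<in>UNIV. \<Sum>i\<in>UNIV. V i z * (\<Gamma> m l k z * H m i z)) = (\<Sum>i\<in>UNIV. \<Sum>m\<in>UNIV. V i z * (\<Gamma> m l k z * H m i z))"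
      by (rule sum.swap)
    finally have 2: "(\<Sum>m\<in>UNIV. \<Gamma> m l k z * D m N z) = 2 * (\<Sum>i\<in>UNIV. V i z * (\<Sum>m\<in>UNIV. \<Gamma> m l k z * H m i z))"
      by (simp add: sum_distrib_left)
    show ?thesis unfolding D_D_N[OF z] 1 2 B_def
      by (simp add: right_diff_distrib sum_subtractf mult.commute[of "D _ _ _"])
  qed
  have "laplacian g N z = (\<Sum>l\<in>UNIV. \<Sum>k\<in>UNIV. gi l k z * (2 * (\<Sum>i\<in>UNIV. V i z * B i l k) + 2 * (\<Sum>i\<in>UNIV. H k i z * (\<Sum>j\<in>UNIV. gi i j z * H l j z))))"
    unfolding laplacian_def lap ..
  also have "\<dots> = 2 * (\<Sum>l\<in>UNIV. \<Sum>k\<in>UNIV. gi l k z * (\<Sum>i\<in>UNIV. V i z * B i l k)) + 2 * hess_sq z"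
  proof -
    have "(\<Sum>l\<in>UNIV. \<Sum>k\<in>UNIV. a l k * (2 * X l k + 2 * Y l k)) =
      2 * (\<Sum>l\<in>UNIV. \<Sum>k\<in>UNIV. a l k * X l k) + 2 * (\<Sum>l\<in>UNIV. \<Sum>k\<in>UNIV. a l k * Y l k)"
      for a X Y :: "'n \<Rightarrow> 'n \<Rightarrow> real"
      by (simp add: distrib_left sum.distrib sum_distrib_left mult_ac)
    then show ?thesis unfolding hess_sq_def .
  qed
  also have "(\<Sum>l\<in>UNIV. \<Sum>k\<in>UNIV. gi l k z * (\<Sum>i\<in>UNIV. V i z * B i l k)) = (\<Sum>l\<in>UNIV. \<Sum>k\<in>UNIV. \<Sum>i\<in>UNIV. V i z * (gi l k z * B i l k))"
    by (simp add: sum_distrib_left mult_ac)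
  also have "\<dots> = (\<Sum>l\<in>UNIV. \<Sum>i\<in>UNIV. \<Sum>k\<in>UNIV. V i z * (gi l k z * B i l k))"
    by (intro sum.cong refl sum.swap)
  also have "\<dots> = (\<Sum>i\<in>UNIV. \<Sum>l\<in>UNIV. \<Sum>k\<in>UNIV. V i z * (gi l k z * B i l k))" by (rule sum.swap)
  also have "\<dots> = (\<Sum>i\<in>UNIV. V i z * (\<Sum>l\<in>UNIV. \<Sum>k\<in>UNIV. gi l k z * B i l k))"
    by (simp add: sum_distrib_left)
  finally show ?thesis unfolding contr
    by (simp add: distrib_left sum.distrib sum_distrib_left mult_ac)
qed

lemma hess_sq_nonneg: "z \<in> U \<Longrightarrow> hess_sq z \<ge> 0"
  unfolding hess_sq_def by (rule sum_psd_square_nonneg) (auto intro: gi_sym gi_pos)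

end

section \<open>The parabolic inequality for the gradient at a spatial maximum\<close>

lemma Ck_on_space_slice:
  fixes F :: "(real^'n::finite) \<times> real \<Rightarrow> real"
  assumes "open U" "t \<in> T" "Ck_on k F (U \<times> T)"
  shows "Ck_on k (\<lambda>z. F (z, t)) U"
proof -
  have "Ck_on k (\<lambda>z. F ((z, 0) + (0, t))) U"
    by (rule Ck_on_affine[where L = "\<lambda>z. (z, 0)", OF assms(1) _ _ _ assms(3)])
      (use assms(2) in \<open>auto intro!: bounded_linear_Pair bounded_linear_ident bounded_linear_zero simp: Basis_prod_def\<close>)
  then show ?thesis by simp
qed

context
  fixes U :: "(real^'n::finite) set" and T :: "real set" and F :: "(real^'n) \<times> real \<Rightarrow> real" and k z t
  assumes U: "open U" and T: "open T" and F: "Ck_on (Suc k) F (U \<times> T)" and z: "z \<in> U" and t: "t \<in> T"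
begin

lemma pderiv_space_slice: "pderiv_at i (\<lambda>z. F (z, t)) z = pd (axis i 1, 0) F (z, t)"
proof -
  have "((\<lambda>z. F (z, t)) has_derivative (\<lambda>x. frechet_derivative F (at (z, t)) (x, 0))) (at z)"
    using has_derivative_compose[OF has_derivative_Pair[OF has_derivative_ident has_derivative_const]
      Ck_on_has_derivative[OF open_Times[OF U T] F, of "(z, t)"]] z t by simp
  from pderiv_unique[OF this] show ?thesis .
qed

lemma time_slice_derivative: "((\<lambda>t. F (z, t)) has_real_derivative pd (0, 1) F (z, t)) (at t)"
  using has_real_derivative_line[of F "frechet_derivative F (at (z, t))" "(z, 0)" t "(0, 1)"]
    Ck_on_has_derivative[OF open_Times[OF U T] F, of "(z, t)"] z t by simp

end

lemma Basis_space_time: "(axis i 1, 0) \<in> (Basis :: ((real^'n::finite) \<times> real) set)" "(0, 1) \<in> (Basis :: ((real^'n::finite) \<times> real) set)"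
  by (auto simp: Basis_prod_def axis_in_Basis_iff)

lemma second_derivative_test:
  fixes q :: "real^'n::finite \<Rightarrow> real"
  assumes U: "open U" and q: "Ck_on 2 q U" and z: "z \<in> U" and max: "\<And>w. w \<in> U \<Longrightarrow> q w \<le> q z"
  shows "pderiv_at i q z = 0"
    and "(\<Sum>i\<in>UNIV. \<Sum>j\<in>UNIV. a i * a j * pderiv_at i (pderiv_at j q) z) \<le> 0"
proof -
  have q': "Ck_on (Suc 1) q U" using q by (simp add: numeral_2_eq_2)
  have line: "((\<lambda>s. q (z + s *\<^sub>R b)) has_real_derivative (\<Sum>i\<in>UNIV. b $ i * pderiv_at i q (z + s *\<^sub>R b))) (at s)"
    if "z + s *\<^sub>R b \<in> U" for s b
    using has_real_derivative_line[OF Ck_on_has_derivative[OF U q' that]]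
      derivative_eq_sum_partials[OF Ck_on_has_derivative[OF U q' that], of b] by (simp add: pderiv_at_def)
  have near: "\<exists>d>0. \<forall>s. \<bar>s\<bar> < d \<longrightarrow> z + s *\<^sub>R b \<in> U" for b
  proof -
    have "isCont (\<lambda>s. z + s *\<^sub>R b) 0" by (intro continuous_intros)
    moreover have "z + 0 *\<^sub>R b \<in> U" using z by simp
    ultimately have "\<forall>\<^sub>F s in at 0. z + s *\<^sub>R b \<in> U" using U by (auto simp: isCont_def topological_tendstoD)
    then obtain d where "d > 0" "\<forall>s. s \<noteq> 0 \<and> \<bar>s\<bar> < d \<longrightarrow> z + s *\<^sub>R b \<in> U"
      unfolding eventually_at by (auto simp: dist_real_def)
    then show ?thesis using z by (intro exI[of _ d]) (metis add.right_neutral scaleR_zero_left)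
  qed
  have first: "(\<Sum>i\<in>UNIV. b $ i * pderiv_at i q z) = 0" for b
  proof -
    obtain d where d: "d > 0" "\<And>s. \<bar>s\<bar> < d \<Longrightarrow> z + s *\<^sub>R b \<in> U" using near by blast
    show ?thesis
      using line[of 0 b] z d max by (intro DERIV_local_max[of "\<lambda>s. q (z + s *\<^sub>R b)" _ 0 d]) auto
  qed
  show "pderiv_at i q z = 0" using first[of "axis i 1"] by (simp add: axis_def if_distrib[of "\<lambda>x. x * _"] cong: if_cong)
  define b where "b = (\<chi> i. a i)"
  define L where "L = (\<Sum>i\<in>UNIV. \<Sum>j\<in>UNIV. a i * a j * pderiv_at i (pderiv_at j q) z)"
  define \<phi>' where "\<phi>' s = (\<Sum>j\<in>UNIV. b $ j * pderiv_at j q (z + s *\<^sub>R b))" for s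
  have "L \<le> 0"
  proof (rule ccontr)
    assume "\<not> L \<le> 0"
    then have "L > 0" by simp
    have "((\<lambda>s. pderiv_at j q (z + s *\<^sub>R b)) has_real_derivative (\<Sum>i\<in>UNIV. a i * pderiv_at i (pderiv_at j q) z)) (at 0)" for j
    proof -
      have "Ck_on (Suc 0) (pderiv_at j q) U" using Ck_on_pderiv[OF U q'] by simp
      from Ck_on_has_derivative[OF U this z] have d: "(pderiv_at j q has_derivative frechet_derivative (pderiv_at j q) (at z)) (at z)" .
      have "frechet_derivative (pderiv_at j q) (at z) b = (\<Sum>i\<in>UNIV. a i * pderiv_at i (pderiv_at j q) z)"
        using derivative_eq_sum_partials[OF d, of b] by (simp add: b_def pderiv_at_def[of _ "pderiv_at j q"])
      with has_real_derivative_line[of "pderiv_at j q" "frechet_derivative (pderiv_at j q) (at z)" z 0 b] d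
      show ?thesis by simp
    qed
    then have "(\<phi>' has_real_derivative (\<Sum>j\<in>UNIV. b $ j * (\<Sum>i\<in>UNIV. a i * pderiv_at i (pderiv_at j q) z))) (at 0)"
      unfolding \<phi>'_def by (intro DERIV_sum DERIV_cmult)
    moreover have "(\<Sum>j\<in>UNIV. b $ j * (\<Sum>i\<in>UNIV. a i * pderiv_at i (pderiv_at j q) z)) = L"
      unfolding L_def by (subst sum.swap) (simp add: b_def sum_distrib_left mult_ac)
    ultimately have "(\<phi>' has_real_derivative L) (at 0)" by simp
    from DERIV_pos_inc_right[OF this \<open>L > 0\<close>] obtain d1 where d1: "d1 > 0" "\<And>s. 0 < s \<Longrightarrow> s < d1 \<Longrightarrow> \<phi>' 0 < \<phi>' s"
      by auto
    have "\<phi>' 0 = 0" using first[of b] by (simp add: \<phi>'_def)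
    obtain d where d: "d > 0" "\<And>s. \<bar>s\<bar> < d \<Longrightarrow> z + s *\<^sub>R b \<in> U" using near by blast
    define r where "r = min d d1 / 2"
    have r: "0 < r" "r < d" "r < d1" using d d1 by (auto simp: r_def)
    have "\<exists>s. 0 < s \<and> s < r \<and> q (z + r *\<^sub>R b) - q (z + 0 *\<^sub>R b) = (r - 0) * \<phi>' s"
      using r d(2) by (intro MVT2) (auto simp: \<phi>'_def intro!: line)
    then obtain s where s: "0 < s" "s < r" "q (z + r *\<^sub>R b) - q z = r * \<phi>' s" by auto
    have "\<phi>' s > 0" using d1(2)[of s] s r \<open>\<phi>' 0 = 0\<close> by simp
    then have "q (z + r *\<^sub>R b) > q z" using s(3) r by (simp add: algebra_simps)
    then show False using max[of "z + r *\<^sub>R b"] d(2)[of r] r by simp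
  qed
  then show "(\<Sum>i\<in>UNIV. \<Sum>j\<in>UNIV. a i * a j * pderiv_at i (pderiv_at j q) z) \<le> 0" by (simp add: L_def)
qed

lemma (in coordinate_metric) laplacian_at_max:
  assumes q: "Ck_on 2 q U" and z: "z \<in> U" and max: "\<And>w. w \<in> U \<Longrightarrow> q w \<le> q z"
  shows "laplacian g q z \<le> 0"
proof -
  have "(\<Sum>i\<in>UNIV. \<Sum>j\<in>UNIV. matrix_inv (g z) $ i $ j * pderiv_at i (pderiv_at j q) z) \<le> 0"
    by (rule sum_psd_form_nonpos) (auto intro: gi_sym gi_pos z second_derivative_test[OF open_U q z max])
  then show ?thesis by (simp add: laplacian_def second_derivative_test(1)[OF open_U q z max])
qed

locale coordinate_flow =
  fixes U :: "(real^'n::finite) set" and T :: "real set" and g :: "real \<Rightarrow> real^'n \<Rightarrow> real^'n^'n"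
    and h :: "(real^'n) \<times> real \<Rightarrow> real"
  assumes metric: "\<And>t. t \<in> T \<Longrightarrow> coordinate_metric U (g t)"
    and open_U: "open U" and open_T: "open T"
    and ricci_flow: "\<And>z t i j. z \<in> U \<Longrightarrow> t \<in> T \<Longrightarrow>
        ((\<lambda>t. g t z $ i $ j) has_real_derivative - 2 * ricci (g t) i j z) (at t)"
    and h3: "Ck_on 3 h (U \<times> T)"
begin

definition N :: "real^'n \<Rightarrow> real \<Rightarrow> real" where
  "N z t = (\<Sum>i\<in>UNIV. (\<Sum>j\<in>UNIV. matrix_inv (g t z) $ i $ j * pderiv_at j (\<lambda>w. h (w, t)) z) * pderiv_at i (\<lambda>w. h (w, t)) z)"

lemma coordinate_function: "t \<in> T \<Longrightarrow> coordinate_function U (g t) (\<lambda>w. h (w, t))"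
  unfolding coordinate_function_def coordinate_function_axioms_def
  using metric Ck_on_space_slice[OF open_U _ h3] by blast

lemma N_eq: "t \<in> T \<Longrightarrow> coordinate_function.N (g t) (\<lambda>w. h (w, t)) = (\<lambda>z. N z t)"
  by (simp add: fun_eq_iff N_def coordinate_function.N_def[OF coordinate_function] coordinate_function.V_def[OF coordinate_function])

text \<open>The inverse metric moves by \<open>+ 2 Ric\<close>, with raised indices. It is differentiable because its entries are
  quotients of determinants (Cramer's rule).\<close>

lemma time_derivative_inverse_metric:
  assumes z: "z \<in> U" and t: "t \<in> T"
  shows "((\<lambda>t. matrix_inv (g t z) $ i $ j) has_real_derivative
     2 * (\<Sum>a\<in>UNIV. \<Sum>b\<in>UNIV. matrix_inv (g t z) $ i $ a * ricci (g t) a b z * matrix_inv (g t z) $ b $ j)) (at t)"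
proof -
  have inv: "invertible (g s z)" if "s \<in> T" for s by (rule coordinate_metric.inv_g[OF metric[OF that] z])
  have diff: "(\<lambda>s. matrix_inv (g s z) $ i $ j) differentiable (at t)" for i j
  proof -
    have d: "(\<lambda>s. g s z $ i $ j) differentiable (at t)" for i j
      using ricci_flow[OF z t] real_differentiable_def by blast
    have det: "(\<lambda>s. det (B s)) differentiable (at t)"
      if B: "\<And>i j. (\<lambda>s. B s $ i $ j) differentiable (at t)" for B :: "real \<Rightarrow> real^'n^'n"
    proof -
      have "(\<lambda>s. \<Prod>i\<in>J. B s $ i $ p i) differentiable (at t)" for p and J :: "'n set"
        by (induction J rule: infinite_finite_induct) (auto intro: differentiable_mult B)
      then show ?thesis unfolding det_def by (intro differentiable_sum differentiable_mult) auto
    qed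
    have "(\<lambda>s. det (\<chi> r c. if c = i then axis j 1 $ r else g s z $ r $ c) / det (g s z)) differentiable (at t)"
    proof (intro differentiable_divide det d)
      fix r c show "(\<lambda>s. (\<chi> r c. if c = i then axis j 1 $ r else g s z $ r $ c) $ r $ c) differentiable (at t)"
        by (cases "c = i") (simp_all add: d)
    qed (use inv[OF t] in \<open>simp add: invertible_det_nz\<close>)
    then obtain D where "((\<lambda>s. det (\<chi> r c. if c = i then axis j 1 $ r else g s z $ r $ c) / det (g s z)) has_derivative D) (at t)"
      unfolding differentiable_def by blast
    then have "((\<lambda>s. matrix_inv (g s z) $ i $ j) has_derivative D) (at t)"
      by (rule has_derivative_transform_within_open[OF _ open_T t]) (simp add: matrix_inv_entry[OF inv])
    then show ?thesis by (auto simp: differentiable_def)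
  qed
  define B' where "B' = (\<chi> i j. deriv (\<lambda>s. matrix_inv (g s z) $ i $ j) t)"
  define A' where "A' = (\<chi> i j. - 2 * ricci (g t) i j z)"
  have B': "((\<lambda>s. matrix_inv (g s z) $ i $ j) has_real_derivative B' $ i $ j) (at t)" for i j
    using diff by (simp add: B'_def DERIV_deriv_iff_real_differentiable)
  have "(B' ** g t z + matrix_inv (g t z) ** A') $ i $ j = 0" for i j
  proof -
    have "((\<lambda>s. \<Sum>k\<in>UNIV. matrix_inv (g s z) $ i $ k * g s z $ k $ j) has_real_derivative
       (\<Sum>k\<in>UNIV. B' $ i $ k * g t z $ k $ j + A' $ k $ j * matrix_inv (g t z) $ i $ k)) (at t)"
      using ricci_flow[OF z t] by (intro DERIV_sum DERIV_mult B') (simp add: A'_def)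
    moreover have "((\<lambda>s. \<Sum>k\<in>UNIV. matrix_inv (g s z) $ i $ k * g s z $ k $ j) has_real_derivative 0) (at t)"
    proof (rule has_field_derivative_transform_within_open[OF _ open_T t])
      show "((\<lambda>s. if i = j then 1 else 0 :: real) has_real_derivative 0) (at t)" by simp
    qed (simp add: coordinate_metric.sum_gi_g[OF metric z])
    ultimately have "(\<Sum>k\<in>UNIV. B' $ i $ k * g t z $ k $ j + A' $ k $ j * matrix_inv (g t z) $ i $ k) = 0"
      by (rule DERIV_unique)
    then show ?thesis by (simp add: matrix_matrix_mult_def sum.distrib mult.commute)
  qed
  then have "B' ** g t z + matrix_inv (g t z) ** A' = 0" by (simp add: vec_eq_iff)
  from derivative_of_inverse_matrix[OF this matrix_inv_right[OF inv[OF t]]]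
  have "B' $ i $ j = 2 * (\<Sum>b\<in>UNIV. \<Sum>a\<in>UNIV. matrix_inv (g t z) $ i $ a * ricci (g t) a b z * matrix_inv (g t z) $ b $ j)"
    by (simp add: matrix_matrix_mult_def A'_def sum_distrib_left sum_distrib_right sum_negf mult_ac)
  also have "(\<Sum>b\<in>UNIV. \<Sum>a\<in>UNIV. matrix_inv (g t z) $ i $ a * ricci (g t) a b z * matrix_inv (g t z) $ b $ j) =
    (\<Sum>a\<in>UNIV. \<Sum>b\<in>UNIV. matrix_inv (g t z) $ i $ a * ricci (g t) a b z * matrix_inv (g t z) $ b $ j)" by (rule sum.swap)
  finally show ?thesis using B'[of i j] by simp
qed

end

text \<open>The equation satisfied by \<open>h\<close> when \<open>\<Phi>(h)\<close> solves the heat equation.\<close>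

locale coordinate_log_flow = coordinate_flow +
  assumes h_eq: "\<And>z t. z \<in> U \<Longrightarrow> t \<in> T \<Longrightarrow>
    ((\<lambda>t. h (z, t)) has_real_derivative laplacian (g t) (\<lambda>w. h (w, t)) z - h (z, t) * N z t) (at t)"
begin

text \<open>The derivative of \<open>N = g\<^sup>i\<^sup>j \<partial>\<^sub>ih \<partial>\<^sub>jh\<close> in time is \<open>2 Ric(\<nabla>h, \<nabla>h) + 2 \<langle>\<nabla>h, \<nabla>(\<Delta>h - h N)\<rangle>\<close>, and \<open>\<nabla>N = 0\<close> at the maximum.
  Bochner's formula replaces \<open>2 \<langle>\<nabla>h, \<nabla>\<Delta>h\<rangle> + 2 Ric(\<nabla>h, \<nabla>h)\<close> by \<open>\<Delta>N - 2 |\<nabla>\<^sup>2h|\<^sup>2 \<le> 0\<close>, so that only the term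
  \<open>- 2 N\<^sup>2\<close> from \<open>- h N\<close> remains.\<close>

lemma N_derivative_at_max:
  assumes z: "z \<in> U" and t: "t \<in> T" and max: "\<And>w. w \<in> U \<Longrightarrow> N w t \<le> N z t"
  obtains d where "((\<lambda>t. N z t) has_real_derivative d) (at t)" "d \<le> - 2 * (N z t)\<^sup>2"
proof -
  interpret cf: coordinate_function U "g t" "\<lambda>w. h (w, t)" by (rule coordinate_function[OF t])
  note Neq = N_eq[OF t]
  define p where "p j s = pderiv_at j (\<lambda>w. h (w, s)) z" for j s
  define p' where "p' j = cf.D j (laplacian (g t) (\<lambda>w. h (w, t))) z - p j t * N z t" for j
  have S: "open (U \<times> T)" using open_U open_T by (rule open_Times)
  have h3': "Ck_on (Suc 2) h (U \<times> T)" using h3 by (simp add: eval_nat_numeral del: Ck_on.simps)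
  have CN: "Ck_on 2 (\<lambda>z. N z t) U" using cf.Ck_N unfolding Neq .
  have crit: "cf.D j (\<lambda>z. N z t) z = 0" for j
    by (rule second_derivative_test(1)[OF open_U CN z max])
  have dp: "(p j has_real_derivative p' j) (at t)" for j
  proof -
    define G where "G = pd (axis j 1, 0) h"
    have CG: "Ck_on (Suc 1) G (U \<times> T)" unfolding G_def
      using Ck_on_pd[OF S h3' Basis_space_time(1)] by (simp add: numeral_2_eq_2 del: Ck_on.simps)
    have CT: "Ck_on (Suc 1) (pd (0, 1) h) (U \<times> T)"
      using Ck_on_pd[OF S h3' Basis_space_time(2)] by (simp add: numeral_2_eq_2 del: Ck_on.simps)
    have ht: "pd (0, 1) h (w, t) = laplacian (g t) (\<lambda>w. h (w, t)) w - h (w, t) * N w t" if "w \<in> U" for w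
      using DERIV_unique[OF time_slice_derivative[OF open_U open_T h3' that t] h_eq[OF that t]] .
    have "((\<lambda>s. G (z, s)) has_real_derivative pd (0, 1) G (z, t)) (at t)"
      by (rule time_slice_derivative[OF open_U open_T CG z t])
    then have "(p j has_real_derivative pd (0, 1) G (z, t)) (at t)"
      by (rule has_field_derivative_transform_within_open[OF _ open_T t])
        (simp add: p_def G_def pderiv_space_slice[OF open_U open_T h3' z])
    \<comment> \<open>Time and space derivatives commute, so the equation for \<open>h\<close> can be differentiated in space.\<close>
    also have "pd (0, 1) G (z, t) = pd (axis j 1, 0) (pd (0, 1) h) (z, t)"
      unfolding G_def
      by (rule pd_commute[OF S Ck_on_mono[OF h3'] _ Basis_space_time(2,1)]) (use z t in auto)
    also have "\<dots> = cf.D j (\<lambda>w. pd (0, 1) h (w, t)) z"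
      by (rule pderiv_space_slice[OF open_U open_T CT z t, symmetric])
    also have "\<dots> = cf.D j (\<lambda>w. laplacian (g t) (\<lambda>w. h (w, t)) w - h (w, t) * N w t) z"
      by (rule pderiv_cong[OF open_U _ z]) (rule ht)
    also have "\<dots> = p' j"
    proof -
      have 1: "Ck_on (Suc 0) (\<lambda>w. laplacian (g t) (\<lambda>w. h (w, t)) w) U"
        unfolding cf.laplacian_eq by (intro Ck_on_sum Ck_on_mult open_U cf.Ck_gi cf.Ck_H)
      have 2: "Ck_on (Suc 0) (\<lambda>w. h (w, t)) U" by (rule Ck_on_mono[OF cf.f3]) simp
      have 3: "Ck_on (Suc 0) (\<lambda>w. N w t) U" by (rule Ck_on_mono[OF CN]) simp
      show ?thesis
        by (simp add: p'_def p_def crit pderiv_diff[OF open_U z 1] pderiv_mult[OF open_U z 2 3] Ck_on_mult[OF open_U 2 3] del: Ck_on.simps)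
    qed
    finally show ?thesis .
  qed
  define gi' where "gi' i j = 2 * (\<Sum>a\<in>UNIV. \<Sum>b\<in>UNIV. cf.gi i a z * ricci (g t) a b z * cf.gi b j z)" for i j
  define d where "d = (\<Sum>i\<in>UNIV. (\<Sum>j\<in>UNIV. gi' i j * p j t + p' j * cf.gi i j z) * p i t + p' i * (\<Sum>j\<in>UNIV. cf.gi i j z * p j t))"
  have "((\<lambda>t. N z t) has_real_derivative d) (at t)"
    unfolding N_def d_def p_def[symmetric]
    by (intro DERIV_sum DERIV_mult dp) (simp add: gi'_def time_derivative_inverse_metric[OF z t])
  moreover have "d \<le> - 2 * (N z t)\<^sup>2"
  proof -
    have V: "cf.V i z = (\<Sum>j\<in>UNIV. cf.gi i j z * p j t)" for i by (simp add: cf.V_def p_def)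
    have Nz: "N z t = (\<Sum>i\<in>UNIV. cf.V i z * p i t)" using fun_cong[OF Neq, of z] by (simp add: cf.N_def p_def)
    have "(\<Sum>i\<in>UNIV. (\<Sum>j\<in>UNIV. p' j * cf.gi i j z) * p i t) = (\<Sum>i\<in>UNIV. \<Sum>j\<in>UNIV. p' j * cf.gi i j z * p i t)"
      by (simp add: sum_distrib_right)
    also have "\<dots> = (\<Sum>j\<in>UNIV. \<Sum>i\<in>UNIV. p' j * cf.gi i j z * p i t)" by (rule sum.swap)
    also have "\<dots> = (\<Sum>j\<in>UNIV. p' j * cf.V j z)"
      unfolding V sum_distrib_left by (intro sum.cong refl) (simp add: cf.gi_sym[OF z] mult_ac)
    finally have 1: "(\<Sum>i\<in>UNIV. (\<Sum>j\<in>UNIV. p' j * cf.gi i j z) * p i t) = (\<Sum>j\<in>UNIV. p' j * cf.V j z)" .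
    have "(\<Sum>i\<in>UNIV. (\<Sum>j\<in>UNIV. gi' i j * p j t) * p i t) = 2 * (\<Sum>i\<in>UNIV. \<Sum>j\<in>UNIV. \<Sum>a\<in>UNIV. \<Sum>b\<in>UNIV. (cf.gi i a z * p i t) * ricci (g t) a b z * (cf.gi b j z * p j t))"
      by (simp add: gi'_def sum_distrib_right sum_distrib_left mult_ac)
    also have "(\<Sum>i\<in>UNIV. \<Sum>j\<in>UNIV. \<Sum>a\<in>UNIV. \<Sum>b\<in>UNIV. (cf.gi i a z * p i t) * ricci (g t) a b z * (cf.gi b j z * p j t))
      = (\<Sum>i\<in>UNIV. \<Sum>a\<in>UNIV. \<Sum>j\<in>UNIV. \<Sum>b\<in>UNIV. (cf.gi i a z * p i t) * ricci (g t) a b z * (cf.gi b j z * p j t))"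
      by (intro sum.cong refl sum.swap)
    also have "\<dots> = (\<Sum>a\<in>UNIV. \<Sum>i\<in>UNIV. \<Sum>j\<in>UNIV. \<Sum>b\<in>UNIV. (cf.gi i a z * p i t) * ricci (g t) a b z * (cf.gi b j z * p j t))"
      by (rule sum.swap)
    also have "\<dots> = (\<Sum>a\<in>UNIV. \<Sum>i\<in>UNIV. \<Sum>b\<in>UNIV. \<Sum>j\<in>UNIV. (cf.gi i a z * p i t) * ricci (g t) a b z * (cf.gi b j z * p j t))"
      by (intro sum.cong refl sum.swap)
    also have "\<dots> = (\<Sum>a\<in>UNIV. \<Sum>b\<in>UNIV. \<Sum>i\<in>UNIV. \<Sum>j\<in>UNIV. (cf.gi i a z * p i t) * ricci (g t) a b z * (cf.gi b j z * p j t))"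
      by (intro sum.cong refl sum.swap)
    also have "\<dots> = (\<Sum>a\<in>UNIV. \<Sum>b\<in>UNIV. ricci (g t) a b z * cf.V a z * cf.V b z)"
    proof (intro sum.cong refl)
      fix a b
      have "(\<Sum>i\<in>UNIV. \<Sum>j\<in>UNIV. (cf.gi i a z * p i t) * ricci (g t) a b z * (cf.gi b j z * p j t)) =
         (\<Sum>i\<in>UNIV. cf.gi i a z * p i t) * ricci (g t) a b z * (\<Sum>j\<in>UNIV. cf.gi b j z * p j t)"
        by (simp only: sum_distrib_right[symmetric] sum_distrib_left[symmetric])
      then show "(\<Sum>i\<in>UNIV. \<Sum>j\<in>UNIV. (cf.gi i a z * p i t) * ricci (g t) a b z * (cf.gi b j z * p j t)) = ricci (g t) a b z * cf.V a z * cf.V b z"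
        unfolding cf.gi_sym[OF z, of _ a] V[symmetric] by (simp only: mult.commute)
    qed
    finally have 2: "(\<Sum>i\<in>UNIV. (\<Sum>j\<in>UNIV. gi' i j * p j t) * p i t) = 2 * (\<Sum>a\<in>UNIV. \<Sum>b\<in>UNIV. ricci (g t) a b z * cf.V a z * cf.V b z)" .
    have "d = (\<Sum>i\<in>UNIV. (\<Sum>j\<in>UNIV. gi' i j * p j t) * p i t) + (\<Sum>i\<in>UNIV. (\<Sum>j\<in>UNIV. p' j * cf.gi i j z) * p i t) + (\<Sum>i\<in>UNIV. p' i * cf.V i z)"
      by (simp add: d_def V sum.distrib distrib_right)
    also have "\<dots> = 2 * (\<Sum>a\<in>UNIV. \<Sum>b\<in>UNIV. ricci (g t) a b z * cf.V a z * cf.V b z) + 2 * (\<Sum>i\<in>UNIV. p' i * cf.V i z)"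
      unfolding 1 2 by simp
    also have "(\<Sum>i\<in>UNIV. p' i * cf.V i z) = (\<Sum>i\<in>UNIV. cf.V i z * cf.D i (laplacian (g t) (\<lambda>w. h (w, t))) z) - N z t * N z t"
    proof -
      have "(\<Sum>i\<in>UNIV. p' i * cf.V i z) = (\<Sum>i\<in>UNIV. cf.V i z * cf.D i (laplacian (g t) (\<lambda>w. h (w, t))) z) - (\<Sum>i\<in>UNIV. cf.V i z * p i t) * N z t"
        by (simp add: p'_def left_diff_distrib right_diff_distrib sum_subtractf sum_distrib_left sum_distrib_right mult_ac)
      then show ?thesis by (simp only: Nz[symmetric])
    qed
    finally have d_eq: "d = 2 * (\<Sum>a\<in>UNIV. \<Sum>b\<in>UNIV. ricci (g t) a b z * cf.V a z * cf.V b z)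
      + 2 * ((\<Sum>i\<in>UNIV. cf.V i z * cf.D i (laplacian (g t) (\<lambda>w. h (w, t))) z) - N z t * N z t)" .
    have le: "laplacian (g t) (\<lambda>z. N z t) z \<le> 0" by (rule cf.laplacian_at_max[OF CN z max])
    have arith: "2 * R + 2 * (X - n * n) \<le> - 2 * n\<^sup>2"
      if "L = 2 * X + 2 * q + 2 * R" "L \<le> 0" "0 \<le> q" for R X n L q :: real
      using that by (simp add: power2_eq_square)
    show ?thesis unfolding d_eq
      by (rule arith[OF cf.bochner[OF z, unfolded Neq] le cf.hess_sq_nonneg[OF z]])
  qed
  ultimately show thesis by (rule that)
qed

end

section \<open>Integrals depending smoothly on a parameter\<close>

text \<open>Smoothness in \<open>p\<close>, uniformly in a parameter \<open>y\<close> from a space without linear structure. Joint continuity of the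
  derivatives gives bounds that are uniform in \<open>y\<close> when the parameter space is compact, as needed for
  differentiation under the integral.\<close>

primrec Ck_param :: "nat \<Rightarrow> ('a::euclidean_space \<Rightarrow> 'm::topological_space \<Rightarrow> real) \<Rightarrow> 'a set \<Rightarrow> bool" where
  "Ck_param 0 F S \<longleftrightarrow> continuous_on (S \<times> UNIV) (\<lambda>(p, y). F p y)"
| "Ck_param (Suc k) F S \<longleftrightarrow> continuous_on (S \<times> UNIV) (\<lambda>(p, y). F p y) \<and>
     (\<forall>y. (\<lambda>p. F p y) differentiable_on S) \<and>
     (\<forall>b\<in>Basis. Ck_param k (\<lambda>p y. pd b (\<lambda>p. F p y) p) S)"

lemma Ck_param_continuous: "Ck_param k F S \<Longrightarrow> continuous_on (S \<times> UNIV) (\<lambda>(p, y). F p y)"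
  by (cases k) auto

lemma atlas_facts:
  assumes "smooth_atlas A" "c \<in> A"
  shows "open (cdom c)" "open (cimg c)" "homeomorphism (cdom c) (cimg c) (coord c) (cinv c)"
  using assms by (auto simp: smooth_atlas_def)

lemma atlas_cover: assumes "smooth_atlas A" obtains c where "c \<in> A" "y \<in> cdom c"
  using assms unfolding smooth_atlas_def by (metis UN_E UNIV_I)

lemma continuous_on_from_charts:
  fixes A :: "('m::{t2_space,second_countable_topology}, 'n::finite) chart set"
    and F :: "'a::t2_space \<Rightarrow> 'm \<Rightarrow> real"
  assumes A: "smooth_atlas A"
    and F: "\<And>c. c \<in> A \<Longrightarrow> continuous_on (S \<times> cimg c) (\<lambda>(p, w). F p (cinv c w))"
  shows "continuous_on (S \<times> UNIV) (\<lambda>(p, y). F p y)"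
  unfolding continuous_on_eq_continuous_within
proof
  fix x assume xS: "x \<in> S \<times> (UNIV :: 'm set)"
  obtain p y where x: "x = (p, y)" "p \<in> S" using xS by blast
  obtain c where c: "c \<in> A" "y \<in> cdom c" by (rule atlas_cover[OF A])
  note h = atlas_facts[OF A c(1)]
  have "continuous_on (cdom c) (coord c)" "coord c ` cdom c = cimg c"
    using h(3) by (auto simp: homeomorphism_def)
  then have cc: "continuous_on (S \<times> cdom c) (\<lambda>x. (fst x, coord c (snd x)))"
    by (auto intro!: continuous_intros intro: continuous_on_compose2[of "cdom c" "coord c"])
  have "continuous_on (S \<times> cdom c) (\<lambda>x. (\<lambda>(p, w). F p (cinv c w)) (fst x, coord c (snd x)))"
    by (rule continuous_on_compose2[OF F[OF c(1)] cc]) (auto simp: cimg_def)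
  then have "continuous_on (S \<times> cdom c) (\<lambda>(p, y). F p y)"
    by (rule continuous_on_eq) (use h(3) in \<open>auto simp: homeomorphism_def\<close>)
  then have "continuous (at x within S \<times> cdom c) (\<lambda>(p, y). F p y)"
    using x c by (simp add: continuous_on_eq_continuous_within)
  moreover have "at x within S \<times> UNIV = at x within S \<times> cdom c"
    by (rule at_within_nhd[of x "UNIV \<times> cdom c"]) (use x c h in \<open>auto intro: open_Times\<close>)
  ultimately show "continuous (at x within S \<times> UNIV) (\<lambda>(p, y). F p y)" by simp
qed

lemma Ck_param_from_charts:
  fixes A :: "('m::{t2_space,second_countable_topology}, 'n::finite) chart set"
    and F :: "'a::euclidean_space \<Rightarrow> 'm \<Rightarrow> real"
  assumes A: "smooth_atlas A" and S: "open S"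
  shows "(\<And>c. c \<in> A \<Longrightarrow> Ck_on k (\<lambda>(p, w). F p (cinv c w)) (S \<times> cimg c)) \<Longrightarrow> Ck_param k F S"
proof (induction k arbitrary: F)
  case (0 F)
  then show ?case using continuous_on_from_charts[OF A, of S F] by simp
next
  case (Suc k F)
  have d: "((\<lambda>p. F p y) has_derivative (\<lambda>b. frechet_derivative (\<lambda>(p, w). F p (cinv c w)) (at (p, coord c y)) (b, 0))) (at p)"
    if "p \<in> S" "c \<in> A" "y \<in> cdom c" for p y c
  proof -
    note h = atlas_facts[OF A that(2)]
    have inS: "(p, coord c y) \<in> S \<times> cimg c" using that h by (auto simp: homeomorphism_def)
    have "((\<lambda>p. (\<lambda>(p, w). F p (cinv c w)) (p, coord c y)) has_derivative (\<lambda>b. frechet_derivative (\<lambda>(p, w). F p (cinv c w)) (at (p, coord c y)) (b, 0))) (at p)"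
      by (rule has_derivative_compose[OF has_derivative_Pair[OF has_derivative_ident has_derivative_const]
        Ck_on_has_derivative[OF open_Times[OF S h(2)] Suc.prems[OF that(2)] inS]])
    then show ?thesis using that h by (simp add: homeomorphism_def)
  qed
  show ?case unfolding Ck_param.simps
  proof (intro conjI allI ballI)
    show "continuous_on (S \<times> UNIV) (\<lambda>(p, y). F p y)"
    proof -
      have "Ck_param k F S" by (rule Suc.IH) (rule Ck_on_SucD, rule Suc.prems)
      then show ?thesis by (rule Ck_param_continuous)
    qed
    show "(\<lambda>p. F p y) differentiable_on S" for y
      unfolding differentiable_on_def differentiable_def
      by (metis atlas_cover[OF A, of y] d has_derivative_at_withinI)
    fix b :: 'a assume b: "b \<in> Basis"
    show "Ck_param k (\<lambda>p y. pd b (\<lambda>p. F p y) p) S"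
    proof (rule Suc.IH)
      fix c assume c: "c \<in> A"
      note h = atlas_facts[OF A c]
      have "Ck_on k (pd (b, 0) (\<lambda>(p, w). F p (cinv c w))) (S \<times> cimg c)"
        by (rule Ck_on_pd[OF open_Times[OF S h(2)] Suc.prems[OF c]]) (use b in \<open>auto simp: Basis_prod_def\<close>)
      then show "Ck_on k (\<lambda>(p, w). pd b (\<lambda>p. F p (cinv c w)) p) (S \<times> cimg c)"
      proof (rule Ck_on_cong[THEN iffD1, rotated], clarify)
        fix p w assume pw: "p \<in> S" "w \<in> cimg c"
        then have "cinv c w \<in> cdom c" "coord c (cinv c w) = w" using h(3) by (auto simp: homeomorphism_def)
        with frechet_derivative_at[OF d[OF pw(1) c, of "cinv c w"]]
        show "pd (b, 0) (\<lambda>(p, w). F p (cinv c w)) (p, w) = pd b (\<lambda>p. F p (cinv c w)) p" by (metis (no_types))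
      qed
    qed
  qed
qed

locale compact_param =
  fixes \<mu> :: "'m::topological_space measure" and f :: "'m \<Rightarrow> real"
  assumes compact_UNIV: "compact (UNIV :: 'm set)" and fin: "finite_measure \<mu>" and sets_\<mu>: "sets \<mu> = sets borel"
    and f_meas: "f \<in> borel_measurable borel" and f_bounded: "\<And>y. \<bar>f y\<bar> \<le> 1"
begin

lemma borel_measurable_slice:
  fixes F :: "'b::topological_space \<Rightarrow> 'm \<Rightarrow> real"
  assumes "continuous_on (S \<times> UNIV) (\<lambda>(p, y). F p y)" "p \<in> S"
  shows "(\<lambda>y. F p y :: real) \<in> borel_measurable \<mu>"
proof -
  have "continuous_on UNIV (\<lambda>y. (\<lambda>(p, y). F p y) (p, y))"
    by (rule continuous_on_compose2[OF assms(1)]) (use assms(2) in \<open>auto intro!: continuous_intros\<close>)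
  then show ?thesis using borel_measurable_continuous_onI sets_\<mu> by (simp cong: measurable_cong_sets)
qed

lemma bounded_on_compact:
  fixes F :: "'b::topological_space \<Rightarrow> 'm \<Rightarrow> real"
  assumes "continuous_on (S \<times> UNIV) (\<lambda>(p, y). F p y)" "compact C" "C \<subseteq> S"
  obtains B where "\<And>p y. p \<in> C \<Longrightarrow> \<bar>F p y :: real\<bar> \<le> B"
proof -
  have "compact ((\<lambda>(p, y). F p y) ` (C \<times> UNIV))"
    by (intro compact_continuous_image compact_Times assms compact_UNIV continuous_on_subset[OF assms(1)]) (use assms in auto)
  then obtain B where "\<And>x. x \<in> (\<lambda>(p, y). F p y) ` (C \<times> UNIV) \<Longrightarrow> norm x \<le> B"
    using compact_imp_bounded bounded_iff by metis
  then show thesis by (intro that[of B]) force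
qed

lemma f_measurable: "f \<in> borel_measurable \<mu>"
  using f_meas sets_\<mu> by (simp cong: measurable_cong_sets)

lemma integrable_param:
  fixes F :: "'b::t2_space \<Rightarrow> 'm \<Rightarrow> real"
  assumes "continuous_on (S \<times> UNIV) (\<lambda>(p, y). F p y)" "p \<in> S"
  shows "integrable \<mu> (\<lambda>y. F p y * f y)"
proof -
  obtain B where B: "\<And>q y. q \<in> {p} \<Longrightarrow> \<bar>F q y\<bar> \<le> B"
    by (rule bounded_on_compact[OF assms(1), of "{p}"]) (use assms(2) in auto)
  show ?thesis
  proof (rule finite_measure.integrable_const_bound[OF fin, of _ B])
    show "AE y in \<mu>. norm (F p y * f y) \<le> B"
    proof (rule AE_I2)
      fix y
      have "\<bar>F p y\<bar> * \<bar>f y\<bar> \<le> B * 1" using B[of p y] f_bounded[of y] by (intro mult_mono) auto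
      then show "norm (F p y * f y) \<le> B" by (simp add: abs_mult)
    qed
    show "(\<lambda>y. F p y * f y) \<in> borel_measurable \<mu>"
      by (intro borel_measurable_times borel_measurable_slice[OF assms] f_measurable)
  qed
qed

lemma continuous_on_integral_param:
  fixes F :: "'b::heine_borel \<Rightarrow> 'm \<Rightarrow> real"
  assumes F: "continuous_on (S \<times> UNIV) (\<lambda>(p, y). F p y)"
  shows "continuous_on S (\<lambda>p. \<integral>y. F p y * f y \<partial>\<mu>)"
  unfolding continuous_on_sequentially
proof (intro allI ballI impI, elim conjE)
  fix X p assume X: "p \<in> S" "\<forall>n. X n \<in> S" "X \<longlonglongrightarrow> p"
  have "compact (insert p (range X))" by (rule compact_sequence_with_limit[OF X(3)])
  then obtain B where B: "\<And>q y. q \<in> insert p (range X) \<Longrightarrow> \<bar>F q y\<bar> \<le> B"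
    by (rule bounded_on_compact[OF F]) (use X in auto)
  have "(\<lambda>n. \<integral>y. F (X n) y * f y \<partial>\<mu>) \<longlonglongrightarrow> (\<integral>y. F p y * f y \<partial>\<mu>)"
  proof (rule integral_dominated_convergence[where w = "\<lambda>_. B"])
    show "AE y in \<mu>. (\<lambda>n. F (X n) y * f y) \<longlonglongrightarrow> F p y * f y"
    proof (intro AE_I2 tendsto_mult tendsto_const)
      fix y
      have "continuous_on S (\<lambda>q. (\<lambda>(p, y). F p y) (q, y))"
        by (rule continuous_on_compose2[OF F]) (auto intro!: continuous_intros)
      then show "(\<lambda>n. F (X n) y) \<longlonglongrightarrow> F p y"
        using X by (auto simp: continuous_on_sequentially o_def)
    qed
    show "AE y in \<mu>. norm (F (X n) y * f y) \<le> B" for n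
    proof (rule AE_I2)
      fix y
      have "\<bar>F (X n) y\<bar> * \<bar>f y\<bar> \<le> B * 1" using B[of "X n" y] f_bounded[of y] by (intro mult_mono) auto
      then show "norm (F (X n) y * f y) \<le> B" by (simp add: abs_mult)
    qed
    show "integrable \<mu> (\<lambda>_. B)" using finite_measure.integrable_const[OF fin] .
    show "(\<lambda>y. F p y * f y) \<in> borel_measurable \<mu>" "(\<lambda>y. F (X n) y * f y) \<in> borel_measurable \<mu>" for n
      using X by (auto intro!: borel_measurable_times borel_measurable_slice[OF F] f_measurable)
  qed
  then show "((\<lambda>p. \<integral>y. F p y * f y \<partial>\<mu>) \<circ> X) \<longlonglongrightarrow> (\<integral>y. F p y * f y \<partial>\<mu>)" by (simp add: o_def)
qed

text \<open>Differentiation under the integral by dominated convergence along sequences: the mean value inequality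
  bounds the difference quotients by a bound for the partial derivatives on a ball times the parameter space.\<close>

lemma has_derivative_integral_param:
  fixes F :: "'a::euclidean_space \<Rightarrow> 'm \<Rightarrow> real"
  assumes S: "open S" and F: "Ck_param (Suc 0) F S" and p: "p \<in> S"
  shows "((\<lambda>p. \<integral>y. F p y * f y \<partial>\<mu>) has_derivative
     (\<lambda>h. \<integral>y. frechet_derivative (\<lambda>p. F p y) (at p) h * f y \<partial>\<mu>)) (at p)"
proof -
  define F' where "F' q y = frechet_derivative (\<lambda>p. F p y) (at q)" for q y
  have cF: "continuous_on (S \<times> UNIV) (\<lambda>(p, y). F p y)" using F by simp
  have d: "((\<lambda>p. F p y) has_derivative F' q y) (at q)" if "q \<in> S" for q y
  proof -
    have "(\<lambda>p. F p y) differentiable (at q within S)"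
      using F that by (simp add: differentiable_on_def)
    then have "(\<lambda>p. F p y) differentiable (at q)" by (simp only: at_within_open[OF that S])
    then show ?thesis unfolding F'_def frechet_derivative_works .
  qed
  have cF': "continuous_on (S \<times> UNIV) (\<lambda>(p, y). F' p y b)" if "b \<in> Basis" for b
    using F that by (simp add: F'_def)
  have rep: "F' q y h = (\<Sum>b\<in>Basis. (h \<bullet> b) * F' q y b)" if "q \<in> S" for q y h
  proof -
    have "F' q y h = F' q y (\<Sum>b\<in>Basis. (h \<bullet> b) *\<^sub>R b)" by (simp add: euclidean_representation)
    then show ?thesis using has_derivative_linear[OF d[OF that]] by (simp add: linear_sum linear_cmul)
  qed
  have rep_f: "(\<lambda>y. F' p y h * f y) = (\<lambda>y. \<Sum>b\<in>Basis. (h \<bullet> b) * (F' p y b * f y))" for h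
  proof
    fix y show "F' p y h * f y = (\<Sum>b\<in>Basis. (h \<bullet> b) * (F' p y b * f y))"
      by (subst rep[OF p]) (simp add: sum_distrib_right mult.assoc)
  qed
  have int': "integrable \<mu> (\<lambda>y. F' p y h * f y)" for h
    unfolding rep_f[of h]
    by (intro Bochner_Integration.integrable_sum integrable_mult_right integrable_param[OF cF' p])
  have int: "integrable \<mu> (\<lambda>y. F q y * f y)" if "q \<in> S" for q by (rule integrable_param[OF cF that])
  obtain r where r: "r > 0" "cball p r \<subseteq> S" using S p open_contains_cball by blast
  have "\<exists>B. \<forall>b\<in>Basis. \<forall>q\<in>cball p r. \<forall>y. \<bar>F' q y b\<bar> \<le> B"
  proof -
    have "\<forall>b\<in>Basis. \<exists>B. \<forall>q\<in>cball p r. \<forall>y. \<bar>F' q y b\<bar> \<le> B"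
      by (metis bounded_on_compact[OF cF' compact_cball r(2)])
    then obtain B where B: "\<And>b q y. b \<in> Basis \<Longrightarrow> q \<in> cball p r \<Longrightarrow> \<bar>F' q y b\<bar> \<le> B b" by metis
    have "B b \<le> Max (B ` Basis)" if "b \<in> Basis" for b using that by (intro Max_ge) auto
    with B show ?thesis by (intro exI[of _ "Max (B ` Basis)"]) (meson order_trans)
  qed
  then obtain B where B: "\<And>b q y. b \<in> Basis \<Longrightarrow> q \<in> cball p r \<Longrightarrow> \<bar>F' q y b\<bar> \<le> B" by blast
  define C where "C = DIM('a) * B"
  have F'_bound: "norm (F' q y h) \<le> C * norm h" if "q \<in> cball p r" for q y h
  proof -
    have "norm (F' q y h) \<le> (\<Sum>b\<in>Basis. \<bar>h \<bullet> b\<bar> * \<bar>F' q y b\<bar>)"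
      using that r(2) by (subst rep) (auto intro!: sum_abs[THEN order_trans] simp: abs_mult)
    also have "\<dots> \<le> (\<Sum>b\<in>(Basis::'a set). norm h * B)"
      using B[OF _ that] by (intro sum_mono mult_mono) (auto simp: Basis_le_norm)
    finally show ?thesis by (simp add: C_def mult_ac)
  qed
  have lip: "norm (F q y - F p y) \<le> C * norm (q - p)" if q: "q \<in> cball p r" for q y
  proof (rule differentiable_bound[of "cball p r" "\<lambda>p. F p y" "\<lambda>q. F' q y"])
    fix x assume x: "x \<in> cball p r"
    then have "x \<in> S" using r(2) by blast
    from d[OF this] show "((\<lambda>p. F p y) has_derivative F' x y) (at x within cball p r)"
      by (rule has_derivative_at_withinI)
    show "onorm (F' x y) \<le> C"
      by (rule onorm_le) (rule F'_bound[OF x])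
  next
    show "convex (cball p r)" by (rule convex_cball)
    show "q \<in> cball p r" by (rule q)
    show "p \<in> cball p r" using r(1) by simp
  qed
  show ?thesis unfolding F'_def[symmetric] has_derivative_iff_norm tendsto_at_iff_sequentially
  proof (intro conjI allI impI)
    show "bounded_linear (\<lambda>h. \<integral>y. F' p y h * f y \<partial>\<mu>)"
    proof -
      have "(\<lambda>h. \<integral>y. F' p y h * f y \<partial>\<mu>) = (\<lambda>h. \<Sum>b\<in>Basis. (h \<bullet> b) * (\<integral>y. F' p y b * f y \<partial>\<mu>))"
        by (subst rep_f, subst Bochner_Integration.integral_sum) (auto intro!: integrable_mult_right integrable_param[OF cF' p])
      then show ?thesis
        by (auto intro!: bounded_linear_sum bounded_linear_mult_const bounded_linear_inner_left)
    qed
    fix X assume X: "\<forall>i. X i \<in> UNIV - {p}" "X \<longlonglongrightarrow> p"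
    have ne: "norm (X n - p) > 0" for n using X(1) by auto
    define R where "R n y = (F (X n) y - F p y - F' p y (X n - p)) / norm (X n - p)" for n y
    have "\<forall>\<^sub>F n in sequentially. X n \<in> cball p r"
      using tendstoD[OF X(2) r(1)] by eventually_elim (simp add: dist_commute)
    then obtain n0 where n0: "\<And>n. n \<ge> n0 \<Longrightarrow> X n \<in> cball p r" by (auto simp: eventually_sequentially)
    have R_int: "integrable \<mu> (\<lambda>y. R n y * f y)"
      and R_eq: "(\<integral>y. R n y * f y \<partial>\<mu>) = ((\<integral>y. F (X n) y * f y \<partial>\<mu>) - (\<integral>y. F p y * f y \<partial>\<mu>) - (\<integral>y. F' p y (X n - p) * f y \<partial>\<mu>)) / norm (X n - p)"
      if "n \<ge> n0" for n
    proof -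
      have Xn: "X n \<in> S" using n0[OF that] r by auto
      have *: "(\<lambda>y. R n y * f y) = (\<lambda>y. (F (X n) y * f y - F p y * f y - F' p y (X n - p) * f y) / norm (X n - p))"
        by (simp add: R_def fun_eq_iff algebra_simps diff_divide_distrib)
      show "integrable \<mu> (\<lambda>y. R n y * f y)" unfolding *
        by (intro integrable_divide Bochner_Integration.integrable_diff int int' Xn p)
      show "(\<integral>y. R n y * f y \<partial>\<mu>) = ((\<integral>y. F (X n) y * f y \<partial>\<mu>) - (\<integral>y. F p y * f y \<partial>\<mu>) - (\<integral>y. F' p y (X n - p) * f y \<partial>\<mu>)) / norm (X n - p)"
        unfolding * by (simp add: int int' Xn p)
    qed
    have "(\<lambda>n. \<integral>y. R (n + n0) y * f y \<partial>\<mu>) \<longlonglongrightarrow> (\<integral>y. 0 \<partial>\<mu>)"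
    proof (rule integral_dominated_convergence[where w = "\<lambda>_. 2 * C"])
      show "AE y in \<mu>. (\<lambda>n. R (n + n0) y * f y) \<longlonglongrightarrow> 0"
      proof (intro AE_I2 tendsto_mult_left_zero LIMSEQ_ignore_initial_segment)
        fix y
        have "((\<lambda>q. norm (F q y - F p y - F' p y (q - p)) / norm (q - p)) \<longlongrightarrow> 0) (at p)"
          using d[OF p, of y] by (simp add: has_derivative_iff_norm)
        then have "(\<lambda>n. norm (F (X n) y - F p y - F' p y (X n - p)) / norm (X n - p)) \<longlonglongrightarrow> 0"
          using X unfolding tendsto_at_iff_sequentially by (auto simp: o_def)
        then have "(\<lambda>n. norm (R n y)) \<longlonglongrightarrow> 0" by (simp add: R_def abs_mult)
        then show "(\<lambda>n. R n y) \<longlonglongrightarrow> 0" by (rule tendsto_norm_zero_cancel)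
      qed
      show "AE y in \<mu>. norm (R (n + n0) y * f y) \<le> 2 * C" for n
      proof (rule AE_I2)
        fix y
        have "\<bar>F (X (n + n0)) y - F p y - F' p y (X (n + n0) - p)\<bar> \<le> 2 * C * norm (X (n + n0) - p)"
          using lip[OF n0, of "n + n0" y] F'_bound[of p y "X (n + n0) - p"] r(1) by simp
        then have R: "\<bar>R (n + n0) y\<bar> \<le> 2 * C" using ne[of "n + n0"] by (simp add: R_def field_simps)
        have "\<bar>R (n + n0) y\<bar> * \<bar>f y\<bar> \<le> 2 * C * 1" using R f_bounded[of y] by (intro mult_mono) auto
        then show "norm (R (n + n0) y * f y) \<le> 2 * C" by (simp add: abs_mult)
      qed
      show "integrable \<mu> (\<lambda>_. 2 * C)" using finite_measure.integrable_const[OF fin] .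
      show "(\<lambda>y. R (n + n0) y * f y) \<in> borel_measurable \<mu>" for n using R_int[of "n + n0"] by simp
    qed simp
    then have "(\<lambda>n. ((\<integral>y. F (X (n + n0)) y * f y \<partial>\<mu>) - (\<integral>y. F p y * f y \<partial>\<mu>) - (\<integral>y. F' p y (X (n + n0) - p) * f y \<partial>\<mu>)) / norm (X (n + n0) - p)) \<longlonglongrightarrow> 0"
      by (simp add: R_eq)
    from tendsto_norm_zero[OF LIMSEQ_offset[OF this]]
    show "((\<lambda>q. norm ((\<integral>y. F q y * f y \<partial>\<mu>) - (\<integral>y. F p y * f y \<partial>\<mu>) - (\<integral>y. F' p y (q - p) * f y \<partial>\<mu>)) / norm (q - p)) \<circ> X) \<longlonglongrightarrow> 0"
      by (simp add: o_def abs_mult)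
  qed
qed

lemma Ck_param_SucD: "Ck_param (Suc k) F S \<Longrightarrow> Ck_param k F S"
proof (induction k arbitrary: F)
  case 0 then show ?case by simp
next
  case (Suc k)
  show ?case
    using Suc.prems[unfolded Ck_param.simps(2)[of "Suc k" F S]] Suc.IH
    unfolding Ck_param.simps(2)[of k F S] by blast
qed

lemma Ck_param_mono: "Ck_param k F S \<Longrightarrow> j \<le> k \<Longrightarrow> Ck_param j F S"
  by (induction k) (auto simp del: Ck_param.simps(2) simp: le_Suc_eq dest: Ck_param_SucD)

lemma Ck_on_integral_param:
  fixes F :: "'a::euclidean_space \<Rightarrow> 'm \<Rightarrow> real"
  assumes S: "open S"
  shows "Ck_param k F S \<Longrightarrow> Ck_on k (\<lambda>p. \<integral>y. F p y * f y \<partial>\<mu>) S"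
proof (induction k arbitrary: F)
  case 0 then show ?case by (simp add: continuous_on_integral_param)
next
  case (Suc k)
  have "Ck_param (Suc 0) F S" by (rule Ck_param_mono[OF Suc.prems]) simp
  note d = has_derivative_integral_param[OF S this]
  show ?case
    by (rule Ck_on_SucI[OF S d Suc.IH]) (use Suc.prems in auto)
qed

end

lemma (in compact_param) pd_integral_param:
  fixes F :: "'a::euclidean_space \<Rightarrow> 'm \<Rightarrow> real"
  assumes S: "open S" and F: "Ck_param (Suc k) F S" and p: "p \<in> S"
  shows "pd b (\<lambda>p. \<integral>y. F p y * f y \<partial>\<mu>) p = (\<integral>y. pd b (\<lambda>p. F p y) p * f y \<partial>\<mu>)"
  using has_derivative_integral_param[OF S Ck_param_mono[OF F] p] by (simp add: frechet_derivative_at[symmetric])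

text \<open>By compactness finitely many balls in charts cover the manifold, and the density is bounded on each of them.\<close>

lemma riemannian_volume_finite:
  fixes A :: "('m::{t2_space,second_countable_topology}, 'n::finite) chart set"
  assumes comp: "compact (UNIV :: 'm set)" and A: "smooth_atlas A" and h: "riemannian_metric A h"
    and \<mu>: "riemannian_volume A h \<mu>"
  shows "finite_measure \<mu>"
proof -
  have sets: "sets \<mu> = sets borel" using \<mu> by (simp add: riemannian_volume_def)
  have "\<exists>B. open B \<and> x \<in> B \<and> emeasure \<mu> B < \<infinity>" for x
  proof -
    obtain c where c: "c \<in> A" "x \<in> cdom c" by (rule atlas_cover[OF A])
    note f = atlas_facts[OF A c(1)]
    have "coord c x \<in> cimg c" using c by (simp add: cimg_def)
    then obtain r where r: "r > 0" "cball (coord c x) r \<subseteq> cimg c" using f(2) open_contains_cball by blast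
    define B where "B = cdom c \<inter> coord c -` ball (coord c x) r"
    have oB: "open B" unfolding B_def
      using f by (auto intro!: continuous_open_preimage simp: homeomorphism_def)
    have "coord c ` B = cimg c \<inter> ball (coord c x) r" unfolding B_def cimg_def by blast
    then have img: "coord c ` B = ball (coord c x) r"
      using r(2) ball_subset_cball[of "coord c x" r] by blast
    have "continuous_on (cimg c) (\<lambda>z. sqrt (det (in_chart h c z)))"
    proof -
      have "smooth_on (cimg c) (in_chart h c)" using h c(1) by (simp add: riemannian_metric_def)
      then have "continuous_on (cimg c) (in_chart h c)" unfolding smooth_on_def by (metis Ck_on.simps(1))
      then have "Ck_on 0 (\<lambda>z. in_chart h c z $ i $ j) (cimg c)" for i j
        unfolding Ck_on.simps by (intro continuous_on_component)
      from Ck_on_det[OF f(2) this] show ?thesis by (simp add: continuous_on_real_sqrt)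
    qed
    then have "compact ((\<lambda>z. sqrt (det (in_chart h c z))) ` cball (coord c x) r)"
      using r by (intro compact_continuous_image compact_cball) (auto intro: continuous_on_subset)
    from compact_imp_bounded[OF this] obtain M where "\<forall>v\<in>(\<lambda>z. sqrt (det (in_chart h c z))) ` cball (coord c x) r. norm v \<le> M"
      unfolding bounded_iff by blast
    then have M: "\<bar>sqrt (det (in_chart h c z))\<bar> \<le> M" if "z \<in> cball (coord c x) r" for z
      using that by simp
    have "B \<subseteq> cdom c" by (auto simp: B_def)
    then have "emeasure \<mu> B = (\<integral>\<^sup>+ z \<in> coord c ` B. ennreal (sqrt (det (in_chart h c z))) \<partial>lborel)"
      using \<mu> c oB by (auto simp: riemannian_volume_def)
    also have "\<dots> \<le> (\<integral>\<^sup>+ z. ennreal M * indicator (ball (coord c x) r) z \<partial>lborel)"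
      unfolding img
    proof (rule nn_integral_mono)
      fix z
      show "ennreal (sqrt (det (in_chart h c z))) * indicator (ball (coord c x) r) z \<le> ennreal M * indicator (ball (coord c x) r) z"
        using M[of z] by (auto simp: indicator_def intro!: ennreal_leI split: if_splits)
    qed
    also have "\<dots> = ennreal M * emeasure lborel (ball (coord c x) r)" by (simp add: nn_integral_cmult_indicator)
    also have "\<dots> < \<infinity>" using emeasure_bounded_finite[OF bounded_ball[of "coord c x" r]] by (simp add: ennreal_mult_less_top)
    finally show ?thesis using oB c r by (intro exI[of _ B]) (auto simp: B_def)
  qed
  then obtain B where B: "\<And>x. open (B x)" "\<And>x. x \<in> B x" "\<And>x. emeasure \<mu> (B x) < \<infinity>" by metis
  obtain D where D: "finite D" "UNIV \<subseteq> (\<Union>x\<in>D. B x)"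
    by (rule compactE_image[OF comp, of UNIV B]) (use B in auto)
  have "emeasure \<mu> (space \<mu>) \<le> emeasure \<mu> (\<Union>x\<in>D. B x)"
    using D B(1) by (intro emeasure_mono) (auto simp: sets)
  also have "\<dots> \<le> (\<Sum>x\<in>D. emeasure \<mu> (B x))"
    using D B(1) by (intro emeasure_subadditive_finite) (auto simp: sets)
  also have "\<dots> < \<infinity>" using D B(3) by simp
  finally show ?thesis by (intro finite_measureI) simp
qed

section \<open>The standard normal distribution function and its inverse\<close>

text \<open>The standard normal distribution function, written as the upper tail at \<open>- h\<close>: in the comparison with \<open>Z\<close> it
  occurs as the probability of \<open>{Z > - \<sigma> h}\<close>.\<close>

definition Phi :: "real \<Rightarrow> real" where
  "Phi h = (\<integral>x. indicator {-h<..} x * std_normal_density x \<partial>lborel)"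

lemma std_normal_density_even: "std_normal_density (-h) = std_normal_density h"
  by (simp add: std_normal_density_def)

lemma Phi_integrable: "integrable lborel (\<lambda>x. indicator {a<..} x * std_normal_density x)"
  using integrable_mult_indicator[of "{a<..}" lborel std_normal_density] integrable_std_normal_moment[of 0] by simp

lemma Phi_has_derivative: "(Phi has_real_derivative std_normal_density h) (at h)"
proof -
  define Q where "Q u = (LBINT y=0..u. std_normal_density y)" for u :: real
  have si: "set_integrable lborel B std_normal_density" if "B \<in> sets lborel" for B
    using integrable_mult_indicator[OF that, of std_normal_density] integrable_std_normal_moment[of 0]
    by (simp add: set_integrable_def)
  have Phi_eq: "Phi h = Phi 0 - Q (- h)" for h
  proof -
    have tail: "Phi h = (LBINT x=ereal (-h)..\<infinity>. std_normal_density x)" for h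
      by (simp add: Phi_def interval_lebesgue_integral_def set_lebesgue_integral_def einterval_eq_Ici)
    have "(LBINT x=0..ereal (-h). std_normal_density x) + (LBINT x=ereal (-h)..\<infinity>. std_normal_density x)
       = (LBINT x=0..\<infinity>. std_normal_density x)"
      by (rule interval_integral_sum) (simp add: interval_lebesgue_integrable_def si)
    then show ?thesis using tail[of h] tail[of 0] by (simp add: Q_def zero_ereal_def)
  qed
  have cont: "continuous_on {- \<bar>h\<bar> - 1 .. \<bar>h\<bar> + 1} std_normal_density"
    unfolding std_normal_density_def by (intro continuous_intros) auto
  have "(Q has_vector_derivative std_normal_density (-h)) (at (-h) within {- \<bar>h\<bar> - 1 .. \<bar>h\<bar> + 1})"
    unfolding Q_def
    using interval_integral_FTC2[of "- \<bar>h\<bar> - 1" 0 "\<bar>h\<bar> + 1" std_normal_density "-h"] cont by (simp add: zero_ereal_def)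
  then have "(Q has_vector_derivative std_normal_density (-h)) (at (-h))"
    by (subst (asm) at_within_interior) auto
  then have "(Q has_real_derivative std_normal_density (-h)) (at (-h))"
    by (simp add: has_real_derivative_iff_has_vector_derivative)
  then have "((\<lambda>h. Q (- h)) has_real_derivative std_normal_density (-h) * (-1)) (at h)"
    by (rule DERIV_chain2) (auto intro!: derivative_eq_intros)
  then have "((\<lambda>h. Phi 0 - Q (- h)) has_real_derivative std_normal_density h) (at h)"
    by (auto intro!: derivative_eq_intros simp: std_normal_density_even)
  moreover have "(\<lambda>h. Phi 0 - Q (- h)) = Phi" by (rule ext) (rule Phi_eq[symmetric])
  ultimately show ?thesis by simp
qed

lemma Phi_strict_mono: "a < b \<Longrightarrow> Phi a < Phi b"
  using DERIV_pos_imp_increasing[of a b Phi] Phi_has_derivative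
  by (meson normal_density_pos zero_less_one)

lemma Phi_at_top: "(Phi \<longlongrightarrow> 1) at_top"
proof -
  have "((\<lambda>h. \<integral>x. indicator {-h<..} x * std_normal_density x \<partial>lborel) \<longlongrightarrow> (\<integral>x. std_normal_density x \<partial>lborel)) at_top"
  proof (rule integral_dominated_convergence_at_top[where w = std_normal_density])
    show "AE x in lborel. ((\<lambda>h. indicator {-h<..} x * std_normal_density x) \<longlongrightarrow> std_normal_density x) at_top"
    proof (rule AE_I2, rule tendsto_eventually)
      fix x :: real
      show "\<forall>\<^sub>F h in at_top. indicator {-h<..} x * std_normal_density x = std_normal_density x"
        using eventually_gt_at_top[of "-x"] by eventually_elim simp
    qed
  qed (use integrable_std_normal_moment[of 0] in \<open>auto simp: indicator_def\<close>)
  then show ?thesis using integral_std_normal_moment_even[of 0] by (simp add: Phi_def[abs_def])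
qed

lemma Phi_at_bot: "(Phi \<longlongrightarrow> 0) at_bot"
proof -
  have "((\<lambda>h. \<integral>x. indicator {h<..} x * std_normal_density x \<partial>lborel) \<longlongrightarrow> (\<integral>x. 0 \<partial>(lborel :: real measure))) at_top"
  proof (rule integral_dominated_convergence_at_top[where w = std_normal_density])
    show "AE x in lborel. ((\<lambda>h. indicator {h<..} x * std_normal_density x) \<longlongrightarrow> 0) at_top"
    proof (rule AE_I2, rule tendsto_eventually)
      fix x :: real
      show "\<forall>\<^sub>F h in at_top. indicator {h<..} x * std_normal_density x = 0"
        using eventually_gt_at_top[of x] by eventually_elim simp
    qed
  qed (use integrable_std_normal_moment[of 0] in \<open>auto simp: indicator_def\<close>)
  then show ?thesis by (simp add: Phi_def[abs_def] filterlim_at_bot_mirror)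
qed

lemma Phi_surj: assumes "0 < p" "p < 1" obtains h where "Phi h = p"
proof -
  have "\<forall>\<^sub>F h in at_top. Phi h > p" using Phi_at_top assms(2) by (rule order_tendstoD)
  then obtain b where b: "\<And>h. h \<ge> b \<Longrightarrow> Phi h > p" by (auto simp: eventually_at_top_linorder)
  have "\<forall>\<^sub>F h in at_bot. Phi h < p" using Phi_at_bot assms(1) by (rule order_tendstoD)
  then obtain a where a: "\<And>h. h \<le> a \<Longrightarrow> Phi h < p" by (auto simp: eventually_at_bot_linorder)
  have "\<exists>x\<ge>min a b. x \<le> max a b \<and> Phi x = p"
    using a[of "min a b"] b[of "max a b"]
    by (intro IVT' continuous_at_imp_continuous_on ballI DERIV_isCont[OF Phi_has_derivative]) auto
  with that show thesis by blast
qed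

definition Psi :: "real \<Rightarrow> real" where "Psi = inv Phi"

lemma Psi_Phi: "Psi (Phi h) = h"
  unfolding Psi_def by (rule inv_f_f) (metis Phi_strict_mono injI less_irrefl linorder_neqE_linordered_idom)

lemma Phi_Psi: "0 < p \<Longrightarrow> p < 1 \<Longrightarrow> Phi (Psi p) = p"
  by (metis Phi_surj Psi_Phi)

lemma Psi_has_derivative:
  assumes "0 < p" "p < 1"
  shows "(Psi has_real_derivative sqrt (2 * pi) * exp ((Psi p)\<^sup>2 / 2)) (at p)"
proof -
  have "(Psi has_real_derivative inverse (std_normal_density (Psi p))) (at p)"
  proof (rule DERIV_inverse_function[where f = Phi and a = 0 and b = 1])
    show "isCont Psi p"
    proof -
      have "isCont Psi (Phi (Psi p))"
        by (rule isCont_inverse_function[of 1 "Psi p" Psi Phi])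
          (auto simp: Psi_Phi intro: DERIV_isCont[OF Phi_has_derivative])
      then show ?thesis by (simp add: Phi_Psi assms)
    qed
    show "std_normal_density (Psi p) \<noteq> 0" using normal_density_pos[of 1 0 "Psi p"] by linarith
  qed (use assms in \<open>auto simp: Phi_Psi intro: Phi_has_derivative\<close>)
  moreover have "inverse (std_normal_density (Psi p)) = sqrt (2 * pi) * exp ((Psi p)\<^sup>2 / 2)"
    unfolding std_normal_density_def minus_divide_left exp_minus[of "(Psi p)\<^sup>2 / 2", symmetric]
    by (simp add: exp_minus field_simps)
  ultimately show ?thesis by simp
qed

lemma integral_tail_first_moment:
  "(\<integral>x. indicator {-h<..} x * (std_normal_density x * x) \<partial>lborel) = std_normal_density h"
proof -
  have int: "integrable lborel (\<lambda>x. std_normal_density x * x)" using integrable_std_normal_moment[of 1] by simp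
  have "(LBINT x=ereal (-h)..\<infinity>. std_normal_density x * x) = 0 - (- std_normal_density (-h))"
  proof (rule interval_integral_FTC_integrable[where F = "\<lambda>x. - std_normal_density x"])
    show "((\<lambda>x. - std_normal_density x) has_vector_derivative std_normal_density x * x) (at x)" for x
      unfolding has_real_derivative_iff_has_vector_derivative[symmetric] std_normal_density_def
      by (auto intro!: derivative_eq_intros simp: field_simps)
    show "isCont (\<lambda>x. std_normal_density x * x) x" for x
      unfolding std_normal_density_def by (intro continuous_intros) auto
    show "set_integrable lborel (einterval (ereal (- h)) \<infinity>) (\<lambda>x. std_normal_density x * x)"
      unfolding set_integrable_def by (rule integrable_mult_indicator[OF _ int]) simp
    show "(((\<lambda>x. - std_normal_density x) \<circ> real_of_ereal) \<longlongrightarrow> - std_normal_density (- h)) (at_right (ereal (- h)))"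
      unfolding ereal_tendsto_simps std_normal_density_def
      by (intro tendsto_intros tendsto_within_subset[where S = UNIV]) auto
    show "(((\<lambda>x. - std_normal_density x) \<circ> real_of_ereal) \<longlongrightarrow> 0) (at_left \<infinity>)"
      unfolding ereal_tendsto_simps std_normal_density_def by real_asymp
  qed simp
  then show ?thesis
    by (simp add: std_normal_density_even interval_lebesgue_integral_def set_lebesgue_integral_def einterval_eq_Ici)
qed

text \<open>With \<open>X = Z / \<sigma>\<close> the left side of the last inequality is the integral of \<open>\<sigma> X - b\<close> over the event \<open>{X > - h}\<close>, and
  passing to the positive part over the whole space can only increase it.\<close>

lemma gaussian_stop_loss:
  assumes P: "prob_space P" and Z: "distributed P lborel Z (normal_density 0 \<sigma>)" and \<sigma>: "\<sigma> > 0"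
  shows "integrable P Z" "(\<integral>\<omega>. Z \<omega> \<partial>P) = 0"
    and "\<sigma> * std_normal_density h - b * Phi h \<le> (\<integral>\<omega>. max 0 (Z \<omega> - b) \<partial>P)"
proof -
  interpret prob_space P by (rule P)
  have X: "distributed P lborel (\<lambda>x. Z x / \<sigma>) std_normal_density"
    using normal_standard_normal_convert[OF \<sigma>, of Z 0] Z by simp
  have nn: "AE x in lborel. 0 \<le> std_normal_density x" by simp
  have iX: "integrable P (\<lambda>x. Z x / \<sigma>)"
    using distributed_integrable[OF X, of "\<lambda>x. x"] integrable_std_normal_moment[of 1] by simp
  have "integrable P (\<lambda>x. \<sigma> * (Z x / \<sigma>))" by (rule integrable_mult_right[OF iX])
  then show iZ: "integrable P Z" using \<sigma> by simp
  have "(\<integral>x. Z x / \<sigma> \<partial>P) = 0"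
    using distributed_integral[OF X, of "\<lambda>x. x"] integral_std_normal_moment_odd[of 0] by simp
  then show "(\<integral>\<omega>. Z \<omega> \<partial>P) = 0" using \<sigma> by simp
  have i1: "integrable lborel (\<lambda>x. std_normal_density x * x)" using integrable_std_normal_moment[of 1] by simp
  have i0: "integrable lborel (\<lambda>x. std_normal_density x)" using integrable_std_normal_moment[of 0] by simp
  have ind: "integrable lborel (\<lambda>x. indicator {-h<..} x * (std_normal_density x * x))"
    using integrable_mult_indicator[OF _ i1, of "{-h<..}"] by simp
  have "\<sigma> * std_normal_density h - b * Phi h =
     (\<integral>x. \<sigma> * (indicator {-h<..} x * (std_normal_density x * x)) - b * (indicator {-h<..} x * std_normal_density x) \<partial>lborel)"
    by (simp add: ind Phi_integrable integral_tail_first_moment Phi_def)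
  also have "\<dots> \<le> (\<integral>x. std_normal_density x * max 0 (\<sigma> * x - b) \<partial>lborel)"
  proof (rule integral_mono)
    show "integrable lborel (\<lambda>x. \<sigma> * (indicator {-h<..} x * (std_normal_density x * x)) - b * (indicator {-h<..} x * std_normal_density x))"
      by (intro Bochner_Integration.integrable_diff integrable_mult_right ind Phi_integrable)
    have "integrable lborel (\<lambda>x. max 0 (\<sigma> * (std_normal_density x * x) - b * std_normal_density x))"
      by (intro Bochner_Integration.integrable_diff integrable_max integrable_mult_right i0 i1 integrable_zero)
    moreover have "max 0 (\<sigma> * (std_normal_density x * x) - b * std_normal_density x) = std_normal_density x * max 0 (\<sigma> * x - b)" for x
      using max_mult_distrib_left[of "std_normal_density x" 0 "\<sigma> * x - b"] by (simp add: algebra_simps)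
    ultimately show "integrable lborel (\<lambda>x. std_normal_density x * max 0 (\<sigma> * x - b))" by simp
    fix x :: real
    have "std_normal_density x * (\<sigma> * x - b) \<le> std_normal_density x * max 0 (\<sigma> * x - b)"
      by (intro mult_left_mono) auto
    then show "\<sigma> * (indicator {-h<..} x * (std_normal_density x * x)) - b * (indicator {-h<..} x * std_normal_density x) \<le> std_normal_density x * max 0 (\<sigma> * x - b)"
      by (auto simp: indicator_def algebra_simps)
  qed
  also have "\<dots> = (\<integral>x. max 0 (\<sigma> * (Z x / \<sigma>) - b) \<partial>P)"
    by (rule distributed_integral[OF X]) auto
  finally show "\<sigma> * std_normal_density h - b * Phi h \<le> (\<integral>\<omega>. max 0 (Z \<omega> - b) \<partial>P)" using \<sigma> by simp
qed

section \<open>Convex order from stop-loss transforms\<close>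

lemma convex_subgradient:
  fixes \<psi> :: "real \<Rightarrow> real"
  assumes "convex_on UNIV \<psi>"
  obtains d where "\<And>x. \<psi> a + d * (x - a) \<le> \<psi> x"
  using convex_le_Inf_differential[OF assms, of a] by (metis UNIV_I interior_UNIV)

text \<open>For tangents \<open>l 0, l 1, \<dots>\<close> of a convex function at increasing points, this is the maximum of the first ones.
  The form as a sum of ramps is chosen because expectations of ramps can be compared one by one.\<close>

primrec tangent_envelope :: "(nat \<Rightarrow> real \<Rightarrow> real) \<Rightarrow> nat \<Rightarrow> real \<Rightarrow> real" where
  "tangent_envelope l 0 x = l 0 x"
| "tangent_envelope l (Suc k) x = tangent_envelope l k x + max 0 (l (Suc k) x - l k x)"

lemma tangent_envelope_mono: "j \<le> k \<Longrightarrow> tangent_envelope l j x \<le> tangent_envelope l k x"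
  by (induction k) (auto simp: le_Suc_eq max_def)

text \<open>Convexity makes the slopes increase, so the tangent at \<open>a (Suc k)\<close> is below the one at \<open>a k\<close> to the left of \<open>a k\<close>
  and above it to the right of \<open>a (Suc k)\<close>. The new ramp thus vanishes to the left of \<open>a k\<close>, and to the right of
  \<open>a k\<close> the sum equals the maximum of the last two tangents.\<close>

lemma tangent_envelope_bounds:
  fixes a d :: "nat \<Rightarrow> real"
  assumes a: "\<And>k. a k < a (Suc k)" and sub: "\<And>k x. \<psi> (a k) + d k * (x - a k) \<le> \<psi> x"
  defines "l \<equiv> \<lambda>k x. \<psi> (a k) + d k * (x - a k)"
  shows "tangent_envelope l k x \<le> \<psi> x" and "a k \<le> x \<Longrightarrow> tangent_envelope l k x = l k x"
    and "d k \<le> d (Suc k)"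
proof -
  have mono: "d k \<le> d (Suc k)" for k
  proof -
    have "d k * (a (Suc k) - a k) \<le> \<psi> (a (Suc k)) - \<psi> (a k)"
      "\<psi> (a (Suc k)) - \<psi> (a k) \<le> d (Suc k) * (a (Suc k) - a k)"
      using sub[of k "a (Suc k)"] sub[of "Suc k" "a k"] by (auto simp: algebra_simps)
    then have "d k * (a (Suc k) - a k) \<le> d (Suc k) * (a (Suc k) - a k)" by linarith
    then show ?thesis using a[of k] by simp
  qed
  then show "d k \<le> d (Suc k)" .
  have low: "l (Suc k) x \<le> l k x" if "x \<le> a k" for k x
  proof -
    have "(d (Suc k) - d k) * (x - a k) \<le> 0" using mono[of k] that by (simp add: mult_nonneg_nonpos)
    moreover have "l (Suc k) (a k) \<le> \<psi> (a k)" using sub by (simp add: l_def)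
    ultimately show ?thesis by (simp add: l_def algebra_simps)
  qed
  have high: "l k x \<le> l (Suc k) x" if "a (Suc k) \<le> x" for k x
  proof -
    have "0 \<le> (d (Suc k) - d k) * (x - a (Suc k))" using mono[of k] that by simp
    moreover have "l k (a (Suc k)) \<le> \<psi> (a (Suc k))" using sub by (simp add: l_def)
    ultimately show ?thesis by (simp add: l_def algebra_simps)
  qed
  have "(\<forall>x. tangent_envelope l k x \<le> \<psi> x) \<and> (\<forall>x\<ge>a k. tangent_envelope l k x = l k x)"
  proof (induction k)
    case 0 then show ?case using sub by (simp add: l_def)
  next
    case (Suc k)
    show ?case
    proof (intro conjI allI impI)
      fix x
      show "tangent_envelope l (Suc k) x \<le> \<psi> x"
      proof (cases "x \<le> a k")
        case True then show ?thesis using Suc low[OF True] by simp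
      next
        case False
        then have "tangent_envelope l (Suc k) x = max (l k x) (l (Suc k) x)" using Suc by (simp add: max_def)
        then show ?thesis using sub by (simp add: l_def)
      qed
    next
      fix x assume x: "a (Suc k) \<le> x"
      then have "tangent_envelope l k x = l k x" using Suc a[of k] by simp
      then show "tangent_envelope l (Suc k) x = l (Suc k) x" using high[OF x] by simp
    qed
  qed
  then show "tangent_envelope l k x \<le> \<psi> x" and "a k \<le> x \<Longrightarrow> tangent_envelope l k x = l k x" by auto
qed

locale stop_loss_order = S: prob_space \<nu> + Z: prob_space P
  for \<nu> :: "'a measure" and P :: "'z measure" +
  fixes S :: "'a \<Rightarrow> real" and Z :: "'z \<Rightarrow> real"
  assumes int_S: "integrable \<nu> S" and int_Z: "integrable P Z"
    and mean: "(\<integral>y. S y \<partial>\<nu>) = (\<integral>\<omega>. Z \<omega> \<partial>P)"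
    and stop_loss: "\<And>b. (\<integral>y. max 0 (S y - b) \<partial>\<nu>) \<le> (\<integral>\<omega>. max 0 (Z \<omega> - b) \<partial>P)"
begin

lemma int_max: "integrable \<nu> (\<lambda>y. max 0 (D * S y - e))" "integrable P (\<lambda>\<omega>. max 0 (D * Z \<omega> - e))"
  by (intro integrable_max Bochner_Integration.integrable_diff integrable_mult_right int_S int_Z integrable_zero
      S.integrable_const Z.integrable_const)+

lemma integral_ramp_le:
  assumes "D \<ge> 0" "D = 0 \<Longrightarrow> e \<ge> 0"
  shows "(\<integral>y. max 0 (D * S y - e) \<partial>\<nu>) \<le> (\<integral>\<omega>. max 0 (D * Z \<omega> - e) \<partial>P)"
proof (cases "D = 0")
  case False
  have "max 0 (D * x - e) = D * max 0 (x - e / D)" for x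
    using assms(1) False max_mult_distrib_left[of D 0 "x - e / D"] by (simp add: algebra_simps)
  then show ?thesis using stop_loss[of "e / D"] assms(1) by (simp add: mult_left_mono)
qed (use assms in simp)

text \<open>\<open>(- x - b)\<^sup>+ = (x + b)\<^sup>+ - x - b\<close>, and the means agree.\<close>

lemma reflect: "stop_loss_order \<nu> P (\<lambda>y. - S y) (\<lambda>\<omega>. - Z \<omega>)"
proof unfold_locales
  fix b
  have *: "max 0 (- x - b) = max 0 (1 * x - (- b)) - x - b" for x :: real by (simp add: max_def)
  show "(\<integral>y. max 0 (- S y - b) \<partial>\<nu>) \<le> (\<integral>\<omega>. max 0 (- Z \<omega> - b) \<partial>P)"
    unfolding * using stop_loss[of "-b"] int_max[of 1 "-b"] int_S int_Z mean
    by (simp add: S.prob_space Z.prob_space)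
qed (use int_S int_Z mean in auto)

text \<open>Fatou's lemma for tangent envelopes at the points \<open>0, 1/(n+1), 2/(n+1), \<dots>, n+1\<close>. They are nonnegative, below \<open>\<psi>\<close>,
  and converge to \<open>\<psi>\<close> with an error of at most one mesh width times the slope of \<open>\<psi>\<close> at the given point.\<close>

lemma right_convex:
  assumes \<psi>: "convex_on UNIV \<psi>" and nonneg: "\<And>x. 0 \<le> \<psi> x" and zero: "\<And>x. x \<le> 0 \<Longrightarrow> \<psi> x = 0"
  shows "(\<integral>\<^sup>+ y. ennreal (\<psi> (S y)) \<partial>\<nu>) \<le> (\<integral>\<^sup>+ \<omega>. ennreal (\<psi> (Z \<omega>)) \<partial>P)"
proof -
  \<comment> \<open>Slope \<open>0\<close> is a subgradient at the minimum; with this choice all envelopes start from the zero function.\<close>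
  have "\<exists>d. (\<forall>x. \<psi> a + d * (x - a) \<le> \<psi> x) \<and> (a = 0 \<longrightarrow> d = 0)" for a
  proof (cases "a = 0")
    case True
    then show ?thesis using nonneg zero[of 0] by (intro exI[of _ 0]) simp
  next
    case False
    obtain d where "\<And>x. \<psi> a + d * (x - a) \<le> \<psi> x" using convex_subgradient[OF \<psi>] by blast
    with False show ?thesis by blast
  qed
  then obtain d where d: "\<And>a x. \<psi> a + d a * (x - a) \<le> \<psi> x" "d 0 = 0" by metis
  define a where "a n k = real k / real (Suc n)" for n k :: nat
  define l where "l n k x = \<psi> (a n k) + d (a n k) * (x - a n k)" for n k x
  define \<phi> where "\<phi> n = tangent_envelope (l n) ((Suc n) * (Suc n))" for n
  have a_less: "a n k < a n (Suc k)" for n k by (simp add: a_def divide_strict_right_mono)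
  note bounds = tangent_envelope_bounds[where a = "a n" and d = "\<lambda>k. d (a n k)" and \<psi> = \<psi> for n, OF a_less d(1), folded l_def]
  have \<phi>_le: "\<phi> n x \<le> \<psi> x" for n x unfolding \<phi>_def by (rule bounds(1))
  have l0: "l n 0 x = 0" for n x using zero[of 0] d(2) by (simp add: l_def a_def)
  have env_nonneg: "0 \<le> tangent_envelope (l n) k x" for n k x
    using tangent_envelope_mono[of 0 k "l n" x] l0 by simp
  have \<phi>_nonneg: "0 \<le> \<phi> n x" for n x unfolding \<phi>_def by (rule env_nonneg)
  have env: "integrable \<nu> (\<lambda>y. tangent_envelope (l n) k (S y)) \<and> integrable P (\<lambda>\<omega>. tangent_envelope (l n) k (Z \<omega>)) \<and>
     (\<integral>y. tangent_envelope (l n) k (S y) \<partial>\<nu>) \<le> (\<integral>\<omega>. tangent_envelope (l n) k (Z \<omega>) \<partial>P)" for n k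
  proof (induction k)
    case 0 then show ?case by (simp add: l0)
  next
    case (Suc k)
    define D where "D = d (a n (Suc k)) - d (a n k)"
    define e where "e = D * a n k - (l n (Suc k) (a n k) - l n k (a n k))"
    have *: "l n (Suc k) x - l n k x = D * x - e" for x by (simp add: e_def D_def l_def algebra_simps)
    have "D \<ge> 0" using bounds(3)[of n k] by (simp add: D_def)
    moreover have "e \<ge> 0" if "D = 0" using that d(1)[of "a n (Suc k)" "a n k"] by (simp add: e_def l_def)
    ultimately show ?case using Suc integral_ramp_le[of D e] int_max[of D e] by (simp add: *)
  qed
  have le: "(\<integral>\<^sup>+ y. ennreal (\<phi> n (S y)) \<partial>\<nu>) \<le> (\<integral>\<^sup>+ \<omega>. ennreal (\<psi> (Z \<omega>)) \<partial>P)" for n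
  proof -
    note e = env[of n "Suc n * Suc n", folded \<phi>_def]
    have "(\<integral>\<^sup>+ y. ennreal (\<phi> n (S y)) \<partial>\<nu>) = ennreal (\<integral>y. \<phi> n (S y) \<partial>\<nu>)"
      using e by (intro nn_integral_eq_integral) (auto simp: \<phi>_nonneg)
    also have "\<dots> \<le> ennreal (\<integral>\<omega>. \<phi> n (Z \<omega>) \<partial>P)" using e by (intro ennreal_leI) auto
    also have "\<dots> = (\<integral>\<^sup>+ \<omega>. ennreal (\<phi> n (Z \<omega>)) \<partial>P)"
      using e by (intro nn_integral_eq_integral[symmetric]) (auto simp: \<phi>_nonneg)
    also have "\<dots> \<le> (\<integral>\<^sup>+ \<omega>. ennreal (\<psi> (Z \<omega>)) \<partial>P)"
      by (intro nn_integral_mono ennreal_leI) (rule \<phi>_le)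
    finally show ?thesis .
  qed
  have conv: "(\<lambda>n. \<phi> n x) \<longlonglongrightarrow> \<psi> x" for x
  proof (cases "x \<le> 0")
    case True
    have "\<phi> n x = \<psi> x" for n
      using \<phi>_nonneg[of n x] \<phi>_le[of n x] zero[OF True] by simp
    then show ?thesis by simp
  next
    case False
    have low: "\<psi> x - d x / real (Suc n) \<le> \<phi> n x" if "x \<le> real n" for n
    proof -
      define k where "k = nat \<lfloor>x * real (Suc n)\<rfloor>"
      have k: "real k \<le> x * real (Suc n)" "x * real (Suc n) < real k + 1" using False by (auto simp: k_def)
      have "x * real (Suc n) \<le> real (Suc n) * real (Suc n)" using that by (intro mult_right_mono) auto
      with k(1) have "real k \<le> real (Suc n * Suc n)" by (simp only: of_nat_mult)
      then have kle: "k \<le> Suc n * Suc n" by (simp only: of_nat_le_iff)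
      have "x - a n k = (x * real (Suc n) - real k) / real (Suc n)"
        by (simp add: a_def diff_divide_distrib del: of_nat_Suc)
      then have ax: "a n k \<le> x" "x - a n k \<le> 1 / real (Suc n)" "0 \<le> a n k"
        using k by (auto simp: a_def pos_divide_le_eq intro!: divide_right_mono simp del: of_nat_Suc)
      have dn: "0 \<le> d y" if "0 \<le> y" for y
      proof (cases "y = 0")
        case False
        have "\<psi> y - d y * y \<le> 0" using d(1)[of y 0] zero[of 0] by simp
        then have "0 \<le> d y * y" using nonneg[of y] by linarith
        then show ?thesis using that False by (simp add: zero_le_mult_iff)
      qed (simp add: d(2))
      have "d x * (x - a n k) \<le> d x * (1 / real (Suc n))"
        using dn[of x] ax False by (intro mult_left_mono) auto
      moreover have "\<psi> x + d x * (a n k - x) \<le> \<psi> (a n k)" by (rule d(1))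
      moreover have "0 \<le> d (a n k) * (x - a n k)" using dn[OF ax(3)] ax by simp
      ultimately have "\<psi> x - d x / real (Suc n) \<le> l n k x" by (simp add: l_def algebra_simps)
      also have "\<dots> = tangent_envelope (l n) k x" using bounds(2)[OF ax(1)] by simp
      also have "\<dots> \<le> \<phi> n x" unfolding \<phi>_def by (rule tangent_envelope_mono[OF kle])
      finally show ?thesis .
    qed
    show ?thesis
    proof (rule tendsto_sandwich)
      show "\<forall>\<^sub>F n in sequentially. \<psi> x - d x / real (Suc n) \<le> \<phi> n x"
        using eventually_ge_at_top[of "nat \<lceil>x\<rceil>"] by eventually_elim (rule low, linarith)
      show "\<forall>\<^sub>F n in sequentially. \<phi> n x \<le> \<psi> x" by (simp add: \<phi>_le)
      show "(\<lambda>n. \<psi> x - d x / real (Suc n)) \<longlonglongrightarrow> \<psi> x" by real_asymp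
    qed simp
  qed
  have "(\<integral>\<^sup>+ y. ennreal (\<psi> (S y)) \<partial>\<nu>) = (\<integral>\<^sup>+ y. liminf (\<lambda>n. ennreal (\<phi> n (S y))) \<partial>\<nu>)"
    by (intro nn_integral_cong lim_imp_Liminf[symmetric] tendsto_ennrealI conv) simp
  also have "\<dots> \<le> liminf (\<lambda>n. \<integral>\<^sup>+ y. ennreal (\<phi> n (S y)) \<partial>\<nu>)"
  proof (intro nn_integral_liminf measurable_compose[OF _ measurable_ennreal])
    fix n
    show "(\<lambda>y. \<phi> n (S y)) \<in> borel_measurable \<nu>"
      using env[of n "Suc n * Suc n", folded \<phi>_def] by (simp add: borel_measurable_integrable)
  qed
  also have "\<dots> \<le> (\<integral>\<^sup>+ \<omega>. ennreal (\<psi> (Z \<omega>)) \<partial>P)"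
    by (rule order_trans[OF Liminf_le_Limsup Limsup_bounded]) (simp_all add: le)
  finally show ?thesis .
qed

text \<open>Subtracting a tangent at \<open>0\<close>, whose integrals agree, leaves a nonnegative convex function with minimum \<open>0\<close>
  at \<open>0\<close>. Its parts on the two half lines are convex; one is treated directly, the other after reflection.\<close>

lemma ext_integral_convex_le:
  assumes \<psi>: "convex_on UNIV \<psi>"
  shows "ext_integral \<nu> (\<lambda>y. \<psi> (S y)) \<le> ext_integral P (\<lambda>\<omega>. \<psi> (Z \<omega>))"
proof -
  obtain d where d: "\<And>x. \<psi> 0 + d * (x - 0) \<le> \<psi> x" using convex_subgradient[OF \<psi>] by blast
  define q where "q x = \<psi> x - (\<psi> 0 + d * x)" for x
  define q1 where "q1 x = q (max 0 x)" for x
  define q2 where "q2 x = q (- max 0 x)" for x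
  have q0: "q 0 = 0" by (simp add: q_def)
  have qn: "0 \<le> q x" for x using d[of x] by (simp add: q_def)
  have aff: "\<psi> x = (\<psi> 0 + d * x) + q x" for x by (simp add: q_def)
  have split: "q x = q1 x + q2 (- x)" for x by (simp add: q1_def q2_def q0 max_def)
  have qc: "convex_on UNIV q"
  proof -
    have "convex_on UNIV (\<lambda>x. - \<psi> 0 - d * x)" by (rule convex_onI) (auto simp: algebra_simps)
    from convex_on_add[OF \<psi> this] show ?thesis by (simp add: q_def[abs_def] algebra_simps)
  qed
  have mono: "q x \<le> q y" if "0 \<le> x \<and> x \<le> y \<or> y \<le> x \<and> x \<le> 0" for x y
  proof (cases "y = 0")
    case False
    have t: "0 \<le> x / y" "x / y \<le> 1" using that False by (auto simp: divide_simps)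
    have "q ((1 - x / y) *\<^sub>R 0 + (x / y) *\<^sub>R y) \<le> (1 - x / y) * q 0 + (x / y) * q y"
      by (rule convex_onD[OF qc t]) auto
    then have "q x \<le> (x / y) * q y" using False by (simp add: q0)
    also have "\<dots> \<le> 1 * q y" using t qn by (intro mult_right_mono)
    finally show ?thesis by simp
  qed (use that in auto)
  have c1: "convex_on UNIV q1"
  proof (rule convex_onI)
    fix t x y :: real assume t: "0 < t" "t < 1"
    have "max 0 ((1 - t) * x + t * y) \<le> (1 - t) * max 0 x + t * max 0 y"
      using t by (intro max.boundedI add_mono mult_left_mono) auto
    then have "q1 ((1 - t) * x + t * y) \<le> q ((1 - t) *\<^sub>R max 0 x + t *\<^sub>R max 0 y)"
      unfolding q1_def by (intro mono) auto
    also have "\<dots> \<le> (1 - t) * q1 x + t * q1 y" unfolding q1_def by (rule convex_onD[OF qc]) (use t in auto)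
    finally show "q1 ((1 - t) *\<^sub>R x + t *\<^sub>R y) \<le> (1 - t) * q1 x + t * q1 y" by simp
  qed simp
  have c2: "convex_on UNIV q2"
  proof (rule convex_onI)
    fix t x y :: real assume t: "0 < t" "t < 1"
    have "max 0 ((1 - t) * x + t * y) \<le> (1 - t) * max 0 x + t * max 0 y"
      using t by (intro max.boundedI add_mono mult_left_mono) auto
    then have "q2 ((1 - t) * x + t * y) \<le> q ((1 - t) *\<^sub>R (- max 0 x) + t *\<^sub>R (- max 0 y))"
      unfolding q2_def by (intro mono) auto
    also have "\<dots> \<le> (1 - t) * q2 x + t * q2 y" unfolding q2_def by (rule convex_onD[OF qc]) (use t in auto)
    finally show "q2 ((1 - t) *\<^sub>R x + t *\<^sub>R y) \<le> (1 - t) * q2 x + t * q2 y" by simp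
  qed simp
  have meas: "f \<in> borel_measurable borel" if "convex_on UNIV f" for f :: "real \<Rightarrow> real"
    using that by (intro borel_measurable_continuous_onI convex_on_continuous) auto
  note [measurable] = meas[OF c1] meas[OF c2] meas[OF qc] borel_measurable_integrable[OF int_S] borel_measurable_integrable[OF int_Z]
  interpret R: stop_loss_order \<nu> P "\<lambda>y. - S y" "\<lambda>\<omega>. - Z \<omega>" by (rule reflect)
  have "(\<integral>\<^sup>+ y. ennreal (q (S y)) \<partial>\<nu>) = (\<integral>\<^sup>+ y. ennreal (q1 (S y)) \<partial>\<nu>) + (\<integral>\<^sup>+ y. ennreal (q2 (- S y)) \<partial>\<nu>)"
    unfolding split by (subst nn_integral_add[symmetric]) (auto simp: q1_def q2_def qn ennreal_plus[symmetric] simp del: ennreal_plus)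
  also have "\<dots> \<le> (\<integral>\<^sup>+ \<omega>. ennreal (q1 (Z \<omega>)) \<partial>P) + (\<integral>\<^sup>+ \<omega>. ennreal (q2 (- Z \<omega>)) \<partial>P)"
    by (intro add_mono right_convex R.right_convex c1 c2) (auto simp: q1_def q2_def qn q0)
  also have "\<dots> = (\<integral>\<^sup>+ \<omega>. ennreal (q (Z \<omega>)) \<partial>P)"
    unfolding split by (subst nn_integral_add[symmetric]) (auto simp: q1_def q2_def qn ennreal_plus[symmetric] simp del: ennreal_plus)
  finally have le: "(\<integral>\<^sup>+ y. ennreal (q (S y)) \<partial>\<nu>) \<le> (\<integral>\<^sup>+ \<omega>. ennreal (q (Z \<omega>)) \<partial>P)" .
  show ?thesis
  proof (cases "(\<integral>\<^sup>+ \<omega>. ennreal (q (Z \<omega>)) \<partial>P) < \<infinity>")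
    case True
    have iqZ: "integrable P (\<lambda>\<omega>. q (Z \<omega>))" using True by (intro integrableI_nonneg) (auto simp: qn)
    have iqS: "integrable \<nu> (\<lambda>y. q (S y))" using le True by (intro integrableI_nonneg) (auto simp: qn intro: le_less_trans)
    have "(\<integral>y. q (S y) \<partial>\<nu>) \<le> (\<integral>\<omega>. q (Z \<omega>) \<partial>P)"
      using le iqS iqZ by (simp add: nn_integral_eq_integral qn)
    then have "(\<integral>y. (\<psi> 0 + d * S y) + q (S y) \<partial>\<nu>) \<le> (\<integral>\<omega>. (\<psi> 0 + d * Z \<omega>) + q (Z \<omega>) \<partial>P)"
      using iqS iqZ int_S int_Z mean by (simp add: S.prob_space Z.prob_space)
    moreover have i: "integrable \<nu> (\<lambda>y. (\<psi> 0 + d * S y) + q (S y))" "integrable P (\<lambda>\<omega>. (\<psi> 0 + d * Z \<omega>) + q (Z \<omega>))"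
      using iqS iqZ int_S int_Z by auto
    ultimately show ?thesis
      using ext_integral_eq_integral[OF i(1)] ext_integral_eq_integral[OF i(2)] by (simp only: aff[symmetric] ereal_less_eq)
  next
    case False
    \<comment> \<open>The negative part is dominated by the tangent at \<open>0\<close>, so the right-hand side is \<open>+\<infinity>\<close> in this case.\<close>
    have fin: "(\<integral>\<^sup>+ \<omega>. ennreal (- \<psi> (Z \<omega>)) \<partial>P) < \<infinity>"
    proof -
      have "(\<integral>\<^sup>+ \<omega>. ennreal (- \<psi> (Z \<omega>)) \<partial>P) \<le> (\<integral>\<^sup>+ \<omega>. ennreal \<bar>\<psi> 0 + d * Z \<omega>\<bar> \<partial>P)"
        by (intro nn_integral_mono ennreal_leI) (use d in \<open>simp add: abs_if, smt (verit)\<close>)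
      also have "\<dots> < \<infinity>"
      proof -
        have "integrable P (\<lambda>\<omega>. \<psi> 0 + d * Z \<omega>)" using int_Z by auto
        then show ?thesis by (simp add: integrable_iff_bounded)
      qed
      finally show ?thesis .
    qed
    have "(\<integral>\<^sup>+ \<omega>. ennreal (\<psi> (Z \<omega>)) \<partial>P) = \<infinity>"
    proof (rule ccontr)
      assume "(\<integral>\<^sup>+ \<omega>. ennreal (\<psi> (Z \<omega>)) \<partial>P) \<noteq> \<infinity>"
      then have "integrable P (\<lambda>\<omega>. \<psi> (Z \<omega>))"
        unfolding real_integrable_def using fin meas[OF \<psi>] by auto
      then have "integrable P (\<lambda>\<omega>. q (Z \<omega>))" unfolding q_def using int_Z by auto
      then have "(\<integral>\<^sup>+ \<omega>. ennreal (q (Z \<omega>)) \<partial>P) < \<infinity>" by (simp add: nn_integral_eq_integral qn)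
      with False show False by simp
    qed
    with fin have "ext_integral P (\<lambda>\<omega>. \<psi> (Z \<omega>)) = \<infinity>" unfolding ext_integral_def
      by (cases "\<integral>\<^sup>+ \<omega>. ennreal (- \<psi> (Z \<omega>)) \<partial>P") (auto simp: enn2ereal_ennreal)
    then show ?thesis by simp
  qed
qed

end

section \<open>Sharp gradient estimate for heat solutions with values in \<open>(0, 1)\<close>\<close>

text \<open>By induction, since \<open>\<Psi>' = \<surd>(2\<pi>) exp(\<Psi>\<^sup>2 / 2)\<close> is again a smooth function of \<open>\<Psi>\<close>.\<close>

lemma Ck_on_Psi:
  fixes u :: "'a::euclidean_space \<Rightarrow> real"
  assumes S: "open S" and u01: "\<And>p. p \<in> S \<Longrightarrow> 0 < u p \<and> u p < 1"
  shows "Ck_on k u S \<Longrightarrow> Ck_on k (\<lambda>p. Psi (u p)) S"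
proof (induction k)
  case 0
  have "isCont Psi (u p)" if "p \<in> S" for p
    using DERIV_isCont[OF Psi_has_derivative] u01[OF that] by blast
  then have "continuous_on (u ` S) Psi" by (auto intro!: continuous_at_imp_continuous_on)
  then show ?case using 0 by (simp add: continuous_on_compose2)
next
  case (Suc k)
  define w where "w p = sqrt (2 * pi) * exp (1 / 2 * (Psi (u p) * Psi (u p)))" for p
  have d: "((\<lambda>p. Psi (u p)) has_derivative (\<lambda>b. w p * pd b u p)) (at p)" if "p \<in> S" for p
  proof -
    have "(Psi has_real_derivative w p) (at (u p))"
      using Psi_has_derivative[of "u p"] u01[OF that] by (simp add: w_def power2_eq_square)
    then have "(Psi has_derivative (*) (w p)) (at (u p))" by (simp add: has_field_derivative_def)
    from has_derivative_compose[OF Ck_on_has_derivative[OF S Suc.prems that] this]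
    show ?thesis .
  qed
  have "Ck_on k (\<lambda>p. Psi (u p)) S" by (rule Suc.IH[OF Ck_on_SucD[OF Suc.prems]])
  then have "Ck_on k w S" unfolding w_def[abs_def]
    by (intro Ck_on_mult Ck_on_exp Ck_on_const S)
  then show ?case
    by (intro Ck_on_SucI[OF S d] Ck_on_mult[OF S]) (auto intro!: Ck_on_pd[OF S Suc.prems])
qed

definition grad_sq :: "('m, 'n::finite) chart \<Rightarrow> ('m, 'n) metric_field \<Rightarrow> ('m \<Rightarrow> real) \<Rightarrow> 'm \<Rightarrow> real" where
  "grad_sq c G f x = (let d = (\<chi> i. pderiv_at i (f \<circ> cinv c) (coord c x)) in d \<bullet> (matrix_inv (G c x) *v d))"

lemma chart_facts:
  assumes "smooth_atlas A" "c \<in> A"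
  shows "x \<in> cdom c \<Longrightarrow> coord c x \<in> cimg c" "x \<in> cdom c \<Longrightarrow> cinv c (coord c x) = x"
    "z \<in> cimg c \<Longrightarrow> cinv c z \<in> cdom c" "z \<in> cimg c \<Longrightarrow> coord c (cinv c z) = z"
  using atlas_facts(3)[OF assms] by (auto simp: homeomorphism_def)

lemma chart_metric:
  assumes A: "smooth_atlas A" and G: "riemannian_metric A G" and c: "c \<in> A"
  shows "coordinate_metric (cimg c) (in_chart G c)"
proof
  show o: "open (cimg c)" by (rule atlas_facts[OF A c])
  show "Ck_on k (\<lambda>z. in_chart G c z $ i $ j) (cimg c)" for k i j
  proof -
    have "smooth_on (cimg c) (in_chart G c)" using G c by (simp add: riemannian_metric_def)
    then have "Ck_on k (in_chart G c) (cimg c)" by (simp add: smooth_on_def)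
    then show ?thesis
      by (rule Ck_on_bounded_linear[OF o, of "\<lambda>M. M $ i $ j", rotated])
        (intro bounded_linear_intros bounded_linear_compose[OF bounded_linear_vec_nth] bounded_linear_vec_nth)
  qed
  fix z assume "z \<in> cimg c"
  then have p: "cinv c z \<in> cdom c" by (rule chart_facts[OF A c])
  have G': "transpose (G c (cinv c z)) = G c (cinv c z)" "\<And>a. a \<noteq> 0 \<Longrightarrow> a \<bullet> (G c (cinv c z) *v a) > 0"
    using G c p unfolding riemannian_metric_def by blast+
  show "in_chart G c z $ i $ j = in_chart G c z $ j $ i" for i j
    using G'(1) unfolding in_chart_def transpose_def by (metis vec_lambda_beta)
  show "a \<bullet> (in_chart G c z *v a) > 0" if "a \<noteq> 0" for a
    using G'(2)[OF that] by (simp add: in_chart_def)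
qed

text \<open>With the Jacobian \<open>J\<close> of the change of charts the differentials are related by \<open>d = J\<^sup>T d'\<close> and the metrics by
  \<open>G = J\<^sup>T G' J\<close>. If \<open>G y = d\<close> then \<open>G' (J y) = d'\<close>, as \<open>J\<^sup>T\<close> is injective, and \<open>d \<bullet> y = d' \<bullet> (J y)\<close>.\<close>

lemma grad_sq_chart_independent:
  assumes A: "smooth_atlas A" and G: "riemannian_metric A G" and c: "c \<in> A" "c' \<in> A"
    and x: "x \<in> cdom c" "x \<in> cdom c'"
    and f: "(f \<circ> cinv c') differentiable (at (coord c' x))"
  shows "grad_sq c G f x = grad_sq c' G f x"
proof -
  define J where "J = jacobian c c' x"
  define d where "d = (\<chi> i. pderiv_at i (f \<circ> cinv c) (coord c x))"
  define d' where "d' = (\<chi> i. pderiv_at i (f \<circ> cinv c') (coord c' x))"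
  define W where "W = coord c ` (cdom c \<inter> cdom c')"
  define \<theta> where "\<theta> = coord c' \<circ> cinv c"
  have W: "open W"
  proof -
    have "W = cimg c \<inter> cinv c -` cdom c'"
      using chart_facts[OF A c(1)] by (auto simp: W_def image_iff) (metis IntI)
    then show ?thesis
      using atlas_facts[OF A c(1)] atlas_facts(1)[OF A c(2)]
      by (auto simp: homeomorphism_def intro!: continuous_open_preimage)
  qed
  have xW: "coord c x \<in> W" using x by (auto simp: W_def)
  have "smooth_on W \<theta>" using A c unfolding smooth_atlas_def W_def \<theta>_def by blast
  then have "Ck_on (Suc 0) \<theta> W" by (simp only: smooth_on_def)
  note d\<theta> = Ck_on_has_derivative[OF W this xW]
  have \<theta>x: "\<theta> (coord c x) = coord c' x" by (simp add: \<theta>_def chart_facts(2)[OF A c(1) x(1)])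
  have J: "frechet_derivative \<theta> (at (coord c x)) a = J *v a" for a
    unfolding J_def jacobian_def \<theta>_def[symmetric]
    using matrix_works[OF has_derivative_linear[OF d\<theta>, folded linear_matrix_vector_mul_eq]] by simp
  define D' where "D' = frechet_derivative (f \<circ> cinv c') (at (coord c' x))"
  have D': "((f \<circ> cinv c') has_derivative D') (at (coord c' x))"
    using f by (simp add: D'_def frechet_derivative_works)
  have "((\<lambda>z. (f \<circ> cinv c') (\<theta> z)) has_derivative (\<lambda>a. D' (J *v a))) (at (coord c x))"
    using has_derivative_compose[OF d\<theta>, of "f \<circ> cinv c'" D'] D' by (simp add: \<theta>x J)
  then have "((f \<circ> cinv c) has_derivative (\<lambda>a. D' (J *v a))) (at (coord c x))"
  proof (rule has_derivative_transform_within_open[OF _ W xW])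
    fix z assume "z \<in> W"
    then obtain p where "p \<in> cdom c" "p \<in> cdom c'" "z = coord c p" by (auto simp: W_def)
    then show "(f \<circ> cinv c') (\<theta> z) = (f \<circ> cinv c) z"
      by (simp add: \<theta>_def chart_facts[OF A c(1)] chart_facts[OF A c(2)])
  qed
  from pderiv_unique[OF this] have "d $ i = D' (J *v axis i 1)" for i by (simp add: d_def)
  also have "D' (J *v axis i 1) = (\<Sum>k\<in>UNIV. (J *v axis i 1) $ k * D' (axis k 1))" for i
    by (rule derivative_eq_sum_partials[OF D'])
  also have "\<dots> i = (transpose J *v d') $ i" for i
    by (simp only: matrix_vector_mult_basis) (simp add: column_def matrix_vector_mult_def transpose_def d'_def pderiv_at_def D'_def)
  finally have dd': "d = transpose J *v d'" by (simp add: vec_eq_iff)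
  have GJ: "G c x = transpose J ** G c' x ** J"
    using G c x unfolding riemannian_metric_def J_def by blast
  have inv: "invertible (G c x)" "invertible (G c' x)"
    using coordinate_metric.inv_g[OF chart_metric[OF A G c(1)] chart_facts(1)[OF A c(1) x(1)]]
      coordinate_metric.inv_g[OF chart_metric[OF A G c(2)] chart_facts(1)[OF A c(2) x(2)]]
    by (simp_all add: in_chart_def chart_facts(2)[OF A c(1) x(1)] chart_facts(2)[OF A c(2) x(2)])
  define y where "y = matrix_inv (G c x) *v d"
  have "transpose J ** (G c' x ** J ** matrix_inv (G c x)) = mat 1"
    using matrix_inv_right[OF inv(1)] by (simp add: GJ matrix_mul_assoc)
  then have "(G c' x ** J ** matrix_inv (G c x)) ** transpose J = mat 1" by (rule matrix_left_right_inverse[THEN iffD1])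
  then have inj: "a = b" if "transpose J *v a = transpose J *v b" for a b
    using that by (metis matrix_vector_mul_assoc matrix_vector_mul_lid)
  have "G c x *v y = d" by (simp add: y_def matrix_vector_mul_assoc matrix_inv_right[OF inv(1)])
  then have "transpose J *v (G c' x *v (J *v y)) = transpose J *v d'"
    by (simp add: GJ dd' matrix_vector_mul_assoc[symmetric])
  then have "G c' x *v (J *v y) = d'" by (rule inj)
  then have "J *v y = matrix_inv (G c' x) *v d'"
    by (metis matrix_inv_left[OF inv(2)] matrix_vector_mul_assoc matrix_vector_mul_lid)
  moreover have "d \<bullet> y = d' \<bullet> (J *v y)" unfolding dd' transpose_matrix_vector dot_lmul_matrix ..
  ultimately show ?thesis
    by (simp add: grad_sq_def Let_def d_def[symmetric] d'_def[symmetric] y_def)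
qed

locale heat_solution =
  fixes A :: "('m::{t2_space,second_countable_topology}, 'n::finite) chart set" and I g a b
    and u :: "'m \<Rightarrow> real \<Rightarrow> real"
  assumes flow: "closed_Ricci_flow A I g" and sub: "{a<..<b} \<subseteq> I"
    and smooth_u: "\<And>c. c \<in> A \<Longrightarrow> Ck_on 3 (\<lambda>(z, t). u (cinv c z) t) (cimg c \<times> {a<..<b})"
    and heat: "\<And>c x t. c \<in> A \<Longrightarrow> x \<in> cdom c \<Longrightarrow> t \<in> {a<..<b} \<Longrightarrow>
      ((\<lambda>t. u x t) has_real_derivative laplacian (in_chart (g t) c) (\<lambda>z. u (cinv c z) t) (coord c x)) (at t)"
    and u01: "\<And>x t. t \<in> {a<..<b} \<Longrightarrow> 0 < u x t \<and> u x t < 1"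
begin

abbreviation T where "T \<equiv> {a<..<b}"

definition h :: "'m \<Rightarrow> real \<Rightarrow> real" where "h x t = Psi (u x t)"

lemma atlas: "smooth_atlas A" and comp: "compact (UNIV :: 'm set)"
  and metric: "t \<in> T \<Longrightarrow> riemannian_metric A (g t)"
  using flow sub by (auto simp: closed_Ricci_flow_def)

lemma smooth_h: "c \<in> A \<Longrightarrow> Ck_on 3 (\<lambda>(z, t). h (cinv c z) t) (cimg c \<times> T)"
proof -
  assume c: "c \<in> A"
  have "Ck_on 3 (\<lambda>p. Psi ((\<lambda>(z, t). u (cinv c z) t) p)) (cimg c \<times> T)"
    by (rule Ck_on_Psi[OF open_Times[OF atlas_facts(2)[OF atlas c] open_greaterThanLessThan] _ smooth_u[OF c]])
      (use u01 in auto)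
  then show ?thesis by (simp add: h_def case_prod_unfold)
qed

lemma chart_flow:
  assumes c: "c \<in> A"
  shows "coordinate_flow (cimg c) T (\<lambda>t. in_chart (g t) c) (\<lambda>(z, t). h (cinv c z) t)"
proof (rule coordinate_flow.intro)
  show "coordinate_metric (cimg c) (in_chart (g t) c)" if "t \<in> T" for t
    by (rule chart_metric[OF atlas metric[OF that] c])
  show "open (cimg c)" by (rule atlas_facts[OF atlas c])
  show "Ck_on 3 (\<lambda>(z, t). h (cinv c z) t) (cimg c \<times> T)" by (rule smooth_h[OF c])
  fix z t i j assume z: "z \<in> cimg c" and t: "t \<in> T"
  have "((\<lambda>t. g t c (cinv c z) $ i $ j) has_real_derivative - 2 * ricci (in_chart (g t) c) i j (coord c (cinv c z))) (at t within I)"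
    using flow c t sub chart_facts(3)[OF atlas c z] by (auto simp: closed_Ricci_flow_def)
  then have "((\<lambda>t. g t c (cinv c z) $ i $ j) has_real_derivative - 2 * ricci (in_chart (g t) c) i j z) (at t within T)"
    using chart_facts(4)[OF atlas c z] sub by (auto intro: DERIV_subset)
  then show "((\<lambda>t. in_chart (g t) c z $ i $ j) has_real_derivative - 2 * ricci (in_chart (g t) c) i j z) (at t)"
    by (simp only: in_chart_def at_within_open[OF t open_greaterThanLessThan])
qed (rule open_greaterThanLessThan)

lemma N_chart:
  assumes c: "c \<in> A" and x: "x \<in> cdom c"
  shows "coordinate_flow.N (\<lambda>t. in_chart (g t) c) (\<lambda>(z, t). h (cinv c z) t) (coord c x) t = grad_sq c (g t) (\<lambda>x. h x t) x"
  unfolding coordinate_flow.N_def[OF chart_flow[OF c]] grad_sq_def Let_def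
  by (simp add: inner_vec_def matrix_vector_mult_def in_chart_def chart_facts(2)[OF atlas c x] o_def mult.commute)

text \<open>Here \<open>h = \<Psi>(u)\<close> and \<open>\<partial>\<^sub>i h = W \<partial>\<^sub>i u\<close> with \<open>W = \<Psi>'(u)\<close>. Since \<open>\<partial>\<^sub>i W = W h \<partial>\<^sub>i h\<close>, one gets
  \<open>\<Delta>h = W \<Delta>u + h |\<nabla>h|\<^sup>2\<close>.\<close>

lemma h_evolution:
  assumes c: "c \<in> A" and z: "z \<in> cimg c" and t: "t \<in> T"
  shows "((\<lambda>t. h (cinv c z) t) has_real_derivative
     laplacian (in_chart (g t) c) (\<lambda>w. h (cinv c w) t) z - h (cinv c z) t * coordinate_flow.N (\<lambda>t. in_chart (g t) c) (\<lambda>(z, t). h (cinv c z) t) z t) (at t)"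
proof -
  interpret cf: coordinate_flow "cimg c" T "\<lambda>t. in_chart (g t) c" "\<lambda>(z, t). h (cinv c z) t" by (rule chart_flow[OF c])
  interpret cm: coordinate_metric "cimg c" "in_chart (g t) c" by (rule cf.metric[OF t])
  define U where "U w = u (cinv c w) t" for w
  define H where "H w = h (cinv c w) t" for w
  define W where "W w = sqrt (2 * pi) * exp ((H w)\<^sup>2 / 2)" for w
  have HU: "H w = Psi (U w)" for w by (simp add: H_def U_def h_def)
  have CU: "Ck_on 3 U (cimg c)"
    using Ck_on_space_slice[OF cf.open_U t smooth_u[OF c]] by (simp add: U_def[abs_def])
  have CH: "Ck_on 3 H (cimg c)"
    using Ck_on_space_slice[OF cf.open_U t cf.h3] by (simp add: H_def[abs_def])
  have CU': "Ck_on (Suc 2) U (cimg c)" "Ck_on (Suc 0) U (cimg c)" "Ck_on (Suc 2) H (cimg c)" "Ck_on (Suc 0) H (cimg c)"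
    using CU CH Ck_on_mono[OF CU, of "Suc 0"] Ck_on_mono[OF CH, of "Suc 0"] by (simp_all add: eval_nat_numeral del: Ck_on.simps)
  have dPsi: "(Psi has_real_derivative W w) (at (U w))" if "w \<in> cimg c" for w
    using Psi_has_derivative[of "U w"] u01[OF t, of "cinv c w"] by (simp add: W_def HU U_def)
  have D1: "pderiv_at i H w = W w * pderiv_at i U w" if w: "w \<in> cimg c" for i w
  proof -
    have "(Psi has_derivative (*) (W w)) (at (U w))" using dPsi[OF w] by (simp add: has_field_derivative_def)
    from pderiv_unique[OF has_derivative_compose[OF Ck_on_has_derivative[OF cf.open_U CU'(2) w] this]]
    show ?thesis by (simp add: HU[abs_def] pderiv_at_def)
  qed
  have DW: "pderiv_at i W z = W z * (H z * pderiv_at i H z)" for i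
  proof -
    have "(H has_derivative frechet_derivative H (at z)) (at z)" by (rule Ck_on_has_derivative[OF cf.open_U CU'(4) z])
    then have "(W has_derivative (\<lambda>b. W z * (H z * pd b H z))) (at z)"
      unfolding W_def[abs_def] by (auto intro!: derivative_eq_intros simp: fun_eq_iff)
    from pderiv_unique[OF this] show ?thesis by (simp add: pderiv_at_def)
  qed
  have CW: "Ck_on (Suc 0) W (cimg c)"
  proof -
    have "Ck_on (Suc 0) (\<lambda>w. sqrt (2 * pi) * exp (1 / 2 * (H w * H w))) (cimg c)"
      by (intro Ck_on_mult Ck_on_exp Ck_on_const cf.open_U CU')
    then show ?thesis by (simp add: W_def[abs_def] power2_eq_square del: Ck_on.simps)
  qed
  have CDU: "Ck_on (Suc 0) (pderiv_at j U) (cimg c)" for j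
    by (rule Ck_on_mono[OF Ck_on_pderiv[OF cf.open_U CU'(1)]]) simp
  have D2: "pderiv_at i (pderiv_at j H) z = W z * pderiv_at i (pderiv_at j U) z + H z * pderiv_at i H z * pderiv_at j H z" for i j
  proof -
    have "pderiv_at i (pderiv_at j H) z = pderiv_at i (\<lambda>w. W w * pderiv_at j U w) z"
      by (rule pderiv_cong[OF cf.open_U _ z]) (rule D1)
    also have "\<dots> = W z * (H z * pderiv_at i H z) * pderiv_at j U z + W z * pderiv_at i (pderiv_at j U) z"
      by (simp add: pderiv_mult[OF cf.open_U z CW CDU] DW)
    also have "W z * (H z * pderiv_at i H z) * pderiv_at j U z = H z * pderiv_at i H z * pderiv_at j H z"
      by (simp add: D1[OF z, of j])
    finally show ?thesis by simp
  qed
  define G where "G i j = matrix_inv (in_chart (g t) c z) $ i $ j" for i j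
  define Ch where "Ch k i j = christoffel (in_chart (g t) c) k i j z" for k i j
  have N: "cf.N z t = (\<Sum>i\<in>UNIV. \<Sum>j\<in>UNIV. G i j * (pderiv_at i H z * pderiv_at j H z))"
    by (simp add: cf.N_def G_def H_def[abs_def] sum_distrib_right sum_distrib_left mult_ac)
  have hess: "pderiv_at i (pderiv_at j H) z - (\<Sum>k\<in>UNIV. Ch k i j * pderiv_at k H z) =
      W z * (pderiv_at i (pderiv_at j U) z - (\<Sum>k\<in>UNIV. Ch k i j * pderiv_at k U z)) + H z * (pderiv_at i H z * pderiv_at j H z)" for i j
  proof -
    have "(\<Sum>k\<in>UNIV. Ch k i j * pderiv_at k H z) = W z * (\<Sum>k\<in>UNIV. Ch k i j * pderiv_at k U z)"
      by (simp add: D1[OF z] sum_distrib_left mult_ac)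
    then show ?thesis by (simp add: D2 algebra_simps)
  qed
  have "laplacian (in_chart (g t) c) H z = (\<Sum>i\<in>UNIV. \<Sum>j\<in>UNIV. G i j *
      (W z * (pderiv_at i (pderiv_at j U) z - (\<Sum>k\<in>UNIV. Ch k i j * pderiv_at k U z)) + H z * (pderiv_at i H z * pderiv_at j H z)))"
    unfolding laplacian_def G_def[symmetric] Ch_def[symmetric] hess ..
  also have "\<dots> = W z * laplacian (in_chart (g t) c) U z + H z * cf.N z t"
    unfolding laplacian_def G_def[symmetric] Ch_def[symmetric] N distrib_left sum.distrib
    by (simp only: sum_distrib_left mult.left_commute)
  finally have lap: "laplacian (in_chart (g t) c) H z - H z * cf.N z t = laplacian (in_chart (g t) c) U z * W z" by simp
  have "((\<lambda>t. u (cinv c z) t) has_real_derivative laplacian (in_chart (g t) c) U z) (at t)"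
    using heat[OF c chart_facts(3)[OF atlas c z] t] by (simp add: chart_facts(4)[OF atlas c z] U_def[abs_def])
  then have "((\<lambda>t. Psi (u (cinv c z) t)) has_real_derivative W z * laplacian (in_chart (g t) c) U z) (at t)"
    using DERIV_chain2[where f = Psi and g = "\<lambda>t. u (cinv c z) t"] dPsi[OF z] unfolding U_def by blast
  then show ?thesis using lap by (simp add: h_def[abs_def] H_def[abs_def] mult.commute)
qed

lemma log_flow:
  assumes c: "c \<in> A"
  shows "coordinate_log_flow (cimg c) T (\<lambda>t. in_chart (g t) c) (\<lambda>(z, t). h (cinv c z) t)"
proof -
  interpret cf: coordinate_flow "cimg c" T "\<lambda>t. in_chart (g t) c" "\<lambda>(z, t). h (cinv c z) t" by (rule chart_flow[OF c])
  show ?thesis by unfold_locales (use h_evolution[OF c] in simp)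
qed

definition grad_h_sq :: "'m \<Rightarrow> real \<Rightarrow> real" where
  "grad_h_sq x t = grad_sq (SOME c. c \<in> A \<and> x \<in> cdom c) (g t) (\<lambda>x. h x t) x"

lemma grad_h_sq_eq:
  assumes c: "c \<in> A" "x \<in> cdom c" and t: "t \<in> T"
  shows "grad_h_sq x t = grad_sq c (g t) (\<lambda>x. h x t) x"
proof -
  define c' where "c' = (SOME c. c \<in> A \<and> x \<in> cdom c)"
  have c': "c' \<in> A" "x \<in> cdom c'" using someI_ex[of "\<lambda>c. c \<in> A \<and> x \<in> cdom c"] c unfolding c'_def by blast+
  have "Ck_on (Suc 0) (\<lambda>w. h (cinv c w) t) (cimg c)"
    using Ck_on_space_slice[OF atlas_facts(2)[OF atlas c(1)] t Ck_on_mono[OF smooth_h[OF c(1)], of "Suc 0"]] by (simp del: Ck_on.simps)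
  from Ck_on_has_derivative[OF atlas_facts(2)[OF atlas c(1)] this chart_facts(1)[OF atlas c]]
  have "((\<lambda>x. h x t) \<circ> cinv c) differentiable (at (coord c x))" by (auto simp: o_def differentiable_def)
  from grad_sq_chart_independent[OF atlas metric[OF t] c'(1) c(1) c'(2) c(2) this]
  show ?thesis by (simp add: grad_h_sq_def c'_def)
qed

lemma continuous_grad_h_sq: "continuous_on (UNIV \<times> T) (\<lambda>(x, t). grad_h_sq x t)"
proof -
  have "isCont (\<lambda>(x, t). grad_h_sq x t) q" if qT: "q \<in> UNIV \<times> T" for q
  proof -
    obtain x t where q: "q = (x, t)" "t \<in> T" using qT by blast
    obtain c where c: "c \<in> A" "x \<in> cdom c" by (rule atlas_cover[OF atlas])
    interpret cf: coordinate_flow "cimg c" T "\<lambda>t. in_chart (g t) c" "\<lambda>(z, t). h (cinv c z) t" by (rule chart_flow[OF c(1)])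
    have S: "open (cimg c \<times> T)" using cf.open_U cf.open_T by (rule open_Times)
    have Cg: "continuous_on (cimg c \<times> T) (\<lambda>p. in_chart (g (snd p)) c (fst p) $ i $ j)" for i j
    proof -
      have "smooth_on (cimg c \<times> I) (\<lambda>(z, t). in_chart (g t) c z)" using flow c by (auto simp: closed_Ricci_flow_def)
      then have "continuous_on (cimg c \<times> I) (\<lambda>(z, t). in_chart (g t) c z)" unfolding smooth_on_def by (metis Ck_on.simps(1))
      then have "continuous_on (cimg c \<times> T) (\<lambda>(z, t). in_chart (g t) c z)"
        by (rule continuous_on_subset) (use sub in auto)
      then show ?thesis by (intro continuous_on_component) (simp add: case_prod_unfold)
    qed
    have Cgi: "continuous_on (cimg c \<times> T) (\<lambda>p. matrix_inv (in_chart (g (snd p)) c (fst p)) $ i $ j)" for i j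
    proof (rule Ck_on_matrix_inv[OF S, of 0, unfolded Ck_on.simps])
      show "continuous_on (cimg c \<times> T) (\<lambda>p. in_chart (g (snd p)) c (fst p) $ i $ j)" for i j by (rule Cg)
      fix p assume "p \<in> cimg c \<times> T"
      then show "invertible (in_chart (g (snd p)) c (fst p))"
        by (intro coordinate_metric.inv_g[OF cf.metric]) auto
    qed
    have h3: "Ck_on (Suc 2) (\<lambda>(z, t). h (cinv c z) t) (cimg c \<times> T)" using cf.h3 by (simp add: eval_nat_numeral del: Ck_on.simps)
    have Cd: "continuous_on (cimg c \<times> T) (\<lambda>p. pderiv_at i (\<lambda>w. h (cinv c w) (snd p)) (fst p))" for i
    proof -
      have "continuous_on (cimg c \<times> T) (pd (axis i 1, 0) (\<lambda>(z, t). h (cinv c z) t))"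
        by (rule Ck_on_continuous[OF Ck_on_pd[OF S h3 Basis_space_time(1)]])
      then show ?thesis
        by (rule continuous_on_eq) (use pderiv_space_slice[OF cf.open_U cf.open_T h3] in auto)
    qed
    have CN: "continuous_on (cimg c \<times> T) (\<lambda>p. cf.N (fst p) (snd p))"
      unfolding cf.N_def case_prod_conv by (intro continuous_on_sum continuous_on_mult Cgi Cd)
    have cc: "continuous_on (cdom c) (coord c)" using atlas_facts(3)[OF atlas c(1)] by (simp add: homeomorphism_def)
    have "continuous_on (cdom c \<times> T) (\<lambda>p. (coord c (fst p), snd p))"
      by (auto intro!: continuous_intros intro: continuous_on_compose2[OF cc])
    moreover have "(\<lambda>p. (coord c (fst p), snd p)) ` (cdom c \<times> T) \<subseteq> cimg c \<times> T"
      by (auto simp: chart_facts(1)[OF atlas c(1)])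
    ultimately have "continuous_on (cdom c \<times> T) (\<lambda>p. cf.N (coord c (fst p)) (snd p))"
      using continuous_on_compose2[OF CN] by fastforce
    then have "continuous_on (cdom c \<times> T) (\<lambda>(x, t). grad_h_sq x t)"
      by (rule continuous_on_eq) (auto simp: grad_h_sq_eq[OF c(1)] N_chart[OF c(1)])
    then show ?thesis
      using atlas_facts(1)[OF atlas c(1)] c q by (subst (asm) continuous_on_eq_continuous_at) (auto intro!: open_Times)
  qed
  then show ?thesis by (intro continuous_at_imp_continuous_on ballI)
qed

text \<open>At a maximum of \<open>F = (r - s') |\<nabla>h|\<^sup>2\<close> over \<open>M \<times> [s', t1]\<close> with \<open>F > 1/2\<close> one has \<open>r > s'\<close>, and with \<open>n = |\<nabla>h|\<^sup>2\<close> there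
  \<open>\<partial>\<^sub>r F \<le> n - 2 (r - s') n\<^sup>2 = n (1 - 2 F) < 0\<close>, so \<open>F\<close> was larger shortly before. Starting at \<open>s' > a\<close> makes \<open>h\<close>
  smooth on the whole compact time interval, and the factor \<open>r - s'\<close> makes \<open>F\<close> vanish at its beginning.\<close>

lemma gradient_bound_from:
  assumes s': "a < s'" "s' \<le> t1" "t1 < b"
  shows "(t1 - s') * grad_h_sq x t1 \<le> 1 / 2"
proof (rule ccontr)
  assume big: "\<not> (t1 - s') * grad_h_sq x t1 \<le> 1 / 2"
  define F where "F = (\<lambda>(x, t). (t - s') * grad_h_sq x t)"
  have "continuous_on (UNIV \<times> {s'..t1}) F"
    unfolding F_def case_prod_unfold
    by (intro continuous_intros continuous_on_subset[OF continuous_grad_h_sq, unfolded case_prod_unfold]) (use s' in auto)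
  moreover have "compact (UNIV \<times> {s'..t1} :: ('m \<times> real) set)" by (intro compact_Times comp compact_Icc)
  ultimately obtain q where q: "q \<in> UNIV \<times> {s'..t1}" "\<And>r. r \<in> UNIV \<times> {s'..t1} \<Longrightarrow> F r \<le> F q"
    using continuous_attains_sup[of "UNIV \<times> {s'..t1}" F] s' by auto
  obtain x0 t0 where q_eq: "q = (x0, t0)" by (cases q)
  have t0: "s' \<le> t0" "t0 \<le> t1" using q q_eq by auto
  have "F (x, t1) \<le> F (x0, t0)" using q q_eq s' by auto
  then have F0: "(t0 - s') * grad_h_sq x0 t0 > 1 / 2" using big by (simp add: F_def)
  then have t0': "s' < t0" using t0 by (cases "t0 = s'") auto
  have t0T: "t0 \<in> T" using t0 s' by auto
  obtain c where c: "c \<in> A" "x0 \<in> cdom c" by (rule atlas_cover[OF atlas])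
  interpret cf: coordinate_log_flow "cimg c" T "\<lambda>t. in_chart (g t) c" "\<lambda>(z, t). h (cinv c z) t" by (rule log_flow[OF c(1)])
  define z0 where "z0 = coord c x0"
  have z0: "z0 \<in> cimg c" by (simp add: z0_def chart_facts(1)[OF atlas c])
  have N0: "cf.N z0 t = grad_h_sq x0 t" if "t \<in> T" for t
    unfolding z0_def by (simp add: grad_h_sq_eq[OF c that] N_chart[OF c])
  have max: "cf.N w t0 \<le> cf.N z0 t0" if w: "w \<in> cimg c" for w
  proof -
    have "F (cinv c w, t0) \<le> F (x0, t0)" using q q_eq t0 by auto
    then have "grad_h_sq (cinv c w) t0 \<le> grad_h_sq x0 t0" using t0' by (simp add: F_def)
    moreover have "cf.N w t0 = grad_h_sq (cinv c w) t0"
      using N_chart[OF c(1) chart_facts(3)[OF atlas c(1) w]] grad_h_sq_eq[OF c(1) chart_facts(3)[OF atlas c(1) w] t0T]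
      by (simp add: chart_facts(4)[OF atlas c(1) w])
    ultimately show ?thesis by (simp add: N0[OF t0T])
  qed
  obtain d where d: "((\<lambda>t. cf.N z0 t) has_real_derivative d) (at t0)" "d \<le> - 2 * (cf.N z0 t0)\<^sup>2"
    by (rule cf.N_derivative_at_max[OF z0 t0T max])
  have "((\<lambda>t. (t - s') * cf.N z0 t) has_real_derivative (t0 - s') * d + 1 * cf.N z0 t0) (at t0)"
    by (rule DERIV_mult'[OF _ d(1)]) (auto intro!: derivative_eq_intros)
  moreover have "(t0 - s') * d + 1 * cf.N z0 t0 < 0"
  proof -
    define n where "n = cf.N z0 t0"
    have n: "(t0 - s') * n > 1 / 2" using F0 by (simp add: n_def N0[OF t0T])
    then have npos: "n > 0" using t0' by (metis diff_gt_0_iff_gt half_gt_zero_iff less_trans zero_less_mult_pos zero_less_one)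
    have "(t0 - s') * d \<le> (t0 - s') * (- 2 * n\<^sup>2)" using d(2) t0' by (intro mult_left_mono) (auto simp: n_def)
    also have "\<dots> = - 2 * ((t0 - s') * n) * n" by (simp add: power2_eq_square)
    also have "\<dots> < - 1 * n" using n npos by (intro mult_strict_right_mono) auto
    finally show ?thesis by (simp add: n_def)
  qed
  ultimately obtain \<delta> where \<delta>: "\<delta> > 0" "\<And>e. 0 < e \<Longrightarrow> e < \<delta> \<Longrightarrow> (t0 - s') * cf.N z0 t0 < (t0 - e - s') * cf.N z0 (t0 - e)"
    using DERIV_neg_dec_left by blast
  \<comment> \<open>A slightly earlier time with a larger value of \<open>F\<close>.\<close>
  define e where "e = min \<delta> (t0 - s') / 2"
  have e: "0 < e" "e < \<delta>" "e < t0 - s'" using \<delta>(1) t0' by (auto simp: e_def)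
  have eT: "t0 - e \<in> T" using e t0 s' by auto
  have "F (x0, t0) < F (x0, t0 - e)" using \<delta>(2)[OF e(1,2)] unfolding F_def N0[OF t0T] N0[OF eT] by simp
  moreover have "F (x0, t0 - e) \<le> F (x0, t0)" using q q_eq e t0 by auto
  ultimately show False by simp
qed

lemma gradient_bound:
  assumes t: "t \<in> T"
  shows "(t - a) * grad_h_sq x t \<le> 1 / 2"
proof -
  have "((\<lambda>s'. (t - s') * grad_h_sq x t) \<longlongrightarrow> (t - a) * grad_h_sq x t) (at_right a)"
    by (intro tendsto_intros)
  moreover have "\<forall>\<^sub>F s' in at_right a. (t - s') * grad_h_sq x t \<le> 1 / 2"
    unfolding eventually_at_right_field
    by (rule exI[of _ t]) (use t gradient_bound_from[of _ t x] in auto)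
  ultimately show ?thesis by (rule tendsto_upperbound) simp
qed

end

section \<open>Solutions generated by the heat kernel\<close>

text \<open>The kernel \<open>K(\<cdot>, \<cdot>; \<cdot>, s)\<close> with fixed initial time \<open>s\<close>. The times \<open>s\<close> and \<open>t\<close> may be end points of \<open>I\<close>, so two-sided
  derivatives in time are taken on the open interval between them, and time \<open>t\<close> is reached by continuity.\<close>

locale heat_kernel_slice =
  fixes A :: "('m::{t2_space,second_countable_topology}, 'n::finite) chart set" and I g vol K and s t :: real
  assumes flow: "closed_Ricci_flow A I g" and vol_s: "riemannian_volume A (g s) (vol s)"
    and K: "heat_kernel A I g vol K" and s: "s \<in> I" and t: "t \<in> I" and less: "s < t"
begin

abbreviation "\<mu> \<equiv> vol s"
abbreviation "T \<equiv> {s<..<t}"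

lemma atlas: "smooth_atlas A" and comp: "compact (UNIV :: 'm set)"
  and metric: "r \<in> I \<Longrightarrow> riemannian_metric A (g r)"
  using flow by (auto simp: closed_Ricci_flow_def)

lemma sub: "{s..t} \<subseteq> I"
proof -
  have "is_interval I" using flow by (simp add: closed_Ricci_flow_def)
  then show ?thesis using s t unfolding is_interval_1 by (meson atLeastAtMost_iff subsetI)
qed

lemma in_I: "s < r \<Longrightarrow> r \<le> t \<Longrightarrow> r \<in> I" using sub by auto

lemma finite_\<mu>: "finite_measure \<mu>" and sets_\<mu>: "sets \<mu> = sets borel"
  using riemannian_volume_finite[OF comp atlas metric[OF s] vol_s] vol_s by (auto simp: riemannian_volume_def)

lemma kernel_nonneg: "r \<in> {s<..t} \<Longrightarrow> 0 \<le> K x r y s"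
  and kernel_prob: "r \<in> {s<..t} \<Longrightarrow> prob_space (density \<mu> (\<lambda>y. ennreal (K x r y s)))"
  using K s sub unfolding heat_kernel_def by (auto simp: subset_eq)

lemma kernel_smooth:
  assumes c: "c \<in> A" "c' \<in> A"
  shows "Ck_on k (\<lambda>(p, w). K (cinv c (fst p)) (snd p) (cinv c' w) s) ((cimg c \<times> T) \<times> cimg c')"
proof -
  define S4 where "S4 = {(z, t, w, s). z \<in> cimg c \<and> w \<in> cimg c' \<and> s \<in> I \<and> t \<in> I \<and> s < t}"
  define L :: "((real^'n) \<times> real) \<times> (real^'n) \<Rightarrow> (real^'n) \<times> real \<times> (real^'n) \<times> real"
    where "L = (\<lambda>(p, w). (fst p, snd p, w, 0))"
  have "smooth_on S4 (\<lambda>(z, t, w, s). K (cinv c z) t (cinv c' w) s)"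
    using K[unfolded heat_kernel_def, THEN conjunct1, rule_format, OF c] unfolding S4_def .
  then have "Ck_on k (\<lambda>(z, t, w, s). K (cinv c z) t (cinv c' w) s) S4" by (simp add: smooth_on_def)
  then have "Ck_on k (\<lambda>p. (\<lambda>(z, t, w, s). K (cinv c z) t (cinv c' w) s) (L p + (0, 0, 0, s))) ((cimg c \<times> T) \<times> cimg c')"
  proof (rule Ck_on_affine[rotated -1])
    show "open ((cimg c \<times> T) \<times> cimg c')"
      by (intro open_Times open_greaterThanLessThan atlas_facts(2)[OF atlas] c)
    show "bounded_linear L" unfolding L_def case_prod_unfold
      by (intro bounded_linear_Pair bounded_linear_zero bounded_linear_compose[OF bounded_linear_fst bounded_linear_fst]
          bounded_linear_compose[OF bounded_linear_snd bounded_linear_fst] bounded_linear_snd)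
    show "L b \<in> Basis" if "b \<in> Basis" for b using that by (auto simp: L_def Basis_prod_def image_iff zero_prod_def)
    show "L p + (0, 0, 0, s) \<in> S4" if "p \<in> (cimg c \<times> T) \<times> cimg c'" for p
      using that s by (auto simp: L_def S4_def in_I)
  qed
  then show ?thesis by (simp add: L_def case_prod_unfold)
qed

lemma kernel_param: "c \<in> A \<Longrightarrow> Ck_param k (\<lambda>p y. K (cinv c (fst p)) (snd p) y s) (cimg c \<times> T)"
proof -
  assume c: "c \<in> A"
  show ?thesis
    by (rule Ck_param_from_charts[OF atlas open_Times[OF atlas_facts(2)[OF atlas c] open_greaterThanLessThan] kernel_smooth[OF c]])
qed

definition dK :: "('m, 'n) chart \<Rightarrow> real^'n \<Rightarrow> 'm \<Rightarrow> real \<Rightarrow> 'm \<Rightarrow> real" where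
  "dK c v x r y = frechet_derivative (\<lambda>z. K (cinv c z) r y s) (at (coord c x)) v"

text \<open>First derivatives in space are continuous up to and including time \<open>t\<close>. They are obtained from the derivative
  within the full domain of the kernel, along the slice in which only the point \<open>x\<close> varies.\<close>

lemma kernel_up_to_time:
  assumes c: "c \<in> A" "x \<in> cdom c"
  shows "continuous_on ({s<..t} \<times> UNIV) (\<lambda>(r, y). K x r y s)"
    and "continuous_on ({s<..t} \<times> UNIV) (\<lambda>(r, y). dK c (axis i 1) x r y)"
    and "r \<in> {s<..t} \<Longrightarrow> (\<lambda>z. K (cinv c z) r y s) differentiable (at (coord c x))"
proof -
  define S4 where "S4 c' = {(z, t, w, s). z \<in> cimg c \<and> w \<in> cimg c' \<and> s \<in> I \<and> t \<in> I \<and> s < t}" for c' :: "('m, 'n) chart"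
  define F where "F c' = (\<lambda>(z, t, w, s). K (cinv c z) t (cinv c' w) s)" for c' :: "('m, 'n) chart"
  define emb :: "real \<times> (real^'n) \<Rightarrow> (real^'n) \<times> real \<times> (real^'n) \<times> real"
    where "emb = (\<lambda>(r, w). (coord c x, r, w, s))"
  have smooth: "Ck_on k (F c') (S4 c')" if "c' \<in> A" for k c'
  proof -
    have "smooth_on (S4 c') (F c')"
      using K[unfolded heat_kernel_def, THEN conjunct1, rule_format, OF c(1) that] unfolding S4_def F_def .
    then show ?thesis by (simp add: smooth_on_def)
  qed
  have emb: "emb ` ({s<..t} \<times> cimg c') \<subseteq> S4 c'" for c'
    using s chart_facts(1)[OF atlas c] by (auto simp: emb_def S4_def in_I)
  have cemb: "continuous_on ({s<..t} \<times> cimg c') emb" for c'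
    unfolding emb_def case_prod_unfold by (intro continuous_intros)
  have d: "((\<lambda>z. K (cinv c z) r (cinv c' w) s) has_derivative (\<lambda>b. frechet_derivative (F c') (at (emb (r, w)) within S4 c') (b, 0, 0, 0))) (at (coord c x))"
    if "c' \<in> A" "r \<in> {s<..t}" "w \<in> cimg c'" for c' r w
  proof -
    have inS: "emb (r, w) \<in> S4 c'" using emb that by blast
    have "(F c' has_derivative frechet_derivative (F c') (at (emb (r, w)) within S4 c')) (at (emb (r, w)) within S4 c')"
      using smooth[OF that(1), of "Suc 0"] inS by (auto simp: differentiable_on_def frechet_derivative_works)
    moreover have "(\<lambda>z. (z, r, w, s)) ` cimg c \<subseteq> S4 c'" using that s by (auto simp: S4_def in_I)
    ultimately have "(F c' has_derivative frechet_derivative (F c') (at (emb (r, w)) within S4 c')) (at (emb (r, w)) within (\<lambda>z. (z, r, w, s)) ` cimg c)"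
      by (rule has_derivative_subset)
    moreover have "((\<lambda>z. (z, r, w, s)) has_derivative (\<lambda>b. (b, 0, 0, 0))) (at (coord c x) within cimg c)"
      by (intro has_derivative_Pair has_derivative_ident has_derivative_const)
    ultimately have "(F c' \<circ> (\<lambda>z. (z, r, w, s)) has_derivative (frechet_derivative (F c') (at (emb (r, w)) within S4 c')) \<circ> (\<lambda>b. (b, 0, 0, 0))) (at (coord c x) within cimg c)"
      by (intro diff_chain_within) (simp_all add: emb_def)
    then show ?thesis
      by (simp add: F_def o_def at_within_open[OF chart_facts(1)[OF atlas c] atlas_facts(2)[OF atlas c(1)]])
  qed
  show "continuous_on ({s<..t} \<times> UNIV) (\<lambda>(r, y). K x r y s)"
  proof (rule continuous_on_from_charts[OF atlas])
    fix c' assume c': "c' \<in> A"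
    have "continuous_on (S4 c') (F c')" using smooth[OF c', of 0] by simp
    from continuous_on_compose2[OF this cemb emb]
    show "continuous_on ({s<..t} \<times> cimg c') (\<lambda>(r, w). K x r (cinv c' w) s)"
      by (simp add: F_def emb_def case_prod_unfold chart_facts(2)[OF atlas c])
  qed
  show "continuous_on ({s<..t} \<times> UNIV) (\<lambda>(r, y). dK c (axis i 1) x r y)"
  proof (rule continuous_on_from_charts[OF atlas])
    fix c' assume c': "c' \<in> A"
    have "(axis i 1, 0, 0, 0) \<in> (Basis :: ((real^'n) \<times> real \<times> (real^'n) \<times> real) set)"
      by (simp add: Basis_prod_def image_iff zero_prod_def)
    then have "continuous_on (S4 c') (\<lambda>q. frechet_derivative (F c') (at q within S4 c') (axis i 1, 0, 0, 0))"
      using smooth[OF c', of "Suc 0"] by simp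
    from continuous_on_compose2[OF this cemb emb]
    show "continuous_on ({s<..t} \<times> cimg c') (\<lambda>(r, w). dK c (axis i 1) x r (cinv c' w))"
    proof (rule continuous_on_eq, clarify)
      fix r w assume "r \<in> {s<..t}" "w \<in> cimg c'"
      from frechet_derivative_at[OF d[OF c' this]]
      show "frechet_derivative (F c') (at (emb (r, w)) within S4 c') (axis i 1, 0, 0, 0) = dK c (axis i 1) x r (cinv c' w)"
        by (simp add: dK_def fun_eq_iff)
    qed
  qed
  show "(\<lambda>z. K (cinv c z) r y s) differentiable (at (coord c x))" if r: "r \<in> {s<..t}"
  proof -
    obtain c' where c': "c' \<in> A" "y \<in> cdom c'" by (rule atlas_cover[OF atlas])
    from d[OF c'(1) r chart_facts(1)[OF atlas c']] show ?thesis
      by (auto simp: differentiable_def chart_facts(2)[OF atlas c'])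
  qed
qed

lemma dK_sum:
  assumes c: "c \<in> A" "x \<in> cdom c" and r: "r \<in> {s<..t}"
  shows "dK c v x r y = (\<Sum>i\<in>UNIV. v $ i * dK c (axis i 1) x r y)"
  unfolding dK_def
  using derivative_eq_sum_partials kernel_up_to_time(3)[OF c r] frechet_derivative_works by blast

lemma dK_continuous:
  assumes c: "c \<in> A" "x \<in> cdom c"
  shows "continuous_on ({s<..t} \<times> UNIV) (\<lambda>(r, y). dK c v x r y)"
proof -
  have "continuous_on ({s<..t} \<times> UNIV) (\<lambda>p. \<Sum>i\<in>UNIV. v $ i * dK c (axis i 1) x (fst p) (snd p))"
    using kernel_up_to_time(2)[OF c] by (intro continuous_intros) (simp add: case_prod_unfold)
  then show ?thesis by (rule continuous_on_eq) (auto simp: dK_sum[OF c])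
qed

text \<open>The kernel is nonnegative, so a zero is a minimum in \<open>x\<close>.\<close>

lemma dK_zero:
  assumes c: "c \<in> A" "x \<in> cdom c" and r: "r \<in> {s<..t}" and 0: "K x r y s = 0"
  shows "dK c v x r y = 0"
proof -
  have "((\<lambda>z. K (cinv c z) r y s) has_derivative frechet_derivative (\<lambda>z. K (cinv c z) r y s) (at (coord c x))) (at (coord c x))"
    using kernel_up_to_time(3)[OF c r] frechet_derivative_works by blast
  then have "frechet_derivative (\<lambda>z. K (cinv c z) r y s) (at (coord c x)) = (\<lambda>_. 0)"
    using kernel_nonneg[OF r] 0
    by (intro has_derivative_local_min) (auto simp: chart_facts(2)[OF atlas c])
  then show ?thesis by (simp add: dK_def)
qed

lemma kernel_integrable:
  assumes f: "f \<in> borel_measurable borel" "\<And>y. \<bar>f y\<bar> \<le> 1" and r: "r \<in> {s<..t}"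
  shows "integrable \<mu> (\<lambda>y. K x r y s * f y)"
proof -
  interpret cp: compact_param \<mu> f by (rule compact_param.intro[OF comp finite_\<mu> sets_\<mu> f])
  obtain c where c: "c \<in> A" "x \<in> cdom c" by (rule atlas_cover[OF atlas])
  show ?thesis by (rule cp.integrable_param[OF kernel_up_to_time(1)[OF c] r])
qed

lemma kernel_mass:
  assumes r: "r \<in> {s<..t}" shows "(\<integral>y. K x r y s \<partial>\<mu>) = 1"
proof -
  have i: "integrable \<mu> (\<lambda>y. K x r y s)" using kernel_integrable[of "\<lambda>_. 1" r x] r by simp
  interpret prob_space "density \<mu> (\<lambda>y. ennreal (K x r y s))" by (rule kernel_prob[OF r])
  have "(\<integral>\<^sup>+ y. ennreal (K x r y s) \<partial>\<mu>) = 1"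
    using emeasure_space_1 i by (simp add: emeasure_density cong: nn_integral_cong)
  then show ?thesis using nn_integral_eq_integral[OF i] kernel_nonneg[OF r] by (simp add: ennreal_eq_1)
qed

definition evolve :: "('m \<Rightarrow> real) \<Rightarrow> 'm \<Rightarrow> real \<Rightarrow> real" where
  "evolve f x r = (\<integral>y. K x r y s * f y \<partial>\<mu>)"

lemma evolve_smooth:
  assumes f: "f \<in> borel_measurable borel" "\<And>y. \<bar>f y\<bar> \<le> 1" and c: "c \<in> A"
  shows "Ck_on k (\<lambda>(z, r). evolve f (cinv c z) r) (cimg c \<times> T)"
    and "p \<in> cimg c \<times> T \<Longrightarrow> pd b (\<lambda>(z, r). evolve f (cinv c z) r) p = (\<integral>y. pd b (\<lambda>p. K (cinv c (fst p)) (snd p) y s) p * f y \<partial>\<mu>)"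
proof -
  interpret cp: compact_param \<mu> f by (rule compact_param.intro[OF comp finite_\<mu> sets_\<mu> f])
  have S: "open (cimg c \<times> T)" by (intro open_Times open_greaterThanLessThan atlas_facts(2)[OF atlas c])
  have *: "(\<lambda>(z, r). evolve f (cinv c z) r) = (\<lambda>p. \<integral>y. K (cinv c (fst p)) (snd p) y s * f y \<partial>\<mu>)"
    by (simp add: evolve_def case_prod_unfold)
  show "Ck_on k (\<lambda>(z, r). evolve f (cinv c z) r) (cimg c \<times> T)"
    unfolding * by (rule cp.Ck_on_integral_param[OF S kernel_param[OF c]])
  show "pd b (\<lambda>(z, r). evolve f (cinv c z) r) p = (\<integral>y. pd b (\<lambda>p. K (cinv c (fst p)) (snd p) y s) p * f y \<partial>\<mu>)"
    if "p \<in> cimg c \<times> T"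
    unfolding * by (rule cp.pd_integral_param[OF S kernel_param[OF c, where k = "Suc 0"] that])
qed

lemma kernel_slice:
  assumes c: "c \<in> A"
  shows "Ck_on k (\<lambda>p. K (cinv c (fst p)) (snd p) y s) (cimg c \<times> T)"
proof -
  have S: "open (cimg c \<times> T)" by (intro open_Times open_greaterThanLessThan atlas_facts(2)[OF atlas c])
  obtain c' where c': "c' \<in> A" "y \<in> cdom c'" by (rule atlas_cover[OF atlas])
  define L :: "(real^'n) \<times> real \<Rightarrow> ((real^'n) \<times> real) \<times> (real^'n)" where "L = (\<lambda>p. (p, 0))"
  have "Ck_on k (\<lambda>p. (\<lambda>(p, w). K (cinv c (fst p)) (snd p) (cinv c' w) s) (L p + (0, coord c' y))) (cimg c \<times> T)"
  proof (rule Ck_on_affine[OF S _ _ _ kernel_smooth[OF c c'(1)]])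
    show "bounded_linear L" unfolding L_def by (intro bounded_linear_Pair bounded_linear_ident bounded_linear_zero)
    show "L b \<in> Basis" if "b \<in> Basis" for b using that by (auto simp: L_def Basis_prod_def)
    show "L p + (0, coord c' y) \<in> (cimg c \<times> T) \<times> cimg c'" if "p \<in> cimg c \<times> T" for p
      using that chart_facts(1)[OF atlas c'] by (simp add: L_def)
  qed
  then show ?thesis by (simp add: L_def chart_facts(2)[OF atlas c'])
qed

text \<open>The Laplacian is a linear combination of first and second derivatives, each of which can be taken under the
  integral; there the heat equation for the kernel applies.\<close>

lemma evolve_heat:
  assumes f: "f \<in> borel_measurable borel" "\<And>y. \<bar>f y\<bar> \<le> 1" and c: "c \<in> A" "x \<in> cdom c" and r: "r \<in> T"
  shows "((\<lambda>r. evolve f x r) has_real_derivative laplacian (in_chart (g r) c) (\<lambda>z. evolve f (cinv c z) r) (coord c x)) (at r)"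
proof -
  interpret cp: compact_param \<mu> f by (rule compact_param.intro[OF comp finite_\<mu> sets_\<mu> f])
  define U where "U = cimg c"
  define z where "z = coord c x"
  define Kc where "Kc y = (\<lambda>p. K (cinv c (fst p)) (snd p) y s)" for y
  have oU: "open U" unfolding U_def by (rule atlas_facts(2)[OF atlas c(1)])
  have oT: "open T" by (rule open_greaterThanLessThan)
  have S: "open (U \<times> T)" using oU oT by (rule open_Times)
  have z: "z \<in> U" unfolding U_def z_def by (rule chart_facts(1)[OF atlas c])
  have p: "(z, r) \<in> U \<times> T" using z r by simp
  note par = kernel_param[OF c(1), folded U_def, folded Kc_def]
  note sl = kernel_slice[OF c(1), folded U_def, folded Kc_def]
  note es = evolve_smooth[OF f c(1), folded U_def, folded Kc_def]
  have int1: "integrable \<mu> (\<lambda>y. pd b (Kc y) (w, r) * f y)" if "b \<in> Basis" "w \<in> U" for b w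
  proof (rule cp.integrable_param[of "U \<times> T" "\<lambda>p y. pd b (Kc y) p"])
    show "continuous_on ((U \<times> T) \<times> UNIV) (\<lambda>(p, y). pd b (Kc y) p)"
      using par[of "Suc 0"] that by (simp add: Kc_def)
  qed (use that r in auto)
  have par1: "Ck_param k (\<lambda>p y. pd b (Kc y) p) (U \<times> T)" if "b \<in> Basis" for k b
    using par[of "Suc k"] that by (simp add: Kc_def)
  have int2: "integrable \<mu> (\<lambda>y. pd b (pd b' (Kc y)) (z, r) * f y)" if "b \<in> Basis" "b' \<in> Basis" for b b'
  proof (rule cp.integrable_param[of "U \<times> T" "\<lambda>p y. pd b (pd b' (Kc y)) p"])
    show "continuous_on ((U \<times> T) \<times> UNIV) (\<lambda>(p, y). pd b (pd b' (Kc y)) p)"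
      using par1[OF that(2), of "Suc 0"] that by simp
  qed (use p in auto)
  define G where "G i j = matrix_inv (in_chart (g r) c z) $ i $ j" for i j
  define Ch where "Ch k i j = christoffel (in_chart (g r) c) k i j z" for k i j
  define e :: "'n \<Rightarrow> (real^'n) \<times> real" where "e i = (axis i 1, 0)" for i
  have e: "e i \<in> Basis" for i unfolding e_def by (rule Basis_space_time)
  have lap: "laplacian (in_chart (g r) c) (\<lambda>z. F (z, r)) z =
     (\<Sum>i\<in>UNIV. \<Sum>j\<in>UNIV. G i j * (pd (e i) (pd (e j) F) (z, r) - (\<Sum>k\<in>UNIV. Ch k i j * pd (e k) F (z, r))))"
    if F: "Ck_on 2 F (U \<times> T)" for F
  proof -
    have F': "Ck_on (Suc 1) F (U \<times> T)" using F by (simp only: Suc_1)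
    have 1: "pderiv_at i (\<lambda>z. F (z, r)) w = pd (e i) F (w, r)" if "w \<in> U" for i w
      unfolding e_def by (rule pderiv_space_slice[OF oU oT F' that r])
    have 2: "Ck_on (Suc 0) (pd (e j) F) (U \<times> T)" for j using Ck_on_pd[OF S F' e] by simp
    have "pderiv_at i (pderiv_at j (\<lambda>z. F (z, r))) z = pderiv_at i (\<lambda>w. pd (e j) F (w, r)) z" for i j
      by (rule pderiv_cong[OF oU _ z]) (rule 1)
    also have "\<dots> i j = pd (e i) (pd (e j) F) (z, r)" for i j
      unfolding e_def[of i] by (rule pderiv_space_slice[OF oU oT 2 z r])
    finally show ?thesis by (simp add: laplacian_def G_def Ch_def 1[OF z])
  qed
  have K_heat: "pd (0, 1) (Kc y) (z, r) = laplacian (in_chart (g r) c) (\<lambda>z. Kc y (z, r)) z" for y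
  proof -
    have rI: "s \<in> I" "r \<in> I" "s < r" using r s in_I by auto
    have "((\<lambda>t. K x t y s) has_real_derivative laplacian (in_chart (g r) c) (\<lambda>z. K (cinv c z) r y s) (coord c x)) (at r within I)"
      using K[unfolded heat_kernel_def, THEN conjunct2, THEN conjunct2, THEN conjunct1, rule_format, OF rI c] .
    then have "((\<lambda>t. K x t y s) has_real_derivative laplacian (in_chart (g r) c) (\<lambda>z. K (cinv c z) r y s) (coord c x)) (at r within T)"
      by (rule DERIV_subset) (auto simp: in_I)
    then have "((\<lambda>t. K x t y s) has_real_derivative laplacian (in_chart (g r) c) (\<lambda>z. Kc y (z, r)) z) (at r)"
      by (simp only: at_within_open[OF r oT] Kc_def fst_conv snd_conv z_def)
    moreover have "((\<lambda>t. Kc y (z, t)) has_real_derivative pd (0, 1) (Kc y) (z, r)) (at r)"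
      by (rule time_slice_derivative[OF oU oT sl z r])
    then have "((\<lambda>t. K x t y s) has_real_derivative pd (0, 1) (Kc y) (z, r)) (at r)"
      by (simp add: Kc_def z_def chart_facts(2)[OF atlas c])
    ultimately show ?thesis by (rule DERIV_unique[rotated])
  qed
  define E where "E = (\<lambda>(z, r). evolve f (cinv c z) r)"
  have dE: "pd b E q = (\<integral>y. pd b (Kc y) q * f y \<partial>\<mu>)" if "q \<in> U \<times> T" for b q
    using es(2)[OF that] by (simp add: E_def)
  have CE: "Ck_on k E (U \<times> T)" for k unfolding E_def by (rule es(1))
  have ddE: "pd b (pd (e j) E) (z, r) = (\<integral>y. pd b (pd (e j) (Kc y)) (z, r) * f y \<partial>\<mu>)" for b j
  proof -
    have "pd b (pd (e j) E) (z, r) = pd b (\<lambda>q. \<integral>y. pd (e j) (Kc y) q * f y \<partial>\<mu>) (z, r)"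
    proof -
      have "Ck_on (Suc 0) (pd (e j) E) (U \<times> T)" by (rule Ck_on_pd[OF S CE e])
      from Ck_on_has_derivative[OF S this p] have "pd (e j) E differentiable at (z, r)"
        by (auto simp: differentiable_def)
      from frechet_derivative_transform_within_open[OF this S p dE] show ?thesis by simp
    qed
    also have "\<dots> = (\<integral>y. pd b (pd (e j) (Kc y)) (z, r) * f y \<partial>\<mu>)"
      using cp.pd_integral_param[OF S par1[OF e, where k = "Suc 0"] p] by simp
    finally show ?thesis .
  qed
  have "laplacian (in_chart (g r) c) (\<lambda>z. E (z, r)) z = (\<Sum>i\<in>UNIV. \<Sum>j\<in>UNIV. G i j *
     ((\<integral>y. pd (e i) (pd (e j) (Kc y)) (z, r) * f y \<partial>\<mu>) - (\<Sum>k\<in>UNIV. Ch k i j * (\<integral>y. pd (e k) (Kc y) (z, r) * f y \<partial>\<mu>))))"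
    unfolding lap[OF CE] ddE dE[OF p] ..
  also have "\<dots> = (\<integral>y. (\<Sum>i\<in>UNIV. \<Sum>j\<in>UNIV. G i j *
     (pd (e i) (pd (e j) (Kc y)) (z, r) * f y - (\<Sum>k\<in>UNIV. Ch k i j * (pd (e k) (Kc y) (z, r) * f y)))) \<partial>\<mu>)"
    by (simp add: int1[OF e z] int2[OF e e])
  also have "\<dots> = (\<integral>y. laplacian (in_chart (g r) c) (\<lambda>z. Kc y (z, r)) z * f y \<partial>\<mu>)"
    by (intro Bochner_Integration.integral_cong refl, subst lap[OF sl])
      (simp add: sum_distrib_right left_diff_distrib mult.assoc)
  also have "\<dots> = pd (0, 1) E (z, r)" unfolding K_heat[symmetric] dE[OF p] ..
  finally have eq: "laplacian (in_chart (g r) c) (\<lambda>z. E (z, r)) z = pd (0, 1) E (z, r)" .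
  have "((\<lambda>t. E (z, t)) has_real_derivative pd (0, 1) E (z, r)) (at r)"
    by (rule time_slice_derivative[OF oU oT CE z r])
  then show ?thesis using eq by (simp add: E_def z_def chart_facts(2)[OF atlas c])
qed

end

section \<open>The score and its convex order\<close>

context heat_kernel_slice
begin

lemma evolve_range:
  assumes f: "f \<in> borel_measurable borel" "\<And>y. e \<le> f y \<and> f y \<le> 1 - e" "0 < e" and r: "r \<in> {s<..t}"
  shows "e \<le> evolve f x r \<and> evolve f x r \<le> 1 - e"
proof -
  have f1: "\<bar>f y\<bar> \<le> 1" for y using f(2)[of y] f(3) by auto
  note i = kernel_integrable[OF f(1) f1 r, of x]
  have i1: "integrable \<mu> (\<lambda>y. K x r y s)" using kernel_integrable[of "\<lambda>_. 1" r x] r by simp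
  have "(\<integral>y. K x r y s * e \<partial>\<mu>) \<le> evolve f x r" unfolding evolve_def
    using f(2) kernel_nonneg[OF r] by (intro integral_mono i integrable_mult_left i1 mult_left_mono) auto
  moreover have "evolve f x r \<le> (\<integral>y. K x r y s * (1 - e) \<partial>\<mu>)" unfolding evolve_def
    using f(2) kernel_nonneg[OF r] by (intro integral_mono i integrable_mult_left i1 mult_left_mono) auto
  ultimately show ?thesis using i1 by (simp add: kernel_mass[OF r])
qed

lemma dK_integrable:
  assumes f: "f \<in> borel_measurable borel" "\<And>y. \<bar>f y\<bar> \<le> 1" and c: "c \<in> A" "x \<in> cdom c" and r: "r \<in> {s<..t}"
  shows "integrable \<mu> (\<lambda>y. dK c v x r y * f y)"
proof -
  interpret cp: compact_param \<mu> f by (rule compact_param.intro[OF comp finite_\<mu> sets_\<mu> f])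
  show ?thesis by (rule cp.integrable_param[OF dK_continuous[OF c] r])
qed

lemma dK_evolve:
  assumes f: "f \<in> borel_measurable borel" "\<And>y. \<bar>f y\<bar> \<le> 1" and c: "c \<in> A" "x \<in> cdom c" and r: "r \<in> T"
  shows "(\<integral>y. dK c v x r y * f y \<partial>\<mu>) = (\<Sum>i\<in>UNIV. v $ i * pderiv_at i (\<lambda>z. evolve f (cinv c z) r) (coord c x))"
proof -
  have oU: "open (cimg c)" by (rule atlas_facts(2)[OF atlas c(1)])
  have oT: "open T" by (rule open_greaterThanLessThan)
  have z: "coord c x \<in> cimg c" by (rule chart_facts(1)[OF atlas c])
  have r': "r \<in> {s<..t}" using r by auto
  have "pderiv_at i (\<lambda>z. evolve f (cinv c z) r) (coord c x) = (\<integral>y. dK c (axis i 1) x r y * f y \<partial>\<mu>)" for i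
  proof -
    have "pd (axis i 1, 0) (\<lambda>p. K (cinv c (fst p)) (snd p) y s) (coord c x, r) = dK c (axis i 1) x r y" for y
      using pderiv_space_slice[OF oU oT kernel_slice[OF c(1)] z r, of i y] by (simp add: dK_def pderiv_at_def)
    moreover have "pderiv_at i (\<lambda>z. evolve f (cinv c z) r) (coord c x) = pd (axis i 1, 0) (\<lambda>(z, r). evolve f (cinv c z) r) (coord c x, r)"
      using pderiv_space_slice[OF oU oT evolve_smooth(1)[OF f c(1)] z r, of i] by simp
    ultimately show ?thesis using evolve_smooth(2)[OF f c(1), of "(coord c x, r)"] z r by simp
  qed
  moreover have "(\<integral>y. dK c v x r y * f y \<partial>\<mu>) = (\<Sum>i\<in>UNIV. v $ i * (\<integral>y. dK c (axis i 1) x r y * f y \<partial>\<mu>))"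
    by (simp add: dK_sum[OF c r', of v] sum_distrib_right mult.assoc dK_integrable[OF f c r'])
  ultimately show ?thesis by simp
qed

text \<open>From \<open>|\<nabla>h|\<^sup>2 \<le> 1 / (2 (r - s))\<close> and the Cauchy-Schwarz inequality for the metric, with
  \<open>\<partial>\<^sub>v u = \<phi>(h) \<partial>\<^sub>v h\<close>.\<close>

lemma dK_bound_before:
  assumes f: "f \<in> borel_measurable borel" "\<And>y. e \<le> f y \<and> f y \<le> 1 - e" "0 < e" and c: "c \<in> A" "x \<in> cdom c" and r: "r \<in> T"
  shows "(\<integral>y. dK c v x r y * f y \<partial>\<mu>)\<^sup>2 \<le> (std_normal_density (Psi (evolve f x r)))\<^sup>2 * (v \<bullet> (g r c x *v v)) / (2 * (r - s))"
proof -
  have f1: "\<bar>f y\<bar> \<le> 1" for y using f(2)[of y] f(3) by auto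
  have u01: "0 < evolve f x r \<and> evolve f x r < 1" if "r \<in> {s<..t}" for x r
    using evolve_range[OF f that, of x] f(3) by auto
  interpret hs: heat_solution A I g s t "evolve f"
  proof (rule heat_solution.intro)
    show "{s<..<t} \<subseteq> I" using sub by auto
    show "Ck_on 3 (\<lambda>(z, t). evolve f (cinv c z) t) (cimg c \<times> T)" if "c \<in> A" for c
      by (rule evolve_smooth(1)[OF f(1) f1 that])
  qed (use evolve_heat[OF f(1) f1] u01 flow in auto)
  define z where "z = coord c x"
  define u where "u w = evolve f (cinv c w) r" for w
  define p where "p = evolve f x r"
  define G where "G = g r c x"
  have uz: "u z = p" by (simp add: u_def z_def p_def chart_facts(2)[OF atlas c])
  have p01: "0 < p" "p < 1" using u01[of r x] r by (auto simp: p_def)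
  have oU: "open (cimg c)" by (rule atlas_facts(2)[OF atlas c(1)])
  have zU: "z \<in> cimg c" unfolding z_def by (rule chart_facts(1)[OF atlas c])
  have "Ck_on (Suc 0) u (cimg c)"
    using Ck_on_space_slice[OF oU r evolve_smooth(1)[OF f(1) f1 c(1)]] by (simp add: u_def[abs_def] del: Ck_on.simps)
  note du = Ck_on_has_derivative[OF oU this zU]
  define w where "w = sqrt (2 * pi) * exp ((Psi p)\<^sup>2 / 2)"
  have "(Psi has_derivative (*) w) (at (u z))"
    using Psi_has_derivative[OF p01] by (simp add: uz w_def has_field_derivative_def)
  from pderiv_unique[OF has_derivative_compose[OF du this]]
  have dh: "pderiv_at i (\<lambda>z. Psi (u z)) z = w * pderiv_at i u z" for i by (simp add: pderiv_at_def)
  define d where "d = (\<chi> i. pderiv_at i (\<lambda>z. Psi (u z)) z)"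
  interpret cm: coordinate_metric "cimg c" "in_chart (g r) c"
    by (rule chart_metric[OF atlas metric c(1)]) (use r in_I in auto)
  have G: "in_chart (g r) c z = G" by (simp add: in_chart_def z_def G_def chart_facts(2)[OF atlas c])
  have grad: "(r - s) * (d \<bullet> (matrix_inv G *v d)) \<le> 1 / 2"
  proof -
    have "d \<bullet> (matrix_inv G *v d) = hs.grad_h_sq x r"
      unfolding hs.grad_h_sq_eq[OF c r] grad_sq_def Let_def d_def G_def
      by (simp add: o_def hs.h_def u_def z_def)
    then show ?thesis using hs.gradient_bound[OF r, of x] by simp
  qed
  have psd: "0 \<le> a \<bullet> (G *v a)" for a
    using cm.metric_pos[OF zU, of a] unfolding G by (cases "a = 0") auto
  have sym: "G $ i $ j = G $ j $ i" for i j using cm.metric_sym[OF zU] unfolding G .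
  define y where "y = matrix_inv G *v d"
  have Gy: "G *v y = d"
    using matrix_inv_right[OF cm.inv_g[OF zU]] by (simp add: y_def matrix_vector_mul_assoc G)
  have "(v \<bullet> d)\<^sup>2 \<le> (v \<bullet> (G *v v)) * (y \<bullet> d)" using psd_cauchy_schwarz[OF sym psd, of v y] by (simp add: Gy)
  also have "y \<bullet> d \<le> 1 / (2 * (r - s))" using grad r by (simp add: y_def inner_commute field_simps)
  then have "(v \<bullet> (G *v v)) * (y \<bullet> d) \<le> (v \<bullet> (G *v v)) * (1 / (2 * (r - s)))" by (rule mult_left_mono[OF _ psd])
  finally have main: "(v \<bullet> d)\<^sup>2 \<le> (v \<bullet> (G *v v)) / (2 * (r - s))" by simp
  have "v \<bullet> d = w * (\<integral>y. dK c v x r y * f y \<partial>\<mu>)"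
  proof -
    have "v \<bullet> d = w * (\<Sum>i\<in>UNIV. v $ i * pderiv_at i u z)"
      by (simp add: inner_vec_def d_def dh sum_distrib_left mult_ac)
    then show ?thesis unfolding dK_evolve[OF f(1) f1 c r] u_def[abs_def] z_def .
  qed
  moreover have wphi: "std_normal_density (Psi p) * w = 1"
    by (simp add: std_normal_density_def w_def exp_minus)
  ultimately have "(\<integral>y. dK c v x r y * f y \<partial>\<mu>) = std_normal_density (Psi p) * (v \<bullet> d)"
    by (simp add: mult.assoc[symmetric])
  then have "(\<integral>y. dK c v x r y * f y \<partial>\<mu>)\<^sup>2 = (std_normal_density (Psi p))\<^sup>2 * (v \<bullet> d)\<^sup>2" by (simp add: power_mult_distrib)
  also have "\<dots> \<le> (std_normal_density (Psi p))\<^sup>2 * ((v \<bullet> (G *v v)) / (2 * (r - s)))" by (rule mult_left_mono[OF main]) simp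
  finally show ?thesis by (simp add: p_def G_def)
qed

lemma at_within_T: "at t within T = at_left t"
  by (rule at_within_nhd[of t "{s<..}"]) (use less in auto)

lemma left_limit:
  assumes "continuous_on {s<..t} F"
  shows "(F \<longlongrightarrow> F t) (at_left t)"
proof -
  have "(F \<longlongrightarrow> F t) (at t within {s<..t})" using assms less by (simp add: continuous_on_def)
  then have "(F \<longlongrightarrow> F t) (at t within T)" by (rule tendsto_within_subset) auto
  then show ?thesis by (simp add: at_within_T)
qed

lemma dK_bound:
  assumes f: "f \<in> borel_measurable borel" "\<And>y. e \<le> f y \<and> f y \<le> 1 - e" "0 < e" and c: "c \<in> A" "x \<in> cdom c"
    and v: "v \<bullet> (g t c x *v v) = 1"
  shows "(\<integral>y. dK c v x t y * f y \<partial>\<mu>) \<le> sqrt (1 / (2 * (t - s))) * std_normal_density (Psi (evolve f x t))"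
proof -
  have f1: "\<bar>f y\<bar> \<le> 1" for y using f(2)[of y] f(3) by auto
  interpret cp: compact_param \<mu> f by (rule compact_param.intro[OF comp finite_\<mu> sets_\<mu> f(1) f1])
  have l1: "((\<lambda>r. \<integral>y. dK c v x r y * f y \<partial>\<mu>) \<longlongrightarrow> (\<integral>y. dK c v x t y * f y \<partial>\<mu>)) (at_left t)"
    by (rule left_limit[OF cp.continuous_on_integral_param[OF dK_continuous[OF c]]])
  have l2: "((\<lambda>r. evolve f x r) \<longlongrightarrow> evolve f x t) (at_left t)"
    unfolding evolve_def by (rule left_limit[OF cp.continuous_on_integral_param[OF kernel_up_to_time(1)[OF c]]])
  have p01: "0 < evolve f x t" "evolve f x t < 1" using evolve_range[OF f, of t x] f(3) less by auto
  have l3: "((\<lambda>r. std_normal_density (Psi (evolve f x r))) \<longlongrightarrow> std_normal_density (Psi (evolve f x t))) (at_left t)"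
    unfolding std_normal_density_def
    by (intro tendsto_intros isCont_tendsto_compose[OF DERIV_isCont[OF Psi_has_derivative[OF p01]] l2]) auto
  have l4: "((\<lambda>r. v \<bullet> (g r c x *v v)) \<longlongrightarrow> v \<bullet> (g t c x *v v)) (at_left t)"
  proof -
    have "((\<lambda>r. g r c x $ i $ j) \<longlongrightarrow> g t c x $ i $ j) (at_left t)" for i j
    proof -
      have "((\<lambda>r. g r c x $ i $ j) has_real_derivative - 2 * ricci (in_chart (g t) c) i j (coord c x)) (at t within I)"
        using flow c t unfolding closed_Ricci_flow_def by blast
      then have "((\<lambda>r. g r c x $ i $ j) \<longlongrightarrow> g t c x $ i $ j) (at t within I)"
        using has_field_derivative_imp_has_derivative has_derivative_continuous continuous_within by blast
      then have "((\<lambda>r. g r c x $ i $ j) \<longlongrightarrow> g t c x $ i $ j) (at t within T)"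
        by (rule tendsto_within_subset) (auto simp: in_I)
      then show ?thesis by (simp add: at_within_T)
    qed
    then show ?thesis unfolding inner_vec_def matrix_vector_mult_def inner_real_def vec_lambda_beta
      by (intro tendsto_sum tendsto_mult tendsto_const)
  qed
  have "\<forall>\<^sub>F r in at_left t. r \<in> T" using less by (intro eventually_at_leftI[of s]) auto
  then have "\<forall>\<^sub>F r in at_left t. (\<integral>y. dK c v x r y * f y \<partial>\<mu>)\<^sup>2 \<le> (std_normal_density (Psi (evolve f x r)))\<^sup>2 * (v \<bullet> (g r c x *v v)) / (2 * (r - s))"
    by eventually_elim (rule dK_bound_before[OF f c])
  moreover have "((\<lambda>r. (std_normal_density (Psi (evolve f x r)))\<^sup>2 * (v \<bullet> (g r c x *v v)) / (2 * (r - s))) \<longlongrightarrow>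
      (std_normal_density (Psi (evolve f x t)))\<^sup>2 * (v \<bullet> (g t c x *v v)) / (2 * (t - s))) (at_left t)"
    using less by (intro tendsto_intros l3 l4) auto
  ultimately have "(\<integral>y. dK c v x t y * f y \<partial>\<mu>)\<^sup>2 \<le> (std_normal_density (Psi (evolve f x t)))\<^sup>2 * (v \<bullet> (g t c x *v v)) / (2 * (t - s))"
    by (intro tendsto_le[OF _ _ tendsto_power[OF l1]]) auto
  also have "\<dots> = (sqrt (1 / (2 * (t - s))) * std_normal_density (Psi (evolve f x t)))\<^sup>2"
    using less by (simp add: v power_mult_distrib real_sqrt_pow2)
  finally have sq: "(\<integral>y. dK c v x t y * f y \<partial>\<mu>)\<^sup>2 \<le> (sqrt (1 / (2 * (t - s))) * std_normal_density (Psi (evolve f x t)))\<^sup>2" .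
  have "0 \<le> sqrt (1 / (2 * (t - s))) * std_normal_density (Psi (evolve f x t))"
    by (rule mult_nonneg_nonneg) (use less in simp_all)
  then show ?thesis by (rule power2_le_imp_le[OF sq])
qed

text \<open>The total mass of the kernel is constantly \<open>1\<close>.\<close>

lemma dK_mean_zero:
  assumes c: "c \<in> A" "x \<in> cdom c"
  shows "(\<integral>y. dK c v x t y \<partial>\<mu>) = 0"
proof -
  have f: "(\<lambda>_. 1) \<in> borel_measurable (borel :: 'm measure)" "\<bar>1 :: real\<bar> \<le> 1" by auto
  interpret cp: compact_param \<mu> "\<lambda>_. 1" by (rule compact_param.intro[OF comp finite_\<mu> sets_\<mu> f])
  have "((\<lambda>r. \<integral>y. dK c v x r y * 1 \<partial>\<mu>) \<longlongrightarrow> (\<integral>y. dK c v x t y * 1 \<partial>\<mu>)) (at_left t)"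
    by (rule left_limit[OF cp.continuous_on_integral_param[OF dK_continuous[OF c]]])
  moreover have "\<forall>\<^sub>F r in at_left t. (\<integral>y. dK c v x r y * 1 \<partial>\<mu>) = 0"
  proof -
    have "(\<integral>y. dK c v x r y * 1 \<partial>\<mu>) = 0" if r: "r \<in> T" for r
    proof -
      have "evolve (\<lambda>_. 1) y r = 1" for y using kernel_mass[of r y] r by (simp add: evolve_def)
      then show ?thesis unfolding dK_evolve[OF f c r] by (simp add: pderiv_at_def)
    qed
    moreover have "\<forall>\<^sub>F r in at_left t. r \<in> T" using less by (intro eventually_at_leftI[of s]) auto
    ultimately show ?thesis by (auto elim: eventually_mono)
  qed
  then have "((\<lambda>r. \<integral>y. dK c v x r y * 1 \<partial>\<mu>) \<longlongrightarrow> 0) (at_left t)" by (rule tendsto_eventually)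
  ultimately have "(\<integral>y. dK c v x t y * 1 \<partial>\<mu>) = 0" by (rule tendsto_unique[rotated]) simp
  then show ?thesis by simp
qed

text \<open>At zeros of the kernel the quotient is \<open>0\<close>; these form a null set for \<open>\<nu>\<close>. Elsewhere it is the derivative of
  \<open>log K\<close>.\<close>

definition score :: "('m, 'n) chart \<Rightarrow> real^'n \<Rightarrow> 'm \<Rightarrow> 'm \<Rightarrow> real" where
  "score c v x y = dK c v x t y / K x t y s"

text \<open>The gradient bound for \<open>f = e + (1 - 2 e) \<cdot> 1\<^sub>B\<close>, \<open>B = {S > b}\<close>, as \<open>e\<close> tends to \<open>0\<close>. The constant \<open>e\<close> keeps the
  values of \<open>f\<close> in a compact subset of \<open>(0, 1)\<close>.\<close>

lemma score_stop_loss: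
  assumes c: "c \<in> A" "x \<in> cdom c" and v: "v \<bullet> (g t c x *v v) = 1"
    and P: "prob_space P" and Z: "distributed P lborel Z (normal_density 0 (sqrt (1 / (2 * (t - s)))))"
  shows "stop_loss_order (density \<mu> (\<lambda>y. ennreal (K x t y s))) P (score c v x) Z"
proof -
  define \<nu> where "\<nu> = density \<mu> (\<lambda>y. ennreal (K x t y s))"
  define \<sigma> where "\<sigma> = sqrt (1 / (2 * (t - s)))"
  have \<sigma>: "\<sigma> > 0" using less by (simp add: \<sigma>_def)
  note gauss = gaussian_stop_loss[OF P Z[folded \<sigma>_def] \<sigma>]
  have tt: "t \<in> {s<..t}" using less by simp
  note nonneg = kernel_nonneg[OF tt]
  interpret nu: prob_space \<nu> unfolding \<nu>_def by (rule kernel_prob[OF tt])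
  interpret P: prob_space P by (rule P)
  have mult: "K x t y s * score c v x y = dK c v x t y" for y
    using dK_zero[OF c tt, of y v] by (cases "K x t y s = 0") (auto simp: score_def)
  have cont: "continuous_on UNIV (\<lambda>y. F t y)" if "continuous_on ({s<..t} \<times> UNIV) (\<lambda>(r, y). F r y)" for F :: "real \<Rightarrow> 'm \<Rightarrow> real"
  proof -
    have "continuous_on UNIV (\<lambda>y. (\<lambda>(r, y). F r y) (t, y))"
      by (rule continuous_on_compose2[OF that]) (use tt in \<open>auto intro!: continuous_intros\<close>)
    then show ?thesis by simp
  qed
  have mK: "(\<lambda>y. K x t y s) \<in> borel_measurable borel" and mdK: "(\<lambda>y. dK c v x t y) \<in> borel_measurable borel"
    using cont[OF kernel_up_to_time(1)[OF c]] cont[OF dK_continuous[OF c]] by (auto intro: borel_measurable_continuous_onI)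
  have mS: "score c v x \<in> borel_measurable borel" unfolding score_def[abs_def] using mK mdK by measurable
  have m\<mu>: "F \<in> borel_measurable \<mu>" if "F \<in> borel_measurable borel" for F :: "'m \<Rightarrow> real"
    using that sets_\<mu> by (simp cong: measurable_cong_sets)
  have int_dK: "integrable \<mu> (\<lambda>y. dK c v x t y)"
    using dK_integrable[of "\<lambda>_. 1" c x t v] c tt by simp
  have int_K: "integrable \<mu> (\<lambda>y. K x t y s)" using kernel_integrable[of "\<lambda>_. 1" t x] tt by simp
  have int_S: "integrable \<nu> (score c v x)" unfolding \<nu>_def
    using nonneg int_dK by (subst integrable_density) (auto intro!: m\<mu> mS mK simp: mult)
  have mean: "(\<integral>y. score c v x y \<partial>\<nu>) = 0" unfolding \<nu>_def
    using nonneg dK_mean_zero[OF c, of v] by (subst integral_density) (auto intro!: m\<mu> mS mK simp: mult)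
  have stop: "(\<integral>y. max 0 (score c v x y - b) \<partial>\<nu>) \<le> (\<integral>\<omega>. max 0 (Z \<omega> - b) \<partial>P)" for b
  proof -
    define B where "B = {y. b < score c v x y}"
    have B: "B \<in> sets borel"
      using borel_measurable_less[OF borel_measurable_const mS, of b] by (simp add: B_def)
    have ind: "(indicator B :: 'm \<Rightarrow> real) \<in> borel_measurable borel" "\<bar>indicator B y :: real\<bar> \<le> 1" for y
      using B by (auto simp: indicator_def)
    define DB where "DB = (\<integral>y. dK c v x t y * indicator B y \<partial>\<mu>)"
    define \<beta> where "\<beta> = (\<integral>y. K x t y s * indicator B y \<partial>\<mu>)"
    note iDB = dK_integrable[OF ind c tt, of v]
    note iKB = kernel_integrable[OF ind tt, of x]
    have lhs: "(\<integral>y. max 0 (score c v x y - b) \<partial>\<nu>) = DB - b * \<beta>"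
    proof -
      have "(\<integral>y. max 0 (score c v x y - b) \<partial>\<nu>) = (\<integral>y. K x t y s *\<^sub>R max 0 (score c v x y - b) \<partial>\<mu>)"
        unfolding \<nu>_def using nonneg mS by (intro integral_density) (auto intro!: m\<mu> mK)
      also have "\<dots> = (\<integral>y. dK c v x t y * indicator B y - b * (K x t y s * indicator B y) \<partial>\<mu>)"
      proof (intro Bochner_Integration.integral_cong refl)
        fix y
        show "K x t y s *\<^sub>R max 0 (score c v x y - b) = dK c v x t y * indicator B y - b * (K x t y s * indicator B y)"
          by (cases "y \<in> B") (auto simp: B_def mult[symmetric] algebra_simps)
      qed
      also have "\<dots> = DB - b * \<beta>" using iDB iKB by (simp add: DB_def \<beta>_def)
      finally show ?thesis .
    qed
    have approx: "(1 - 2 * e) * DB - b * (e + (1 - 2 * e) * \<beta>) \<le> (\<integral>\<omega>. max 0 (Z \<omega> - b) \<partial>P)" if e: "0 < e" "e < 1 / 2" for e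
    proof -
      define f where "f y = e + (1 - 2 * e) * indicator B y" for y
      have f: "f \<in> borel_measurable borel" "e \<le> f y \<and> f y \<le> 1 - e" for y
        using e B by (auto simp: f_def[abs_def] f_def indicator_def)
      define p where "p = evolve f x t"
      have p: "p = e + (1 - 2 * e) * \<beta>"
      proof -
        have "p = (\<integral>y. e * K x t y s + (1 - 2 * e) * (K x t y s * indicator B y) \<partial>\<mu>)"
          unfolding p_def evolve_def f_def by (intro Bochner_Integration.integral_cong refl) (simp add: algebra_simps)
        then show ?thesis using int_K iKB by (simp add: kernel_mass[OF tt] \<beta>_def)
      qed
      have "(\<integral>y. dK c v x t y * f y \<partial>\<mu>) = (\<integral>y. e * dK c v x t y + (1 - 2 * e) * (dK c v x t y * indicator B y) \<partial>\<mu>)"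
        unfolding f_def by (intro Bochner_Integration.integral_cong refl) (simp add: algebra_simps)
      also have "\<dots> = (1 - 2 * e) * DB" using int_dK iDB by (simp add: dK_mean_zero[OF c] DB_def)
      finally have "(1 - 2 * e) * DB \<le> \<sigma> * std_normal_density (Psi p)"
        using dK_bound[OF f e(1) c v] by (simp add: \<sigma>_def p_def)
      moreover have "Phi (Psi p) = p"
        using evolve_range[OF f e(1) tt, of x] e by (intro Phi_Psi) (auto simp: p_def)
      ultimately show ?thesis using gauss(3)[of "Psi p" b] by (simp add: p)
    qed
    have "((\<lambda>e. (1 - 2 * e) * DB - b * (e + (1 - 2 * e) * \<beta>)) \<longlongrightarrow> (1 - 2 * 0) * DB - b * (0 + (1 - 2 * 0) * \<beta>)) (at_right 0)"
      by (intro tendsto_intros)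
    moreover have "\<forall>\<^sub>F e in at_right 0. (1 - 2 * e) * DB - b * (e + (1 - 2 * e) * \<beta>) \<le> (\<integral>\<omega>. max 0 (Z \<omega> - b) \<partial>P)"
      unfolding eventually_at_right_field by (rule exI[of _ "1/2"]) (use approx in auto)
    ultimately have "(1 - 2 * 0) * DB - b * (0 + (1 - 2 * 0) * \<beta>) \<le> (\<integral>\<omega>. max 0 (Z \<omega> - b) \<partial>P)"
      by (rule tendsto_upperbound) simp
    then show ?thesis unfolding lhs by simp
  qed
  show ?thesis unfolding \<nu>_def[symmetric]
    by unfold_locales (simp_all add: int_S mean stop gauss)
qed

lemma score_eq:
  assumes c: "c \<in> A" "x \<in> cdom c" and pos: "K x t y s > 0"
  shows "gradient (g t) (\<lambda>x'. ln (K x' t y s)) x c \<bullet> (g t c x *v v) = score c v x y"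
proof -
  have tt: "t \<in> {s<..t}" using less by simp
  define z where "z = coord c x"
  define D where "D = frechet_derivative (\<lambda>z. K (cinv c z) t y s) (at z)"
  have Kz: "K (cinv c z) t y s = K x t y s" by (simp add: z_def chart_facts(2)[OF atlas c])
  have D: "((\<lambda>z. K (cinv c z) t y s) has_derivative D) (at z)"
    using kernel_up_to_time(3)[OF c tt, of y] by (simp add: D_def z_def frechet_derivative_works)
  have "((\<lambda>z. ln (K (cinv c z) t y s)) has_derivative (\<lambda>b. D b * inverse (K x t y s))) (at z)"
    using has_derivative_ln[OF _ D] pos by (simp add: Kz divide_inverse)
  from pderiv_unique[OF this] have d: "pderiv_at i (\<lambda>z. ln (K (cinv c z) t y s)) z = D (axis i 1) / K x t y s" for i
    by (simp add: divide_inverse)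
  define d where "d = (\<chi> i. pderiv_at i ((\<lambda>x'. ln (K x' t y s)) \<circ> cinv c) (coord c x))"
  interpret cm: coordinate_metric "cimg c" "in_chart (g t) c" by (rule chart_metric[OF atlas metric[OF t] c(1)])
  have zU: "z \<in> cimg c" unfolding z_def by (rule chart_facts(1)[OF atlas c])
  have G: "in_chart (g t) c z = g t c x" by (simp add: in_chart_def z_def chart_facts(2)[OF atlas c])
  have inv: "invertible (g t c x)" using cm.inv_g[OF zU] unfolding G .
  have sym: "transpose (g t c x) = g t c x" using cm.metric_sym[OF zU] unfolding G by (simp add: transpose_def vec_eq_iff)
  have "gradient (g t) (\<lambda>x'. ln (K x' t y s)) x c \<bullet> (g t c x *v v) = (matrix_inv (g t c x) *v d) \<bullet> (g t c x *v v)"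
    by (simp add: gradient_def d_def)
  also have "\<dots> = (transpose (g t c x) *v (matrix_inv (g t c x) *v d)) \<bullet> v"
    unfolding transpose_matrix_vector dot_lmul_matrix ..
  also have "\<dots> = d \<bullet> v" by (simp add: sym matrix_vector_mul_assoc matrix_inv_right[OF inv])
  also have "\<dots> = (\<Sum>i\<in>UNIV. v $ i * D (axis i 1)) / K x t y s"
    by (simp add: inner_vec_def d_def o_def d[unfolded z_def] sum_divide_distrib mult.commute)
  also have "(\<Sum>i\<in>UNIV. v $ i * D (axis i 1)) = D v" by (rule derivative_eq_sum_partials[OF D, symmetric])
  finally show ?thesis by (simp add: score_def dK_def D_def z_def)
qed

end

lemma ext_integral_cong_AE:
  assumes "AE x in M. f x = g x"
  shows "ext_integral M f = ext_integral M g"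
proof -
  have "(\<integral>\<^sup>+ x. ennreal (f x) \<partial>M) = (\<integral>\<^sup>+ x. ennreal (g x) \<partial>M)"
    "(\<integral>\<^sup>+ x. ennreal (- f x) \<partial>M) = (\<integral>\<^sup>+ x. ennreal (- g x) \<partial>M)"
    using assms by (auto intro!: nn_integral_cong_AE)
  then show ?thesis by (simp add: ext_integral_def)
qed

theorem theorem5p2:
  fixes A :: "('m::{t2_space,second_countable_topology}, 'n::finite) chart set"
    and I :: "real set"
    and g :: "real \<Rightarrow> ('m, 'n) metric_field"
    and vol :: "real \<Rightarrow> 'm measure"
    and K :: "'m \<Rightarrow> real \<Rightarrow> 'm \<Rightarrow> real \<Rightarrow> real"
    and x :: 'm
    and s t \<tau> :: real
    and v :: "('m, 'n) chart \<Rightarrow> real^'n"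
    and \<nu> :: "'m measure"
    and S :: "'m \<Rightarrow> real"
    and P :: "'z measure"
    and Z :: "'z \<Rightarrow> real"
    and \<psi> :: "real \<Rightarrow> real"
  assumes flow: "closed_Ricci_flow A I g"
    and vol: "\<And>r. r \<in> I \<Longrightarrow> riemannian_volume A (g r) (vol r)"
    and K: "heat_kernel A I g vol K"
    and times: "s \<in> I" "t \<in> I" "s < t"
    and \<tau>: "\<tau> = t - s"
    and \<nu>: "\<nu> = density (vol s) (\<lambda>y. ennreal (K x t y s))"
    and v: "v \<in> tangent_space A x" "metric_inner A (g t) x v v = 1"
    and S: "\<And>y. S y = metric_inner A (g t) x (gradient (g t) (\<lambda>x'. ln (K x' t y s)) x) v"
    and Z: "prob_space P" "distributed P lborel Z (normal_density 0 (sqrt (1 / (2 * \<tau>))))"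
    and \<psi>: "convex_on UNIV \<psi>"
    and wd: "integral_well_defined \<nu> (\<lambda>y. \<psi> (S y))" "integral_well_defined P (\<lambda>\<omega>. \<psi> (Z \<omega>))"
  shows "ext_integral \<nu> (\<lambda>y. \<psi> (S y)) \<le> ext_integral P (\<lambda>\<omega>. \<psi> (Z \<omega>))"
proof -
  interpret heat_kernel_slice A I g vol K s t
    by (rule heat_kernel_slice.intro[OF flow vol[OF times(1)] K times])
  define c where "c = (SOME c. c \<in> A \<and> x \<in> cdom c)"
  have c: "c \<in> A" "x \<in> cdom c"
    using someI_ex[of "\<lambda>c. c \<in> A \<and> x \<in> cdom c"] atlas_cover[OF atlas, of x] unfolding c_def by blast+
  have inner: "metric_inner A (g t) x u w = u c \<bullet> (g t c x *v w c)" for u w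
    by (simp add: metric_inner_def c_def Let_def)
  have "v c \<bullet> (g t c x *v v c) = 1" using v(2) by (simp add: inner)
  from score_stop_loss[OF c this Z(1) Z(2)[unfolded \<tau>]]
  interpret stop_loss_order \<nu> P "score c (v c) x" Z unfolding \<nu> .
  have "AE y in \<nu>. S y = score c (v c) x y"
  proof -
    have tt: "t \<in> {s<..t}" using less by simp
    have "(\<lambda>y. K x t y s) \<in> borel_measurable (vol s)"
      using kernel_integrable[of "\<lambda>_. 1" t x] tt by (auto dest: borel_measurable_integrable)
    then show ?thesis unfolding \<nu>
      by (subst AE_density) (auto simp: S inner score_eq[OF c])
  qed
  then have "ext_integral \<nu> (\<lambda>y. \<psi> (S y)) = ext_integral \<nu> (\<lambda>y. \<psi> (score c (v c) x y))"
    by (intro ext_integral_cong_AE) auto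
  then show ?thesis using ext_integral_convex_le[OF \<psi>] by simp
qed

end
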